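(* Let $\rho$ be a faithful state on $\mathcal{M}$, and let $\mathcal{N}$ be a von Neumann subalgebra of $\mathcal{M}$. Let $\mathcal{C}$ be the fixed-point algebra of the Accardi-Cecchini coarse graining operator $\mathcal{A}_\rho$. Let $\mathcal{H}$ be the finite dimensional Hilbert space on which $\mathcal{M}$ acts, and let $\mathcal{H} = \bigoplus_{j=1}^J \mathcal{H}_{j,\ell}\otimes \mathcal{H}_{j,r}$ be the decomposition induced by the decomposition of $\mathcal{C}$ as a direct sum of factors, with $P_j$ the orthogonal projection onto $\mathcal{H}_{j,\ell}\otimes\mathcal{H}_{j,r}$. (a) There are uniquely determined density matrices $\{\gamma_{1,\ell},\dots,\gamma_{J,\ell}\}$, where $\gamma_{j,\ell}$ acts on $\mathcal{H}_{j,\ell}$ and $\gamma_{j,\ell}\otimes \mathbf{1}_{\mathcal{H}_{j,r}}\in \mathcal{M}$, such that $$\rho = \bigoplus_{j=1}^J \gamma_{j,\ell}\otimes \mathrm{Tr}_{\mathcal{H}_{j,\ell}}(P_j\rho P_j) .$$ (b) Moreover, for each $j$, $\mathcal{E}_\tau (\gamma_{j,\ell}\otimes \mathbf{1}_{\mathcal{H}_{j,r}})$ has the form $\widetilde{\gamma}_{j,\ell}\otimes \mathbf{1}_{\mathcal{H}_{j,r}}$ for an operator $\widetilde\gamma_{j,\ell}$ on $\mathcal{H}_{j,\ell}$, and $$\rho_{\mathcal{N}} = \bigoplus_{j=1}^J \widetilde\gamma_{j,\ell}\otimes \mathrm{Tr}_{\mathcal{H}_{j,\ell}}(P_j\rho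 P_j) .$$ (c) A state $\sigma$ on $\mathcal{M}$ solves the Petz equation $\mathcal{R}_\rho(\sigma_{\mathcal{N}}) = \sigma$ if and only if for all $X\in\mathcal{M}$, $\sigma(X) = \sigma(\mathcal{E}_{\mathcal{C},\rho}(X))$; i.e., if and only if expectations with respect to $\sigma$ are preserved under the conditional expectation given $\mathcal{C}$ under $\rho$. Every such state $\sigma$ has the form $$\sigma = \bigoplus_{j=1}^J \gamma_{j,\ell}\otimes \mathrm{Tr}_{\mathcal{H}_{j,\ell}}(P_j\sigma P_j)$$ for the same $\{\gamma_{1,\ell},\dots,\gamma_{J,\ell}\}$.
   Context: $\mathcal{M}$ is a finite dimensional von Neumann algebra, regarded as a unital $*$-subalgebra of $M_n(\mathbb{C})=\mathcal{B}(\mathcal{H})$, $\mathcal{H}=\mathbb{C}^n$; $\mathrm{Tr}$ is the trace on $M_n(\mathbb{C})$, $\mathbf{1}$ the identity. A von Neumann subalgebra is a $*$-subalgebra containing $\mathbf{1}$. States on $\mathcal{M}$ are identified with density matrices $\rho\in\mathcal{M}$ ($\rho\ge0$, $\mathrm{Tr}[\rho]=1$) via $\rho(X)=\mathrm{Tr}[\rho X]$; faithful means $\rho$ invertible. $\mathcal{E}_\tau:\mathcal{M}\to\mathcal{N}$ is the tracial conditional expectation, i.e. the orthogonal projection of $\mathcal{M}$ onto $\mathcal{N}$ for $\langle X,Y\rangle_{HS}=\mathrm{Tr}[X^*Y]$; for a state $\sigma$, $\sigma_{\mathcal{N}}=\mathcal{E}_\tau(\sigma)$. The Accardi-Cecchini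 coarse graining operator $\mathcal{A}_\rho:\mathcal{M}\to\mathcal{N}$ is $\mathcal{A}_\rho(X)=\rho_{\mathcal{N}}^{-1/2}\mathcal{E}_\tau(\rho^{1/2}X\rho^{1/2})\rho_{\mathcal{N}}^{-1/2}$; equivalently $\mathrm{Tr}[\rho^{1/2}X^*\rho^{1/2}Y]=\mathrm{Tr}[\rho_{\mathcal{N}}^{1/2}\mathcal{A}_\rho(X)^*\rho_{\mathcal{N}}^{1/2}Y]$ for all $X\in\mathcal{M}$, $Y\in\mathcal{N}$. The Petz recovery map is its Hilbert-Schmidt adjoint $\mathcal{R}_\rho(\gamma)=\rho^{1/2}\rho_{\mathcal{N}}^{-1/2}\gamma\rho_{\mathcal{N}}^{-1/2}\rho^{1/2}$, $\gamma\in\mathcal{N}$. The fixed-point set $\mathcal{C}=\{X\in\mathcal{M}:\mathcal{A}_\rho(X)=X\}$ is a von Neumann subalgebra of $\mathcal{N}$. Its center is spanned by a finite family $\{P_1,\dots,P_J\}$ of mutually orthogonal nonzero projections summing to $\mathbf{1}$ (the minimal central projections of $\mathcal{C}$); the range of $P_j$ factors as $\mathcal{H}_{j,\ell}\otimes\mathcal{H}_{j,r}$ in such a way that $\mathcal{C}$ consists exactly of the operators $\sum_{j=1}^J\mathbf{1}_{\mathcal{H}_{j,\ell}}\otimes A_{j,r}$ with $A_{j,r}\in\mathcal{B}(\mathcal{H}_{j,r})$. Operators on the range of $P_j$ (such as $\gamma_{j,\ell}\otimes\mathbf{1}_{\mathcal{H}_{j,r}}$) are regarded as operators on $\mathcal{H}$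 by setting them to zero on the orthogonal complement. $\mathrm{Tr}_{\mathcal{H}_{j,\ell}}$ is the partial trace over $\mathcal{H}_{j,\ell}$, from operators on $\mathcal{H}_{j,\ell}\otimes\mathcal{H}_{j,r}$ to operators on $\mathcal{H}_{j,r}$. $\mathcal{E}_{\mathcal{C},\rho}$, the conditional expectation given $\mathcal{C}$ under $\rho$, is the orthogonal projection of $\mathcal{M}$ onto $\mathcal{C}$ in the GNS inner product $\langle X,Y\rangle_{GNS,\rho}=\mathrm{Tr}[\rho X^*Y]$. *)

theory Defs
  imports "Jordan_Normal_Form.Schur_Decomposition" "Jordan_Normal_Form.Gauss_Jordan_Elimination"
begin

text \<open>Operators on \<open>\<complex>\<^sup>n\<close> are the elements of \<open>carrier_mat n n\<close>.\<close>

definition mat_tr :: "complex mat \<Rightarrow> complex" where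
  "mat_tr A = (\<Sum>i<dim_row A. A $$ (i, i))"

text \<open>The order on \<^typ>\<open>complex\<close> makes \<open>0 \<le> z\<close> mean that \<open>z\<close> is real and nonnegative, so
  self-adjointness is implied here.\<close>

definition psd_mat :: "nat \<Rightarrow> complex mat \<Rightarrow> bool" where
  "psd_mat n A \<longleftrightarrow> A \<in> carrier_mat n n \<and> (\<forall>v\<in>carrier_vec n. 0 \<le> (A *\<^sub>v v) \<bullet>c v)"

definition density_matrix :: "nat \<Rightarrow> complex mat \<Rightarrow> bool" where
  "density_matrix n \<rho> \<longleftrightarrow> psd_mat n \<rho> \<and> mat_tr \<rho> = 1"

definition psd_sqrt :: "complex mat \<Rightarrow> complex mat" where
  "psd_sqrt A = (THE B. psd_mat (dim_row A) B \<and> B * B = A)"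

definition psd_inv_sqrt :: "complex mat \<Rightarrow> complex mat" where
  "psd_inv_sqrt A = the (mat_inverse (psd_sqrt A))"

text \<open>In finite dimension, von Neumann algebras are the unital *-subalgebras of \<open>M\<^sub>n(\<complex>)\<close>.\<close>

definition vn_algebra :: "nat \<Rightarrow> complex mat set \<Rightarrow> bool" where
  "vn_algebra n M \<longleftrightarrow> M \<subseteq> carrier_mat n n \<and> 1\<^sub>m n \<in> M \<and>
     (\<forall>A\<in>M. \<forall>B\<in>M. A + B \<in> M \<and> A * B \<in> M) \<and>
     (\<forall>A\<in>M. mat_adjoint A \<in> M \<and> (\<forall>c. c \<cdot>\<^sub>m A \<in> M))"

definition mat_center :: "complex mat set \<Rightarrow> complex mat set" where
  "mat_center C = {Z \<in> C. \<forall>X\<in>C. Z * X = X * Z}"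

definition state_on :: "nat \<Rightarrow> complex mat set \<Rightarrow> complex mat \<Rightarrow> bool" where
  "state_on n M \<rho> \<longleftrightarrow> \<rho> \<in> M \<and> density_matrix n \<rho>"

definition hs_inner :: "complex mat \<Rightarrow> complex mat \<Rightarrow> complex" where
  "hs_inner X Y = mat_tr (mat_adjoint X * Y)"

definition gns_inner :: "complex mat \<Rightarrow> complex mat \<Rightarrow> complex mat \<Rightarrow> complex" where
  "gns_inner \<rho> X Y = mat_tr (\<rho> * mat_adjoint X * Y)"

definition orth_proj ::
  "(complex mat \<Rightarrow> complex mat \<Rightarrow> complex) \<Rightarrow> complex mat set \<Rightarrow> complex mat \<Rightarrow> complex mat" where
  "orth_proj ip S X = (THE Y. Y \<in> S \<and> (\<forall>Z\<in>S. ip Z (X - Y) = 0))"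

definition tracial_exp :: "complex mat set \<Rightarrow> complex mat \<Rightarrow> complex mat" where
  "tracial_exp N = orth_proj hs_inner N"

definition gns_exp :: "complex mat set \<Rightarrow> complex mat \<Rightarrow> complex mat \<Rightarrow> complex mat" where
  "gns_exp C \<rho> = orth_proj (gns_inner \<rho>) C"

definition accardi_cecchini :: "complex mat set \<Rightarrow> complex mat \<Rightarrow> complex mat \<Rightarrow> complex mat" where
  "accardi_cecchini N \<rho> X =
     psd_inv_sqrt (tracial_exp N \<rho>) * tracial_exp N (psd_sqrt \<rho> * X * psd_sqrt \<rho>)
       * psd_inv_sqrt (tracial_exp N \<rho>)"

definition petz_recovery :: "complex mat set \<Rightarrow> complex mat \<Rightarrow> complex mat \<Rightarrow> complex mat" where
  "petz_recovery N \<rho> \<gamma> =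
     psd_sqrt \<rho> * psd_inv_sqrt (tracial_exp N \<rho>) * \<gamma> * psd_inv_sqrt (tracial_exp N \<rho>) * psd_sqrt \<rho>"

definition ac_fixed :: "complex mat set \<Rightarrow> complex mat set \<Rightarrow> complex mat \<Rightarrow> complex mat set" where
  "ac_fixed M N \<rho> = {X \<in> M. accardi_cecchini N \<rho> X = X}"

text \<open>The basis vector \<open>e\<^sub>i \<otimes> e\<^sub>k\<close> of \<open>\<complex>\<^sup>p \<otimes> \<complex>\<^sup>q\<close> has index \<open>i * q + k\<close> in \<open>\<complex>\<^sup>p\<^sup>q\<close>.\<close>

definition mat_tensor :: "complex mat \<Rightarrow> complex mat \<Rightarrow> complex mat" (infixl \<open>\<otimes>\<^sub>m\<close> 70) where
  "A \<otimes>\<^sub>m B = mat (dim_row A * dim_row B) (dim_col A * dim_col B)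
     (\<lambda>(i, j). A $$ (i div dim_row B, j div dim_col B) * B $$ (i mod dim_row B, j mod dim_col B))"

definition partial_trace_left :: "nat \<Rightarrow> nat \<Rightarrow> complex mat \<Rightarrow> complex mat" where
  "partial_trace_left p q X = mat q q (\<lambda>(a, b). \<Sum>i<p. X $$ (i * q + a, i * q + b))"

definition msum :: "nat \<Rightarrow> (nat \<Rightarrow> complex mat) \<Rightarrow> nat \<Rightarrow> complex mat" where
  "msum n X J = finsum (module_mat TYPE(complex) n n) X {..<J}"

text \<open>A decomposition of \<open>H = \<complex>\<^sup>n\<close> into blocks \<open>H\<^sub>l \<otimes> H\<^sub>r\<close>, indexed by \<open>j < nblocks D\<close>. Choosing
  orthonormal bases, the factors of the \<open>j\<close>-th block are \<open>\<complex>\<^sup>p\<close> and \<open>\<complex>\<^sup>q\<close> with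
  \<open>p = ldim D j\<close> and \<open>q = rdim D j\<close>, and \<open>incl D j\<close> is the isometry from \<open>\<complex>\<^sup>p \<otimes> \<complex>\<^sup>q\<close> into \<open>H\<close>
  that identifies the tensor product with the block.\<close>

record block_decomp =
  nblocks :: nat
  ldim :: "nat \<Rightarrow> nat"
  rdim :: "nat \<Rightarrow> nat"
  incl :: "nat \<Rightarrow> complex mat"

definition block_proj :: "block_decomp \<Rightarrow> nat \<Rightarrow> complex mat" where
  "block_proj D j = incl D j * mat_adjoint (incl D j)"

text \<open>\<open>block_embed\<close> extends an operator on a block by zero to \<open>H\<close>; \<open>block_restrict\<close> views an
  operator on \<open>H\<close> of the form \<open>P\<^sub>j Y P\<^sub>j\<close> as an operator on the block.\<close>

definition block_embed :: "block_decomp \<Rightarrow> nat \<Rightarrow> complex mat \<Rightarrow> complex mat" where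
  "block_embed D j X = incl D j * X * mat_adjoint (incl D j)"

definition block_restrict :: "block_decomp \<Rightarrow> nat \<Rightarrow> complex mat \<Rightarrow> complex mat" where
  "block_restrict D j Y = mat_adjoint (incl D j) * Y * incl D j"

definition block_sum :: "nat \<Rightarrow> block_decomp \<Rightarrow> (nat \<Rightarrow> complex mat) \<Rightarrow> complex mat" where
  "block_sum n D X = msum n (\<lambda>j. block_embed D j (X j)) (nblocks D)"

text \<open>\<open>Tr\<^sub>l(P\<^sub>j Y P\<^sub>j)\<close>, the trace being taken over the left factor of the \<open>j\<close>-th block.\<close>

definition right_marginal :: "block_decomp \<Rightarrow> nat \<Rightarrow> complex mat \<Rightarrow> complex mat" where
  "right_marginal D j Y = partial_trace_left (ldim D j) (rdim D j)
     (block_restrict D j (block_proj D j * Y * block_proj D j))"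

definition decomposes :: "nat \<Rightarrow> complex mat set \<Rightarrow> block_decomp \<Rightarrow> bool" where
  "decomposes n C D \<longleftrightarrow>
     (\<forall>j<nblocks D. 0 < ldim D j \<and> 0 < rdim D j \<and>
        incl D j \<in> carrier_mat n (ldim D j * rdim D j) \<and>
        mat_adjoint (incl D j) * incl D j = 1\<^sub>m (ldim D j * rdim D j)) \<and>
     (\<forall>i<nblocks D. \<forall>j<nblocks D. i \<noteq> j \<longrightarrow> block_proj D i * block_proj D j = 0\<^sub>m n n) \<and>
     msum n (block_proj D) (nblocks D) = 1\<^sub>m n \<and>
     mat_center C = {msum n (\<lambda>j. c j \<cdot>\<^sub>m block_proj D j) (nblocks D) | c. True} \<and>
     C = {block_sum n D (\<lambda>j. 1\<^sub>m (ldim D j) \<otimes>\<^sub>m A j) | A.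
            \<forall>j<nblocks D. A j \<in> carrier_mat (rdim D j) (rdim D j)}"

definition left_densities ::
  "nat \<Rightarrow> complex mat set \<Rightarrow> block_decomp \<Rightarrow> complex mat \<Rightarrow> (nat \<Rightarrow> complex mat) \<Rightarrow> bool" where
  "left_densities n M D \<rho> \<gamma> \<longleftrightarrow>
     (\<forall>j<nblocks D. density_matrix (ldim D j) (\<gamma> j) \<and>
        block_embed D j (\<gamma> j \<otimes>\<^sub>m 1\<^sub>m (rdim D j)) \<in> M) \<and>
     \<rho> = block_sum n D (\<lambda>j. \<gamma> j \<otimes>\<^sub>m right_marginal D j \<rho>)"

end

theory Submission
  imports Defs
begin

text \<open>
  Write \<open>s = \<rho>\<^sup>1\<^sup>/\<^sup>2\<close>, \<open>t = \<rho>\<^sub>N\<^sup>1\<^sup>/\<^sup>2\<close> and \<open>E\<close> for the tracial expectation onto \<open>N\<close>. The equation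
  \<open>E(s X s) = t X t\<close> for a fixed point \<open>X\<close> forces the Hilbert--Schmidt norm of \<open>s X - t X t\<^sup>-\<^sup>1 s\<close> to vanish,
  so \<open>X\<close> is fixed iff \<open>X \<in> N\<close> and \<open>s X s\<^sup>-\<^sup>1 = t X t\<^sup>-\<^sup>1\<close>. Hence conjugation by \<open>\<rho>\<close> and by \<open>\<rho>\<^sub>N\<close> induce the
  same automorphism of the fixed-point algebra \<open>C\<close>, and it is also induced by the trace-preserving
  projection \<open>\<kappa>\<close> of \<open>\<rho>\<close> to \<open>C\<close>. Thus \<open>\<kappa>\<^sup>-\<^sup>1 \<rho>\<close> and \<open>\<kappa>\<^sup>-\<^sup>1 \<rho>\<^sub>N\<close> lie in the commutant of \<open>C\<close>, whose elements are
  block sums of operators \<open>g \<otimes> 1\<close>, while \<open>\<kappa>\<close> is a block sum of operators \<open>1 \<otimes> k\<close>; this gives (a) and (b).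
  For (c), \<open>\<sigma>\<close> solves the Petz equation iff \<open>s\<^sup>-\<^sup>1 \<sigma> s\<^sup>-\<^sup>1\<close> is a fixed point, iff \<open>\<sigma> \<in> \<rho> C\<close>. As the conditional
  expectation is \<open>X \<mapsto> E\<^sub>C(X \<rho>) \<kappa>\<^sup>-\<^sup>1\<close>, its preservation also means \<open>\<sigma> = \<rho> \<kappa>\<^sup>-\<^sup>1 E\<^sub>C(\<sigma>)\<close>.
\<close>

section \<open>Adjoints, traces and unitary diagonalization\<close>

text \<open>The obstacle is that \<rho> need neither lie in \<open>C\<close> nor commute with it, so
  its block form cannot be read off directly. What survives is that \<rho> moves past
  \<open>C\<close>: \<open>\<rho> * X = Y * \<rho>\<close> with \<open>Y\<close> again in
  \<open>C\<close>. Indeed, for a fixed point \<open>X\<close> the operator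
  \<open>s * X * si\<close> (\<open>si\<close> the inverse of \<open>s\<close>) is fixed too: the
  expectation of \<open>\<rho> * X\<close> is \<open>\<rho>N * X\<close>, which equals
  \<open>t * (t * X * ti) * t\<close>. The trace-preserving projection onto \<open>C\<close> is a
  \<open>C\<close>-bimodule map, so applied to \<open>\<rho> * X = Y * \<rho>\<close> it gives
  \<open>\<kappa> * X = Y * \<kappa>\<close>; dividing the two relations leaves an operator that
  commutes with \<open>X\<close>. The same \<open>Y\<close> serves \<rho> and
  \<open>\<rho>N\<close>. Hence both have the same right factor on each block, that of \<kappa>, and
  the right marginal of \<rho> can reappear in (b). Multiplying \<rho> by an element of
  \<open>C\<close> changes right factors only, which is why the left factors in (c) are those of
  (a).\<close>

lemma mult_carrier_iff [simp]:
  "A * B \<in> carrier_mat r c \<longleftrightarrow> dim_row A = r \<and> dim_col B = c"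
  unfolding carrier_mat_def by simp

text \<open>The side conditions speak of dimensions instead of carriers, so that \<open>simp\<close>
  can discharge them while it brackets products to the right.\<close>

lemma mat_assoc:
  "dim_col A = dim_row B \<Longrightarrow> dim_col B = dim_row C \<Longrightarrow> (A * B) * C = A * (B * (C :: complex mat))"
  by (rule assoc_mult_mat[of _ "dim_row A" "dim_col A" _ "dim_col B" _ "dim_col C"]) (auto intro: carrier_matI)

lemma mat_adjoint_dim [simp]:
  "dim_row (mat_adjoint A) = dim_col A" "dim_col (mat_adjoint A) = dim_row A"
  by (auto simp: mat_adjoint_def)

lemma mat_adjoint_carrier [simp]:
  "mat_adjoint A \<in> carrier_mat n m \<longleftrightarrow> A \<in> carrier_mat m n"
  unfolding carrier_mat_def by (simp add: conj_commute)

lemma mat_adjoint_index [simp]: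
  assumes "i < dim_col A" "j < dim_row A"
  shows "mat_adjoint (A :: complex mat) $$ (i, j) = cnj (A $$ (j, i))"
  using assms unfolding mat_adjoint_def by (subst mat_of_rows_index) auto

lemma mat_adjoint_adjoint [simp]: "mat_adjoint (mat_adjoint (A :: complex mat)) = A"
  by (rule eq_matI) auto

lemma mat_mult_index:
  "i < dim_row A \<Longrightarrow> j < dim_col B \<Longrightarrow> dim_col A = dim_row B \<Longrightarrow>
   (A * B) $$ (i, j) = (\<Sum>k<dim_row B. A $$ (i, k) * B $$ (k, j))"
  by (simp add: scalar_prod_def lessThan_atLeast0)

lemma mat_adjoint_mult:
  assumes "dim_col A = dim_row B"
  shows "mat_adjoint (A * (B :: complex mat)) = mat_adjoint B * mat_adjoint A"
proof (rule eq_matI)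
  fix i j assume "i < dim_row (mat_adjoint B * mat_adjoint A)" "j < dim_col (mat_adjoint B * mat_adjoint A)"
  then show "mat_adjoint (A * B) $$ (i, j) = (mat_adjoint B * mat_adjoint A) $$ (i, j)"
    using assms by (simp add: mat_mult_index del: index_mult_mat(1)) (simp add: mult.commute)
qed auto

lemma mat_adjoint_add:
  "dim_row A = dim_row B \<Longrightarrow> dim_col A = dim_col B \<Longrightarrow>
   mat_adjoint (A + (B :: complex mat)) = mat_adjoint A + mat_adjoint B"
  by (rule eq_matI) auto

lemma mat_adjoint_minus:
  "dim_row A = dim_row B \<Longrightarrow> dim_col A = dim_col B \<Longrightarrow>
   mat_adjoint (A - (B :: complex mat)) = mat_adjoint A - mat_adjoint B"
  by (rule eq_matI) auto

lemma mat_adjoint_smult [simp]: "mat_adjoint (c \<cdot>\<^sub>m (A :: complex mat)) = cnj c \<cdot>\<^sub>m mat_adjoint A"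
  by (rule eq_matI) auto

lemma mat_adjoint_one [simp]: "mat_adjoint (1\<^sub>m n :: complex mat) = 1\<^sub>m n"
  by (rule eq_matI) auto

lemma mat_diag_dims [simp]: "dim_row (mat_diag n d) = n" "dim_col (mat_diag n d) = n"
  by (simp_all add: mat_diag_def)

lemma mat_adjoint_diag: "mat_adjoint (mat_diag n d :: complex mat) = mat_diag n (\<lambda>i. cnj (d i))"
  by (rule eq_matI) (auto simp: mat_diag_def)

lemma mat_tr_add:
  "dim_row A = dim_row B \<Longrightarrow> dim_col A = dim_col B \<Longrightarrow> dim_row A = dim_col A \<Longrightarrow>
   mat_tr (A + B) = mat_tr A + mat_tr B"
  by (simp add: mat_tr_def sum.distrib)

lemma mat_tr_minus:
  "dim_row A = dim_row B \<Longrightarrow> dim_col A = dim_col B \<Longrightarrow> dim_row A = dim_col A \<Longrightarrow>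
   mat_tr (A - B) = mat_tr A - mat_tr B"
  by (simp add: mat_tr_def sum_subtractf)

lemma mat_tr_smult [simp]: "dim_row A = dim_col A \<Longrightarrow> mat_tr (c \<cdot>\<^sub>m A) = c * mat_tr A"
  by (simp add: mat_tr_def sum_distrib_left)

lemma mat_tr_zero [simp]: "mat_tr (0\<^sub>m n n) = 0"
  by (simp add: mat_tr_def)

lemma mat_tr_one [simp]: "mat_tr (1\<^sub>m n) = of_nat n"
  by (simp add: mat_tr_def)

lemma mat_tr_adjoint: "dim_row A = dim_col A \<Longrightarrow> mat_tr (mat_adjoint A) = cnj (mat_tr A)"
  by (simp add: mat_tr_def)

lemma mat_tr_comm:
  assumes "dim_col A = dim_row B" "dim_col B = dim_row A"
  shows "mat_tr (A * B) = mat_tr (B * A)"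
proof -
  have "mat_tr (A * B) = (\<Sum>i<dim_row A. \<Sum>k<dim_row B. A $$ (i, k) * B $$ (k, i))"
    unfolding mat_tr_def using assms by (auto intro!: sum.cong simp: mat_mult_index simp del: index_mult_mat(1))
  also have "\<dots> = (\<Sum>k<dim_row B. \<Sum>i<dim_row A. B $$ (k, i) * A $$ (i, k))"
    by (subst sum.swap) (simp add: mult.commute)
  also have "\<dots> = mat_tr (B * A)"
    unfolding mat_tr_def using assms by (auto intro!: sum.cong simp: mat_mult_index simp del: index_mult_mat(1))
  finally show ?thesis .
qed

lemma hs_inner_sum:
  assumes "X \<in> carrier_mat n m" "Y \<in> carrier_mat n m"
  shows "hs_inner X Y = (\<Sum>(i, j)\<in>{..<n} \<times> {..<m}. cnj (X $$ (i, j)) * Y $$ (i, j))"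
proof -
  have "hs_inner X Y = (\<Sum>j<m. \<Sum>i<n. cnj (X $$ (i, j)) * Y $$ (i, j))"
    unfolding hs_inner_def mat_tr_def using assms
    by (auto intro!: sum.cong simp: mat_mult_index simp del: index_mult_mat(1))
  then show ?thesis by (subst (asm) sum.swap) (simp add: sum.cartesian_product)
qed

text \<open>The inner product of \<open>X\<close> with itself is the sum of the squared moduli of
  the entries, a real number.\<close>

lemma hs_inner_self:
  assumes "X \<in> carrier_mat n m"
  shows "0 \<le> hs_inner X X" "hs_inner X X = 0 \<longleftrightarrow> X = 0\<^sub>m n m"
proof -
  have e: "hs_inner X X = of_real (\<Sum>p\<in>{..<n} \<times> {..<m}. (cmod (X $$ p))\<^sup>2)"
    by (simp add: hs_inner_sum[OF assms assms] case_prod_beta complex_norm_square mult.commute del: of_real_power)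
  show "0 \<le> hs_inner X X" unfolding e by (simp add: sum_nonneg less_eq_complex_def del: of_real_sum)
  have "hs_inner X X = 0 \<longleftrightarrow> (\<forall>p\<in>{..<n} \<times> {..<m}. X $$ p = 0)"
    unfolding e of_real_eq_0_iff by (subst sum_nonneg_eq_0_iff) auto
  also have "\<dots> \<longleftrightarrow> X = 0\<^sub>m n m"
    using assms by (auto intro!: eq_matI)
  finally show "hs_inner X X = 0 \<longleftrightarrow> X = 0\<^sub>m n m" .
qed

lemma hs_inner_self_pos:
  assumes "X \<in> carrier_mat n m" "X \<noteq> 0\<^sub>m n m"
  shows "0 < hs_inner X X"
  using hs_inner_self[OF assms(1)] assms(2) by (auto simp: order_less_le)

section \<open>Unitary matrices and the spectral theorem for Hermitian matrices\<close>

definition unitary_mat :: "nat \<Rightarrow> complex mat \<Rightarrow> bool" where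
  "unitary_mat n U \<longleftrightarrow> U \<in> carrier_mat n n \<and> mat_adjoint U * U = 1\<^sub>m n \<and> U * mat_adjoint U = 1\<^sub>m n"

lemma unitary_matI:
  assumes "U \<in> carrier_mat n n" "mat_adjoint U * U = 1\<^sub>m n"
  shows "unitary_mat n U"
  using assms mat_mult_left_right_inverse[of "mat_adjoint U" n U] by (auto simp: unitary_mat_def)

lemma unitary_mat_mult:
  assumes "unitary_mat n U" "unitary_mat n V"
  shows "unitary_mat n (U * V)"
proof (rule unitary_matI)
  have [simp]: "U \<in> carrier_mat n n" "V \<in> carrier_mat n n" and d [simp]: "dim_row U = n" "dim_col U = n" "dim_row V = n" "dim_col V = n"
    using assms by (auto simp: unitary_mat_def)
  show "U * V \<in> carrier_mat n n" by simp
  have "mat_adjoint (U * V) * (U * V) = mat_adjoint V * ((mat_adjoint U * U) * V)"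
    by (simp add: mat_adjoint_mult mat_assoc)
  also have "\<dots> = 1\<^sub>m n" using assms by (simp add: unitary_mat_def)
  finally show "mat_adjoint (U * V) * (U * V) = 1\<^sub>m n" .
qed

text \<open>Gram-Schmidt applied to a basis that starts with \<open>v\<close> keeps \<open>v\<close>
  as its first vector. Normalising the resulting orthogonal vectors gives the columns of
  \<open>W\<close>, and \<open>c\<close> is the reciprocal norm of \<open>v\<close>.\<close>

lemma nonzero_vector_extends_to_unitary:
  assumes v: "v \<in> carrier_vec n" and v0: "v \<noteq> 0\<^sub>v n"
  shows "\<exists>W c. unitary_mat n W \<and> c \<noteq> 0 \<and> col W 0 = c \<cdot>\<^sub>v v"
proof -
  interpret cof_vec_space n "TYPE(complex)" .
  define b where "b = basis_completion v"
  define ws where "ws = gram_schmidt n b"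
  from basis_completion[OF v v0, folded b_def]
  have dist_b: "distinct b" and indep: "\<not> lin_dep (set b)" and b: "set b \<subseteq> carrier_vec n"
    and hdb: "hd b = v" and len_b: "length b = n" by auto
  have n: "0 < n" using v v0 by (cases n) auto
  from hdb len_b n obtain vs where bv: "b = v # vs" by (cases b, auto)
  from gram_schmidt_result[OF b dist_b indep refl, folded ws_def]
  have ws: "set ws \<subseteq> carrier_vec n" "corthogonal ws" "length ws = n"
    by (auto simp: len_b)
  from gram_schmidt_hd[OF v, of vs, folded bv] have hdws: "hd ws = v" unfolding ws_def .
  have ws0: "ws ! 0 = v" using hdws ws n by (cases ws) auto
  have wsc: "ws ! i \<in> carrier_vec n" if "i < n" for i using ws that by (auto simp: subset_iff)
  \<comment> \<open>The reciprocal norm of the vector \<open>ws ! i\<close>. Its square norm is a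
    complex number that is real and nonnegative, so \<open>cmod\<close> merely changes its
    type.\<close>
  define r where "r i = inverse (complex_of_real (sqrt (cmod (ws ! i \<bullet>c ws ! i))))" for i
  have nz: "ws ! i \<bullet>c ws ! i \<noteq> 0" if "i < n" for i
    using corthogonalD[OF ws(2), of i i] that ws(3) by simp
  define W where "W = mat n n (\<lambda>(i, j). r j * (ws ! j) $ i)"
  have W: "W \<in> carrier_mat n n" by (simp add: W_def)
  have "mat_adjoint W * W = 1\<^sub>m n"
  proof (rule eq_matI)
    fix i j assume ij: "i < dim_row (1\<^sub>m n :: complex mat)" "j < dim_col (1\<^sub>m n :: complex mat)"
    then have ij: "i < n" "j < n" by auto
    have "(mat_adjoint W * W) $$ (i, j) = (\<Sum>k<n. cnj (r i * (ws ! i) $ k) * (r j * (ws ! j) $ k))"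
      using ij W by (simp add: mat_mult_index W_def del: index_mult_mat(1))
    also have "\<dots> = cnj (r i) * r j * (ws ! j \<bullet>c ws ! i)"
      using wsc[OF ij(1)] wsc[OF ij(2)]
      by (simp add: scalar_prod_def sum_distrib_left lessThan_atLeast0 mult_ac)
    also have "\<dots> = (if i = j then 1 else 0)"
    proof (cases "i = j")
      case True
      have p: "0 \<le> ws ! i \<bullet>c ws ! i"
        by (rule conjugate_square_ge_0_vec)
      then have "ws ! i \<bullet>c ws ! i = of_real (cmod (ws ! i \<bullet>c ws ! i))"
        by (simp add: less_eq_complex_def complex_eq_iff cmod_eq_Re)
      moreover define y where "y = cmod (ws ! i \<bullet>c ws ! i)"
      ultimately have e: "ws ! i \<bullet>c ws ! i = of_real y" by simp
      have y: "0 < y" using nz[OF ij(1)] by (simp add: y_def)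
      have ri: "r i = of_real (inverse (sqrt y))"
        by (simp add: r_def y_def)
      have "cnj (r i) * r i * (ws ! i \<bullet>c ws ! i) = of_real (inverse (sqrt y) * inverse (sqrt y) * y)"
        by (simp only: ri e complex_cnj_complex_of_real of_real_mult)
      also have "inverse (sqrt y) * inverse (sqrt y) * y = 1"
        using y by (simp add: field_simps)
      finally show ?thesis using True by simp
    next
      case False
      then show ?thesis using corthogonalD[OF ws(2), of j i] ij ws(3) by simp
    qed
    finally show "(mat_adjoint W * W) $$ (i, j) = 1\<^sub>m n $$ (i, j)" using ij by simp
  qed (use W in auto)
  moreover have "col W 0 = r 0 \<cdot>\<^sub>v v"
    using n v ws0 by (intro eq_vecI) (auto simp: W_def)
  moreover have "r 0 \<noteq> 0" using nz[OF n] by (simp add: r_def)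
  ultimately show ?thesis using unitary_matI[OF W] by blast
qed

lemma mat_adjoint_four_block:
  assumes "A \<in> carrier_mat r1 c1" "B \<in> carrier_mat r1 c2" "C \<in> carrier_mat r2 c1" "D \<in> carrier_mat r2 c2"
  shows "mat_adjoint (four_block_mat A B C (D :: complex mat)) =
    four_block_mat (mat_adjoint A) (mat_adjoint C) (mat_adjoint B) (mat_adjoint D)"
  using assms by (intro eq_matI) auto

lemma eigenvector_smult:
  fixes A :: "complex mat"
  assumes "A \<in> carrier_mat n n" "v \<in> carrier_vec n" "A *\<^sub>v v = e \<cdot>\<^sub>v v" "w = c \<cdot>\<^sub>v v"
  shows "A *\<^sub>v w = e \<cdot>\<^sub>v w"
proof -
  have "A *\<^sub>v (c \<cdot>\<^sub>v v) = c \<cdot>\<^sub>v (e \<cdot>\<^sub>v v)"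
    using mult_mat_vec[OF assms(1,2), of c] assms(3) by simp
  also have "\<dots> = e \<cdot>\<^sub>v (c \<cdot>\<^sub>v v)"
    by (rule eq_vecI) auto
  finally show ?thesis by (simp only: assms(4))
qed

text \<open>Deflation: a unitary whose first column is a multiple of an eigenvector turns
  \<open>A\<close> into a matrix with first column \<open>e\<close> times a unit vector.
  Self-adjointness clears the first row as well, and the remaining block is Hermitian of size one
  less.\<close>

lemma hermitian_unitary_diagonalization:
  assumes "A \<in> carrier_mat n n" "mat_adjoint A = (A :: complex mat)"
  shows "\<exists>U d. unitary_mat n U \<and> A = U * mat_diag n d * mat_adjoint U"
  using assms
proof (induction n arbitrary: A)
  case 0
  then show ?case by (intro exI[of _ "1\<^sub>m 0"] exI[of _ "\<lambda>_. 0"]) (auto simp: unitary_mat_def intro!: eq_matI)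
next
  case (Suc n)
  obtain as where "char_poly A = (\<Prod>a\<leftarrow>as. [:- a, 1:])" "length as = Suc n"
    using char_poly_factorized[OF Suc.prems(1)] by auto
  then obtain e where "poly (char_poly A) e = 0" by (cases as) auto
  then have "eigenvalue A e" using eigenvalue_root_char_poly[OF Suc.prems(1)] by simp
  then obtain v where v: "v \<in> carrier_vec (Suc n)" "v \<noteq> 0\<^sub>v (Suc n)" "A *\<^sub>v v = e \<cdot>\<^sub>v v"
    unfolding eigenvalue_def eigenvector_def using Suc.prems by auto
  obtain W c where W: "unitary_mat (Suc n) W" and c: "col W 0 = c \<cdot>\<^sub>v v"
    using nonzero_vector_extends_to_unitary[OF v(1,2)] by blast
  have Wc [simp]: "W \<in> carrier_mat (Suc n) (Suc n)" "dim_row W = Suc n" "dim_col W = Suc n"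
    and Ac [simp]: "A \<in> carrier_mat (Suc n) (Suc n)" "dim_row A = Suc n" "dim_col A = Suc n"
    using W Suc.prems by (auto simp: unitary_mat_def)
  have WW: "mat_adjoint W * W = 1\<^sub>m (Suc n)" "W * mat_adjoint W = 1\<^sub>m (Suc n)"
    using W by (auto simp: unitary_mat_def)
  define B where "B = mat_adjoint W * A * W"
  have Bc [simp]: "B \<in> carrier_mat (Suc n) (Suc n)" "dim_row B = Suc n" "dim_col B = Suc n" by (simp_all add: B_def)
  have BB: "mat_adjoint B = B"
    using Suc.prems(2) by (simp add: B_def mat_adjoint_mult mat_assoc)
  have col: "col B 0 = e \<cdot>\<^sub>v unit_vec (Suc n) 0"
  proof -
    have "col B 0 = mat_adjoint W *\<^sub>v (A *\<^sub>v col W 0)"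
      by (simp add: B_def mat_assoc col_mult2[of "mat_adjoint W" "Suc n" "Suc n" _ "Suc n"]
          col_mult2[of A "Suc n" "Suc n" _ "Suc n"])
    moreover have "A *\<^sub>v col W 0 = e \<cdot>\<^sub>v col W 0"
      using Suc.prems(1) v(1,3) c by (rule eigenvector_smult)
    moreover have "mat_adjoint W *\<^sub>v (e \<cdot>\<^sub>v col W 0) = e \<cdot>\<^sub>v (mat_adjoint W *\<^sub>v col W 0)"
      by (rule mult_mat_vec[of _ "Suc n" "Suc n"]) (auto intro!: carrier_vecI)
    moreover have "mat_adjoint W *\<^sub>v col W 0 = col (mat_adjoint W * W) 0"
      by (rule col_mult2[of _ "Suc n" "Suc n" _ "Suc n", symmetric]) auto
    ultimately show ?thesis unfolding WW by (simp only:) simp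
  qed
  have B0: "B $$ (i, 0) = (if i = 0 then e else 0)" if "i < Suc n" for i
    using arg_cong[OF col, of "\<lambda>v. v $ i"] that by auto
  \<comment> \<open>The zeros of the first column are transferred to the first row by conjugate
    symmetry; the case \<open>i = 0\<close> only repeats the corner entry.\<close>
  have B0': "B $$ (0, i) = (if i = 0 then e else 0)" if "i < Suc n" for i
    using arg_cong[OF BB, of "\<lambda>M. M $$ (0, i)"] B0[of i] B0[of 0] that by (auto split: if_splits)
  define A' where "A' = mat n n (\<lambda>(i, j). B $$ (Suc i, Suc j))"
  have A'c [simp]: "A' \<in> carrier_mat n n" by (simp add: A'_def)
  have "mat_adjoint A' = A'"
  proof (rule eq_matI)
    fix i j assume "i < dim_row A'" "j < dim_col A'"
    then show "mat_adjoint A' $$ (i, j) = A' $$ (i, j)"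
      using arg_cong[OF BB, of "\<lambda>M. M $$ (Suc i, Suc j)"] by (simp add: A'_def)
  qed (auto simp: A'_def)
  from Suc.IH[OF A'c this] obtain U d where U: "unitary_mat n U"
    and A': "A' = U * mat_diag n d * mat_adjoint U" by blast
  have Uc [simp]: "U \<in> carrier_mat n n" using U by (simp add: unitary_mat_def)
  define E where "E = mat 1 1 (\<lambda>_. e)"
  have Ec [simp]: "E \<in> carrier_mat 1 1" by (simp add: E_def)
  have B: "B = four_block_mat E (0\<^sub>m 1 n) (0\<^sub>m n 1) A'"
    by (rule eq_matI) (auto simp: E_def A'_def B0 B0')
  define V where "V = four_block_mat (1\<^sub>m 1) (0\<^sub>m 1 n) (0\<^sub>m n 1) U"
  have Vc [simp]: "V \<in> carrier_mat (Suc n) (Suc n)" unfolding V_def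
    using four_block_carrier_mat[of "1\<^sub>m 1" 1 1 U n n "0\<^sub>m 1 n" "0\<^sub>m n 1"] by simp
  have [simp]: "mat_adjoint (0\<^sub>m k l) = (0\<^sub>m l k :: complex mat)" for k l by (rule eq_matI) auto
  have Va: "mat_adjoint V = four_block_mat (1\<^sub>m 1) (0\<^sub>m 1 n) (0\<^sub>m n 1) (mat_adjoint U)"
    unfolding V_def by (subst mat_adjoint_four_block[of _ 1 1 _ n _ n]) auto
  \<comment> \<open>\<open>case_nat e d\<close> puts the eigenvalue that was split off at index 0
    and shifts the others by one.\<close>
  have diag: "mat_diag (Suc n) (case_nat e d) = four_block_mat E (0\<^sub>m 1 n) (0\<^sub>m n 1) (mat_diag n d)"
    by (rule eq_matI) (auto simp: E_def mat_diag_def split: nat.splits)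
  have bd: "four_block_mat F (0\<^sub>m 1 n) (0\<^sub>m n 1) X * four_block_mat G (0\<^sub>m 1 n) (0\<^sub>m n 1) Y =
      four_block_mat (F * G) (0\<^sub>m 1 n) (0\<^sub>m n 1) (X * Y)"
    if "F \<in> carrier_mat 1 1" "G \<in> carrier_mat 1 1" "X \<in> carrier_mat n n" "Y \<in> carrier_mat n n"
    for F G X Y :: "complex mat"
  proof -
    have "F * G \<in> carrier_mat 1 1" "X * Y \<in> carrier_mat n n" using that by simp_all
    then show ?thesis
      using that by (subst mult_four_block_mat[of _ 1 1 _ n _ n _ _ 1 _ n])
        (simp_all add: right_mult_zero_mat[of _ _ 1] right_mult_zero_mat[of _ _ n]
          left_mult_zero_mat[of _ _ 1] left_mult_zero_mat[of _ _ n])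
  qed
  have "mat_adjoint V * V = 1\<^sub>m (Suc n)"
    unfolding Va unfolding V_def
    using U by (subst bd) (simp_all add: unitary_mat_def four_block_one_mat[of 1 n, simplified])
  then have V: "unitary_mat (Suc n) V" by (intro unitary_matI) auto
  have BV: "B = V * mat_diag (Suc n) (case_nat e d) * mat_adjoint V"
    unfolding Va unfolding V_def diag B A'
    using bd[OF one_carrier_mat Ec Uc mat_diag_dim[of n d]]
      bd[OF Ec one_carrier_mat, of "U * mat_diag n d" "mat_adjoint U"] carrier_matD[OF Uc]
      left_mult_one_mat[OF Ec] right_mult_one_mat[OF Ec]
    by simp
  have "W * B * mat_adjoint W = (W * mat_adjoint W) * A * (W * mat_adjoint W)"
    by (simp add: B_def mat_assoc)
  then have "A = W * B * mat_adjoint W" by (simp add: WW)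
  also have "\<dots> = (W * V) * mat_diag (Suc n) (case_nat e d) * mat_adjoint (W * V)"
    using carrier_matD[OF Vc] carrier_matD[OF mat_diag_dim[of "Suc n" "case_nat e d"]]
    by (simp add: BV mat_adjoint_mult mat_assoc)
  finally show ?case using unitary_mat_mult[OF W V] by blast
qed

section \<open>Orthogonal projections and the tracial conditional expectation\<close>

lemma mat_add_mult:
  "dim_row A = dim_row B \<Longrightarrow> dim_col A = dim_col B \<Longrightarrow> dim_col A = dim_row C \<Longrightarrow>
   (A + B) * (C :: complex mat) = A * C + B * C"
  by (rule add_mult_distrib_mat[of _ "dim_row A" "dim_col A" _ _ "dim_col C"]) (rule carrier_matI; simp)+

lemma mat_mult_add:
  "dim_row B = dim_row C \<Longrightarrow> dim_col B = dim_col C \<Longrightarrow> dim_col A = dim_row C \<Longrightarrow>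
   A * (B + C :: complex mat) = A * B + A * C"
  by (rule mult_add_distrib_mat[of _ "dim_row A" "dim_col A" _ "dim_col C"]) (rule carrier_matI; simp)+

lemma mat_minus_mult:
  "dim_row A = dim_row B \<Longrightarrow> dim_col A = dim_col B \<Longrightarrow> dim_col A = dim_row C \<Longrightarrow>
   (A - B) * (C :: complex mat) = A * C - B * C"
  by (rule minus_mult_distrib_mat[of _ "dim_row A" "dim_col A" _ _ "dim_col C"]) (rule carrier_matI; simp)+

lemma mat_mult_minus:
  "dim_row B = dim_row C \<Longrightarrow> dim_col B = dim_col C \<Longrightarrow> dim_col A = dim_row C \<Longrightarrow>
   A * (B - C :: complex mat) = A * B - A * C"
  by (rule mult_minus_distrib_mat[of _ "dim_row A" "dim_col A" _ "dim_col C"]) (rule carrier_matI; simp)+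

lemma mat_smult_mult:
  "dim_col A = dim_row B \<Longrightarrow> (c \<cdot>\<^sub>m A) * (B :: complex mat) = c \<cdot>\<^sub>m (A * B)"
  by (rule mult_smult_assoc_mat[of _ "dim_row A" "dim_col A" _ "dim_col B"]) (rule carrier_matI; simp)+

lemma mat_mult_smult:
  "dim_col A = dim_row B \<Longrightarrow> A * (c \<cdot>\<^sub>m B :: complex mat) = c \<cdot>\<^sub>m (A * B)"
  by (rule mult_smult_distrib[of _ "dim_row A" "dim_col A" _ "dim_col B"]) (rule carrier_matI; simp)+

lemmas mat_distribs = mat_add_mult mat_mult_add mat_minus_mult mat_mult_minus mat_smult_mult mat_mult_smult

lemma mat_one_mult [simp]:
  "dim_row A = n \<Longrightarrow> 1\<^sub>m n * A = A" "dim_col A = n \<Longrightarrow> A * 1\<^sub>m n = (A :: complex mat)"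
  by (auto intro!: left_mult_one_mat[of _ n "dim_col A"] right_mult_one_mat[of _ "dim_row A" n] carrier_matI)

lemma hs_inner_linear:
  assumes "X \<in> carrier_mat n m" "Y \<in> carrier_mat n m" "Z \<in> carrier_mat n m"
  shows "hs_inner X (Y + Z) = hs_inner X Y + hs_inner X Z"
    "hs_inner X (Y - Z) = hs_inner X Y - hs_inner X Z"
    "hs_inner (X + Y) Z = hs_inner X Z + hs_inner Y Z"
    "hs_inner (X - Y) Z = hs_inner X Z - hs_inner Y Z"
    "hs_inner X (c \<cdot>\<^sub>m Y) = c * hs_inner X Y"
    "hs_inner (c \<cdot>\<^sub>m X) Y = cnj c * hs_inner X Y"
  using assms[THEN carrier_matD(1)] assms[THEN carrier_matD(2)] unfolding hs_inner_def
  by (simp_all add: mat_adjoint_add mat_adjoint_minus mat_distribs mat_tr_add mat_tr_minus)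

lemma hs_inner_commute:
  assumes "X \<in> carrier_mat n m" "Y \<in> carrier_mat n m"
  shows "hs_inner Y X = cnj (hs_inner X Y)"
  using assms[THEN carrier_matD(1)] assms[THEN carrier_matD(2)] unfolding hs_inner_def
  by (subst mat_tr_adjoint[symmetric]) (simp_all add: mat_adjoint_mult)

text \<open>Projections are constructed for linear subspaces because the induction below passes
  through subspaces that are not algebras.\<close>

definition mat_subspace :: "nat \<Rightarrow> nat \<Rightarrow> complex mat set \<Rightarrow> bool" where
  "mat_subspace n m S \<longleftrightarrow> S \<subseteq> carrier_mat n m \<and> 0\<^sub>m n m \<in> S \<and>
     (\<forall>X\<in>S. \<forall>Y\<in>S. X + Y \<in> S) \<and> (\<forall>X\<in>S. \<forall>c. c \<cdot>\<^sub>m X \<in> S)"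

lemma mat_subspace_minus:
  assumes "mat_subspace n m S" "X \<in> S" "Y \<in> S"
  shows "X - Y \<in> S"
proof -
  have "X \<in> carrier_mat n m" "Y \<in> carrier_mat n m" using assms by (auto simp: mat_subspace_def)
  then have "X - Y = X + (-1) \<cdot>\<^sub>m Y" by (intro eq_matI) auto
  then show ?thesis using assms by (simp add: mat_subspace_def)
qed

text \<open>Induction on the set of coordinates outside which \<open>S\<close> vanishes: the subspace of elements
  vanishing at one more coordinate has codimension at most one.\<close>

lemma hs_projection_exists:
  assumes "mat_subspace n m S" "X \<in> carrier_mat n m"
  shows "\<exists>Y\<in>S. \<forall>Z\<in>S. hs_inner Z (X - Y) = 0"
proof -
  have gen: "\<exists>Y\<in>S. \<forall>Z\<in>S. hs_inner Z (X - Y) = 0"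
    if "finite I" "mat_subspace n m S" "\<forall>Z\<in>S. \<forall>p\<in>{..<n} \<times> {..<m} - I. Z $$ p = 0" "X \<in> carrier_mat n m" for I S X
    using that
  proof (induction I arbitrary: S X rule: finite_induct)
    case empty
    have S: "0\<^sub>m n m \<in> S" "S \<subseteq> carrier_mat n m" using empty by (auto simp: mat_subspace_def)
    have "hs_inner Z (X - 0\<^sub>m n m) = 0" if Z: "Z \<in> S" for Z
    proof -
      have c: "Z \<in> carrier_mat n m" "X - 0\<^sub>m n m \<in> carrier_mat n m" using S Z empty by auto
      show ?thesis unfolding hs_inner_sum[OF c]
        by (rule sum.neutral) (use empty(2) Z in auto)
    qed
    then show ?case using S by blast
  next
    case (insert p I)
    define S0 where "S0 = {Z \<in> S. p \<in> {..<n} \<times> {..<m} \<longrightarrow> Z $$ p = 0}"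
    have S: "mat_subspace n m S" by fact
    then have Sc: "Z \<in> carrier_mat n m" if "Z \<in> S" for Z using that by (auto simp: mat_subspace_def)
    have Sd: "dim_row Z = n" "dim_col Z = m" if "Z \<in> S" for Z using Sc[OF that] by auto
    have S0: "mat_subspace n m S0"
      using S unfolding mat_subspace_def S0_def by (auto simp: Sd)
    have van: "\<forall>Z\<in>S0. \<forall>q\<in>{..<n} \<times> {..<m} - I. Z $$ q = 0"
      using insert.prems(2) by (auto simp: S0_def)
    obtain Y0 where Y0: "Y0 \<in> S0" "\<And>Z. Z \<in> S0 \<Longrightarrow> hs_inner Z (X - Y0) = 0"
      using insert.IH[OF S0 van insert.prems(3)] by blast
    have S0S: "Z \<in> S" if "Z \<in> S0" for Z using that by (simp add: S0_def)
    show ?case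
    proof (cases "S0 = S")
      case True
      then show ?thesis using Y0 by blast
    next
      case False
      then obtain v where v: "v \<in> S" "v \<notin> S0" using S0S by blast
      obtain v0 where v0: "v0 \<in> S0" "\<And>Z. Z \<in> S0 \<Longrightarrow> hs_inner Z (v - v0) = 0"
        using insert.IH[OF S0 van Sc[OF v(1)]] by blast
      \<comment> \<open>The part of \<open>v\<close> orthogonal to \<open>S0\<close>. One coordinate
        separates \<open>S0\<close> from \<open>S\<close>, so \<open>S\<close> is \<open>S0\<close>
        plus the line through \<open>u\<close>, and the projection onto \<open>S\<close> is that
        onto \<open>S0\<close> plus the component along \<open>u\<close>.\<close>
      define u where "u = v - v0"
      have uS: "u \<in> S" unfolding u_def using mat_subspace_minus[OF S] v v0 S0S by blast
      have p: "p \<in> {..<n} \<times> {..<m}" and vp: "v $$ p \<noteq> 0" using v by (auto simp: S0_def)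
      have up: "u $$ p \<noteq> 0"
        using p vp v0(1) Sd[OF S0S[OF v0(1)]] by (auto simp: u_def S0_def)
      have u0: "u \<noteq> 0\<^sub>m n m" using p up by auto
      have uu: "hs_inner u u \<noteq> 0" using hs_inner_self(2)[OF Sc[OF uS]] u0 by blast
      define c where "c = hs_inner u X / hs_inner u u"
      define Y where "Y = Y0 + c \<cdot>\<^sub>m u"
      have YS: "Y \<in> S" using S uS S0S[OF Y0(1)] by (simp add: Y_def mat_subspace_def)
      note carr = Sc[OF uS] Sc[OF YS] Sc[OF S0S[OF Y0(1)]] insert.prems(3)
      have Yeq: "hs_inner Z (X - Y) = hs_inner Z X - hs_inner Z Y0 - c * hs_inner Z u"
        if "Z \<in> carrier_mat n m" for Z
      proof -
        have "c \<cdot>\<^sub>m u \<in> carrier_mat n m" using carr by simp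
        then show ?thesis using that carr unfolding Y_def by (simp add: hs_inner_linear[of _ n m])
      qed
      have "hs_inner Z (X - Y) = 0" if Z: "Z \<in> S" for Z
      proof -
        \<comment> \<open>This multiple of \<open>u\<close> has the same entry at \<open>p\<close>
          as \<open>Z\<close>, so subtracting it lands in \<open>S0\<close>.\<close>
        define a where "a = Z $$ p / u $$ p"
        define Z0 where "Z0 = Z - a \<cdot>\<^sub>m u"
        have Z0S: "Z0 \<in> S" unfolding Z0_def
          using mat_subspace_minus[OF S Z] S uS by (simp add: mat_subspace_def)
        have Z0: "Z0 \<in> S0"
          using Z0S p up Sd[OF Z] Sd[OF uS] by (auto simp: S0_def Z0_def a_def)
        have Zeq: "Z = a \<cdot>\<^sub>m u + Z0"
          unfolding Z0_def using Sd[OF Z] Sd[OF uS] by (intro eq_matI) auto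
        have "hs_inner u (X - Y) = 0"
        proof -
          have "hs_inner Y0 u = 0" using v0(2)[OF Y0(1)] by (simp add: u_def)
          then have "hs_inner u Y0 = 0" using hs_inner_commute[of Y0 n m u] carr by simp
          then show ?thesis using uu by (simp add: Yeq[OF carr(1)] c_def)
        qed
        moreover have "hs_inner Z0 (X - Y) = 0"
        proof -
          have "hs_inner Z0 X - hs_inner Z0 Y0 = 0"
            using Y0(2)[OF Z0] Sc[OF Z0S] carr by (simp add: hs_inner_linear[of _ n m])
          moreover have "hs_inner Z0 u = 0" using v0(2)[OF Z0] by (simp add: u_def)
          ultimately show ?thesis by (simp add: Yeq[OF Sc[OF Z0S]])
        qed
        moreover have "hs_inner Z (X - Y) = cnj a * hs_inner u (X - Y) + hs_inner Z0 (X - Y)"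
        proof -
          have "X - Y \<in> carrier_mat n m" "a \<cdot>\<^sub>m u \<in> carrier_mat n m" using carr by auto
          then show ?thesis unfolding Zeq using Sc[OF Z0S] carr(1) by (simp add: hs_inner_linear[of _ n m])
        qed
        ultimately show ?thesis by simp
      qed
      then show ?thesis using YS by blast
    qed
  qed
  show ?thesis
    by (rule gen[of "{..<n} \<times> {..<m}", OF _ assms(1) _ assms(2)]) auto
qed

lemma vn_algebraD:
  assumes "vn_algebra n N"
  shows "A \<in> N \<Longrightarrow> A \<in> carrier_mat n n" "A \<in> N \<Longrightarrow> dim_row A = n" "A \<in> N \<Longrightarrow> dim_col A = n" "1\<^sub>m n \<in> N"
    "A \<in> N \<Longrightarrow> B \<in> N \<Longrightarrow> A + B \<in> N" "A \<in> N \<Longrightarrow> B \<in> N \<Longrightarrow> A * B \<in> N"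
    "A \<in> N \<Longrightarrow> mat_adjoint A \<in> N" "A \<in> N \<Longrightarrow> c \<cdot>\<^sub>m A \<in> N"
  using assms unfolding vn_algebra_def by auto

lemma vn_algebra_subspace:
  assumes "vn_algebra n N"
  shows "mat_subspace n n N"
proof -
  have "0 \<cdot>\<^sub>m (1\<^sub>m n :: complex mat) = 0\<^sub>m n n" by (rule eq_matI) auto
  then have "0\<^sub>m n n \<in> N" using vn_algebraD(4,8)[OF assms] by metis
  then show ?thesis using assms by (auto simp: mat_subspace_def vn_algebra_def)
qed

text \<open>The difference of two candidates lies in \<open>S\<close> and is orthogonal to
  \<open>S\<close>, hence to itself.\<close>

lemma hs_projection_unique:
  assumes "mat_subspace n m S" "X \<in> carrier_mat n m" "Y \<in> S" "Y' \<in> S"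
    and "\<forall>Z\<in>S. hs_inner Z (X - Y) = 0" "\<forall>Z\<in>S. hs_inner Z (X - Y') = 0"
  shows "Y = Y'"
proof -
  have D: "Y - Y' \<in> S" using mat_subspace_minus assms by blast
  have c: "Y \<in> carrier_mat n m" "Y' \<in> carrier_mat n m" "Y - Y' \<in> carrier_mat n m"
    using assms D by (auto simp: mat_subspace_def)
  have "hs_inner (Y - Y') (Y - Y') = hs_inner (Y - Y') (X - Y') - hs_inner (Y - Y') (X - Y)"
    using c assms(2) by (simp add: hs_inner_linear(2)[of _ n m])
  also have "\<dots> = 0" using assms D by simp
  finally have "Y - Y' = 0\<^sub>m n m" using hs_inner_self(2)[OF c(3)] by simp
  then have "(Y - Y') + Y' = 0\<^sub>m n m + Y'" by simp
  then show ?thesis using c by (auto intro!: eq_matI simp: mat_eq_iff)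
qed

section \<open>The tracial expectation as an adjoint-preserving bimodule map\<close>

context
  fixes n :: nat and N :: "complex mat set"
  assumes N: "vn_algebra n N"
begin

lemma tracial_exp_unique:
  assumes "X \<in> carrier_mat n n"
  shows "\<exists>!Y. Y \<in> N \<and> (\<forall>Z\<in>N. hs_inner Z (X - Y) = 0)"
  using hs_projection_exists[OF vn_algebra_subspace[OF N] assms]
    hs_projection_unique[OF vn_algebra_subspace[OF N] assms] by blast

text \<open>Since \<open>N\<close> is closed under adjoints, orthogonality can be tested with
  \<open>Z\<close> itself in place of its adjoint. All later computations of expectations go through
  this trace form.\<close>

lemma tracial_exp_eqI:
  assumes "X \<in> carrier_mat n n" "Y \<in> N" "\<And>Z. Z \<in> N \<Longrightarrow> mat_tr (Z * Y) = mat_tr (Z * X)"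
  shows "tracial_exp N X = Y"
  unfolding tracial_exp_def orth_proj_def
proof (rule the1_equality[OF tracial_exp_unique[OF assms(1)]], intro conjI ballI)
  fix Z assume Z: "Z \<in> N"
  have "hs_inner Z (X - Y) = hs_inner Z X - hs_inner Z Y"
    using assms Z vn_algebraD(1)[OF N] by (simp add: hs_inner_linear(2)[of _ n n])
  then show "hs_inner Z (X - Y) = 0"
    using assms(3)[OF vn_algebraD(7)[OF N Z]] by (simp add: hs_inner_def)
qed fact

lemma tracial_exp_in [simp]: "X \<in> carrier_mat n n \<Longrightarrow> tracial_exp N X \<in> N"
  using theI'[OF tracial_exp_unique] by (simp add: tracial_exp_def orth_proj_def)

lemma tracial_exp_dim [simp]:
  "X \<in> carrier_mat n n \<Longrightarrow> dim_row (tracial_exp N X) = n" "X \<in> carrier_mat n n \<Longrightarrow> dim_col (tracial_exp N X) = n"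
  using vn_algebraD(2,3)[OF N] by auto

lemma tracial_exp_tr_left:
  assumes X: "X \<in> carrier_mat n n" and Z: "Z \<in> N"
  shows "mat_tr (Z * tracial_exp N X) = mat_tr (Z * X)"
proof -
  have E: "tracial_exp N X \<in> carrier_mat n n" using X vn_algebraD(1)[OF N] by simp
  have Z': "mat_adjoint Z \<in> N" "mat_adjoint Z \<in> carrier_mat n n" using vn_algebraD(1,7)[OF N] Z by auto
  have "hs_inner (mat_adjoint Z) (X - tracial_exp N X) = 0"
    using theI'[OF tracial_exp_unique[OF X]] Z'(1) by (simp add: tracial_exp_def orth_proj_def)
  then show ?thesis using hs_inner_linear(2)[OF Z'(2) X E] by (simp add: hs_inner_def)
qed

lemma tracial_exp_tr_right:
  assumes "X \<in> carrier_mat n n" "Z \<in> N"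
  shows "mat_tr (tracial_exp N X * Z) = mat_tr (X * Z)"
  using tracial_exp_tr_left[OF assms] assms(1) vn_algebraD(2,3)[OF N assms(2)]
  by (subst (1 2) mat_tr_comm) auto

lemma tracial_exp_mult_left:
  assumes X: "X \<in> carrier_mat n n" and A: "A \<in> N"
  shows "tracial_exp N (A * X) = A * tracial_exp N X"
proof (rule tracial_exp_eqI)
  note [simp] = vn_algebraD(2,3)[OF N] carrier_matD[OF X]
  show "A * X \<in> carrier_mat n n" using A by simp
  show "A * tracial_exp N X \<in> N" using vn_algebraD(6)[OF N A] X by simp
  fix Z assume Z: "Z \<in> N"
  then show "mat_tr (Z * (A * tracial_exp N X)) = mat_tr (Z * (A * X))"
    using tracial_exp_tr_left[OF X vn_algebraD(6)[OF N Z A]] A X by (simp add: mat_assoc)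
qed

text \<open>Cyclicity of the trace carries the factor \<open>A\<close> to the front, where it is
  absorbed into the test element: \<open>A * Z\<close> is again in \<open>N\<close>.\<close>

lemma tracial_exp_mult_right:
  assumes X: "X \<in> carrier_mat n n" and A: "A \<in> N"
  shows "tracial_exp N (X * A) = tracial_exp N X * A"
proof (rule tracial_exp_eqI)
  note [simp] = vn_algebraD(2,3)[OF N] carrier_matD[OF X]
  show "X * A \<in> carrier_mat n n" using A by simp
  show "tracial_exp N X * A \<in> N" using vn_algebraD(6)[OF N _ A] X by simp
  fix Z assume Z: "Z \<in> N"
  have "mat_tr (Z * (Y * A)) = mat_tr ((A * Z) * Y)" if "Y \<in> carrier_mat n n" for Y
    using mat_tr_comm[of "Z * Y" A] that A Z by (simp add: mat_assoc)
  then show "mat_tr (Z * (tracial_exp N X * A)) = mat_tr (Z * (X * A))"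
    using tracial_exp_tr_left[OF X vn_algebraD(6)[OF N A Z]] A X vn_algebraD(1)[OF N] by simp
qed

lemma tracial_exp_adjoint:
  assumes X: "X \<in> carrier_mat n n"
  shows "tracial_exp N (mat_adjoint X) = mat_adjoint (tracial_exp N X)"
proof (rule tracial_exp_eqI)
  note [simp] = vn_algebraD(2,3)[OF N] carrier_matD[OF X]
  show "mat_adjoint X \<in> carrier_mat n n" using X by simp
  show "mat_adjoint (tracial_exp N X) \<in> N" using vn_algebraD(7)[OF N] X by simp
  fix Z assume Z: "Z \<in> N"
  have "mat_tr (Z * mat_adjoint Y) = cnj (mat_tr (Y * mat_adjoint Z))" if "Y \<in> carrier_mat n n" for Y
    using that Z by (subst mat_tr_adjoint[symmetric]) (auto simp: mat_adjoint_mult)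
  then show "mat_tr (Z * mat_adjoint (tracial_exp N X)) = mat_tr (Z * mat_adjoint X)"
    using tracial_exp_tr_right[OF X vn_algebraD(7)[OF N Z]] X vn_algebraD(1)[OF N] by simp
qed

lemma tracial_exp_smult:
  assumes X: "X \<in> carrier_mat n n"
  shows "tracial_exp N (c \<cdot>\<^sub>m X) = c \<cdot>\<^sub>m tracial_exp N X"
proof (rule tracial_exp_eqI)
  note [simp] = vn_algebraD(2,3)[OF N] carrier_matD[OF X]
  show "c \<cdot>\<^sub>m X \<in> carrier_mat n n" using X by simp
  show "c \<cdot>\<^sub>m tracial_exp N X \<in> N" using vn_algebraD(8)[OF N] X by simp
  fix Z assume Z: "Z \<in> N"
  then show "mat_tr (Z * (c \<cdot>\<^sub>m tracial_exp N X)) = mat_tr (Z * (c \<cdot>\<^sub>m X))"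
    using tracial_exp_tr_left[OF X Z] X by (simp add: mat_mult_smult)
qed

lemma tracial_exp_id: "X \<in> N \<Longrightarrow> tracial_exp N X = X"
  by (rule tracial_exp_eqI) (auto simp: vn_algebraD(1)[OF N])

end

section \<open>Positive matrices and their square roots\<close>

lemma unitary_matD:
  assumes "unitary_mat n U"
  shows "U \<in> carrier_mat n n" "dim_row U = n" "dim_col U = n"
    "mat_adjoint U * U = 1\<^sub>m n" "U * mat_adjoint U = 1\<^sub>m n"
    "dim_row B = n \<Longrightarrow> mat_adjoint U * (U * B) = B" "dim_row B = n \<Longrightarrow> U * (mat_adjoint U * B) = B"
  using assms by (auto simp: unitary_mat_def mat_assoc[symmetric])

text \<open>With \<open>U\<close> fixed, sums, products, scalar multiples and adjoints act pointwise
  on \<open>d\<close>, so a function \<open>f\<close> of the matrix is obtained by replacing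
  \<open>d i\<close> with \<open>f (d i)\<close>.\<close>

definition diag_conj :: "nat \<Rightarrow> complex mat \<Rightarrow> (nat \<Rightarrow> complex) \<Rightarrow> complex mat" where
  "diag_conj n U d = U * mat_diag n d * mat_adjoint U"

lemma mat_diag_cong: "(\<And>i. i < n \<Longrightarrow> f i = g i) \<Longrightarrow> mat_diag n f = mat_diag n g"
  by (rule eq_matI) (auto simp: mat_diag_def)

lemma diag_conj_cong: "(\<And>i. i < n \<Longrightarrow> f i = g i) \<Longrightarrow> diag_conj n U f = diag_conj n U g"
  unfolding diag_conj_def using mat_diag_cong[of n f g] by simp

lemma diag_conj_dim [simp]: "dim_row (diag_conj n U d) = dim_row U" "dim_col (diag_conj n U d) = dim_row U"
  by (simp_all add: diag_conj_def)

lemma diag_conj_carrier: "unitary_mat n U \<Longrightarrow> diag_conj n U d \<in> carrier_mat n n"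
  by (simp add: diag_conj_def unitary_matD)

lemma diag_conj_mult:
  assumes "unitary_mat n U"
  shows "diag_conj n U d * diag_conj n U e = diag_conj n U (\<lambda>i. d i * e i)"
proof -
  note [simp] = unitary_matD[OF assms]
  have "diag_conj n U d * diag_conj n U e = U * (mat_diag n d * mat_diag n e) * mat_adjoint U"
    by (simp add: diag_conj_def mat_assoc del: mat_diag_diag)
  then show ?thesis by (simp add: diag_conj_def)
qed

lemma diag_conj_add:
  assumes "unitary_mat n U"
  shows "diag_conj n U d + diag_conj n U e = diag_conj n U (\<lambda>i. d i + e i)"
proof -
  note [simp] = unitary_matD[OF assms]
  have "mat_diag n (\<lambda>i. d i + e i) = mat_diag n d + mat_diag n e"
    by (rule eq_matI) (auto simp: mat_diag_def)
  then show ?thesis by (simp add: diag_conj_def mat_distribs)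
qed

lemma diag_conj_smult:
  assumes "unitary_mat n U"
  shows "c \<cdot>\<^sub>m diag_conj n U d = diag_conj n U (\<lambda>i. c * d i)"
proof -
  note [simp] = unitary_matD[OF assms]
  have "mat_diag n (\<lambda>i. c * d i) = c \<cdot>\<^sub>m mat_diag n d"
    by (rule eq_matI) (auto simp: mat_diag_def)
  then show ?thesis by (simp add: diag_conj_def mat_distribs)
qed

lemma diag_conj_one:
  assumes "unitary_mat n U"
  shows "diag_conj n U (\<lambda>_. 1) = 1\<^sub>m n"
  using unitary_matD[OF assms] by (simp add: diag_conj_def)

lemma diag_conj_adjoint:
  assumes "unitary_mat n U"
  shows "mat_adjoint (diag_conj n U d) = diag_conj n U (\<lambda>i. cnj (d i))"
  using unitary_matD[OF assms] by (simp add: diag_conj_def mat_adjoint_mult mat_adjoint_diag mat_assoc)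

lemma diag_conj_tr:
  assumes "unitary_mat n U"
  shows "mat_tr (diag_conj n U d) = (\<Sum>i<n. d i)"
proof -
  note [simp] = unitary_matD[OF assms]
  have "mat_tr (diag_conj n U d) = mat_tr (mat_adjoint U * (U * mat_diag n d))"
    unfolding diag_conj_def by (rule mat_tr_comm) auto
  then show ?thesis by (simp add: mat_tr_def) (simp add: mat_diag_def)
qed

text \<open>Lagrange interpolation: every function of \<open>A\<close> is a polynomial in \<open>A\<close>.\<close>

lemma vn_algebra_functional_calculus:
  assumes N: "vn_algebra n N" and U: "unitary_mat n U" and A: "diag_conj n U d \<in> N"
  shows "diag_conj n U (\<lambda>i. f (d i)) \<in> N"
proof -
  \<comment> \<open>\<open>P f\<close> says that the function \<open>f\<close> of the matrix lies in
    \<open>N\<close>. It is closed under polynomial operations and depends only on the values of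
    \<open>f\<close> at the eigenvalues.\<close>
  define P where "P f \<longleftrightarrow> diag_conj n U (\<lambda>i. f (d i)) \<in> N" for f
  have const: "P (\<lambda>_. c)" for c
    using vn_algebraD(8)[OF N vn_algebraD(4)[OF N], of c] diag_conj_smult[OF U, of c "\<lambda>_. 1"]
    by (simp add: P_def diag_conj_one[OF U])
  have mult: "P (\<lambda>x. f x * g x)" if "P f" "P g" for f g
    using vn_algebraD(6)[OF N] that unfolding P_def by (metis diag_conj_mult[OF U])
  have add: "P (\<lambda>x. f x + g x)" if "P f" "P g" for f g
    using vn_algebraD(5)[OF N] that unfolding P_def by (metis diag_conj_add[OF U])
  have id: "P (\<lambda>x. x)" using A by (simp add: P_def)
  have cong: "P f \<longleftrightarrow> P g" if "\<And>x. x \<in> d ` {..<n} \<Longrightarrow> f x = g x" for f g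
    using diag_conj_cong[of n "\<lambda>i. f (d i)" "\<lambda>i. g (d i)" U] that by (simp add: P_def)
  have prod: "P (\<lambda>x. \<Prod>e\<in>S. g e * (x + h e))" if "finite S" for S g h
    using that
  proof (induction S rule: finite_induct)
    case (insert e S)
    show ?case unfolding prod.insert[OF insert.hyps] by (intro mult add const id insert.IH)
  qed (simp add: const)
  have ind: "P (\<lambda>x. if x = c then 1 else 0)" for c
  proof -
    let ?S = "d ` {..<n} - {c}"
    \<comment> \<open>The Lagrange basis polynomial of node \<open>c\<close>: 1 at \<open>c\<close>
      and 0 at every other eigenvalue. The node need not be an eigenvalue itself.\<close>
    have "P (\<lambda>x. \<Prod>e\<in>?S. inverse (c - e) * (x + - e))" by (rule prod) auto
    also have "P (\<lambda>x. \<Prod>e\<in>?S. inverse (c - e) * (x + - e)) \<longleftrightarrow> P (\<lambda>x. if x = c then 1 else 0)"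
    proof (rule cong)
      fix x assume x: "x \<in> d ` {..<n}"
      show "(\<Prod>e\<in>?S. inverse (c - e) * (x + - e)) = (if x = c then 1 else 0)"
      proof (cases "x = c")
        case True
        then show ?thesis by (simp only: if_True refl) (rule prod.neutral, auto intro!: left_inverse)
      next
        case False
        then have "\<exists>e\<in>?S. inverse (c - e) * (x + - e) = 0" using x by (intro bexI[of _ x]) auto
        then have "(\<Prod>e\<in>?S. inverse (c - e) * (x + - e)) = 0" by (intro prod_zero) auto
        then show ?thesis using False by simp
      qed
    qed
    finally show ?thesis .
  qed
  have sum: "P (\<lambda>x. \<Sum>e\<in>S. f e * (if x = e then 1 else 0))" if "finite S" for S
    using that
  proof (induction S rule: finite_induct)
    case (insert e S)
    show ?case unfolding sum.insert[OF insert.hyps] by (intro mult add const ind insert.IH)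
  qed (simp add: const)
  have "P (\<lambda>x. \<Sum>e\<in>d ` {..<n}. f e * (if x = e then 1 else 0))" by (rule sum) auto
  also have "P (\<lambda>x. \<Sum>e\<in>d ` {..<n}. f e * (if x = e then 1 else 0)) \<longleftrightarrow> P f"
  proof (rule cong)
    fix x assume x: "x \<in> d ` {..<n}"
    have "(\<Sum>e\<in>d ` {..<n}. f e * (if x = e then 1 else 0)) = (\<Sum>e\<in>d ` {..<n}. if x = e then f e else 0)"
      by (rule sum.cong) auto
    then show "(\<Sum>e\<in>d ` {..<n}. f e * (if x = e then 1 else 0)) = f x"
      using x by (simp add: sum.delta')
  qed
  finally show ?thesis by (simp add: P_def)
qed

section \<open>Positive semidefinite matrices through their quadratic forms\<close>

lemma cscalar_mat_adjoint:
  fixes A :: "complex mat"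
  assumes "A \<in> carrier_mat n m" "v \<in> carrier_vec n" "w \<in> carrier_vec m"
  shows "(mat_adjoint A *\<^sub>v v) \<bullet>c w = v \<bullet>c (A *\<^sub>v w)"
proof -
  have "(mat_adjoint A *\<^sub>v v) \<bullet>c w = (\<Sum>j<m. \<Sum>i<n. cnj (A $$ (i, j)) * v $ i * cnj (w $ j))"
    using assms by (simp add: scalar_prod_def lessThan_atLeast0 sum_distrib_right)
  also have "\<dots> = (\<Sum>i<n. \<Sum>j<m. cnj (A $$ (i, j)) * v $ i * cnj (w $ j))"
    by (rule sum.swap)
  also have "\<dots> = v \<bullet>c (A *\<^sub>v w)"
    using assms by (simp add: scalar_prod_def lessThan_atLeast0 sum_distrib_left mult_ac)
  finally show ?thesis .
qed

lemma psd_mat_gram: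
  assumes "R \<in> carrier_mat m n"
  shows "psd_mat n (mat_adjoint R * R)"
  unfolding psd_mat_def
proof (intro conjI ballI)
  fix v :: "complex vec" assume v: "v \<in> carrier_vec n"
  have R: "mat_adjoint R \<in> carrier_mat n m" using assms by simp
  have Rv: "R *\<^sub>v v \<in> carrier_vec m" using assms v by simp
  have "(mat_adjoint R * R *\<^sub>v v) \<bullet>c v = (R *\<^sub>v v) \<bullet>c (R *\<^sub>v v)"
    unfolding assoc_mult_mat_vec[OF R assms v] by (rule cscalar_mat_adjoint[OF assms Rv v])
  then show "0 \<le> (mat_adjoint R * R *\<^sub>v v) \<bullet>c v" using conjugate_square_ge_0_vec by simp
qed (use assms in simp)

lemma psd_mat_compress:
  assumes A: "psd_mat n A" and Y: "Y \<in> carrier_mat n m"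
  shows "psd_mat m (mat_adjoint Y * A * Y)"
  unfolding psd_mat_def
proof (intro conjI ballI)
  fix v :: "complex vec" assume v: "v \<in> carrier_vec m"
  have Ac: "A \<in> carrier_mat n n" using A by (simp add: psd_mat_def)
  have Y': "mat_adjoint Y \<in> carrier_mat m n" "mat_adjoint Y * A \<in> carrier_mat m n" using Y Ac by auto
  have Yv: "Y *\<^sub>v v \<in> carrier_vec n" using Y v by simp
  have AYv: "A *\<^sub>v (Y *\<^sub>v v) \<in> carrier_vec n" using Yv Ac by simp
  have "(mat_adjoint Y * A * Y *\<^sub>v v) \<bullet>c v = (A *\<^sub>v (Y *\<^sub>v v)) \<bullet>c (Y *\<^sub>v v)"
    unfolding assoc_mult_mat_vec[OF Y'(2) Y v] assoc_mult_mat_vec[OF Y'(1) Ac Yv]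
    by (rule cscalar_mat_adjoint[OF Y AYv v])
  then show "0 \<le> (mat_adjoint Y * A * Y *\<^sub>v v) \<bullet>c v" using A Yv by (simp add: psd_mat_def)
qed (use Y A in \<open>auto simp: psd_mat_def\<close>)

lemma psd_mat_smult:
  assumes "psd_mat n A" "0 \<le> c"
  shows "psd_mat n (c \<cdot>\<^sub>m A)"
  unfolding psd_mat_def
proof (intro conjI ballI)
  fix v :: "complex vec" assume v: "v \<in> carrier_vec n"
  have Ac: "A \<in> carrier_mat n n" using assms(1) by (simp add: psd_mat_def)
  have "(c \<cdot>\<^sub>m A *\<^sub>v v) \<bullet>c v = c * ((A *\<^sub>v v) \<bullet>c v)"
    using Ac v by (simp add: scalar_prod_def lessThan_atLeast0 sum_distrib_left sum_distrib_right mult_ac)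
  then show "0 \<le> (c \<cdot>\<^sub>m A *\<^sub>v v) \<bullet>c v"
    using assms v by (simp add: psd_mat_def)
qed (use assms in \<open>auto simp: psd_mat_def\<close>)

text \<open>Evaluates a sum against a vector supported on two coordinates, as needed for
  polarisation; the formula also holds for \<open>i = j\<close>.\<close>

lemma sum_two_delta:
  fixes f :: "nat \<Rightarrow> complex"
  assumes "i < n" "j < n"
  shows "(\<Sum>l<n. f l * ((if l = i then a else 0) + (if l = j then b else 0))) = f i * a + f j * b"
proof -
  have "(\<Sum>l<n. f l * ((if l = i then a else 0) + (if l = j then b else 0))) =
      (\<Sum>l<n. (if l = i then f l * a else 0) + (if l = j then f l * b else 0))"
    by (rule sum.cong) (auto simp: distrib_left)
  then show ?thesis using assms by (simp add: sum.distrib)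
qed

lemma quadratic_form_unit:
  assumes "A \<in> carrier_mat n n" "k < n"
  shows "(A *\<^sub>v unit_vec n k) \<bullet>c unit_vec n k = (A $$ (k, k) :: complex)"
proof -
  have "(A *\<^sub>v unit_vec n k) \<bullet>c unit_vec n k = (\<Sum>a<n. \<Sum>b<n. if b = k then if a = k then A $$ (k, k) else 0 else 0)"
  proof -
    have "(A *\<^sub>v unit_vec n k) \<bullet>c unit_vec n k =
        (\<Sum>a<n. \<Sum>b<n. A $$ (a, b) * (if b = k then 1 else 0) * cnj (if a = k then 1 else 0))"
      using assms by (simp add: scalar_prod_def lessThan_atLeast0 sum_distrib_right)
    also have "\<dots> = (\<Sum>a<n. \<Sum>b<n. if b = k then if a = k then A $$ (k, k) else 0 else 0)"
      by (intro sum.cong) auto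
    finally show ?thesis .
  qed
  also have "\<dots> = A $$ (k, k)" using assms by simp
  finally show ?thesis .
qed

text \<open>Polarisation with the vectors e_i + c e_j. In the order on complex numbers
  \<open>0 \<le> z\<close> includes that \<open>z\<close> is real, so \<open>c = 1\<close> makes the
  imaginary parts of the (i, j) and (j, i) entries opposite, and \<open>c = \<i>\<close> makes their
  real parts equal.\<close>

lemma psd_mat_hermitian:
  assumes "psd_mat n A"
  shows "mat_adjoint A = A"
proof (rule eq_matI)
  fix i j assume "i < dim_row A" "j < dim_col A"
  have A: "A \<in> carrier_mat n n" and q: "\<And>v. v \<in> carrier_vec n \<Longrightarrow> 0 \<le> (A *\<^sub>v v) \<bullet>c v"
    using assms by (auto simp: psd_mat_def)
  with \<open>i < dim_row A\<close> \<open>j < dim_col A\<close> have ij: "i < n" "j < n" by auto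
  have e: "(A *\<^sub>v v) \<bullet>c v = (\<Sum>k<n. \<Sum>l<n. A $$ (k, l) * v $ l * cnj (v $ k))" if "v \<in> carrier_vec n" for v
    using A that by (simp add: scalar_prod_def lessThan_atLeast0 sum_distrib_right)
  have qq: "0 \<le> A $$ (i, i) + c * A $$ (i, j) + cnj c * A $$ (j, i) + c * cnj c * A $$ (j, j)" if "i \<noteq> j" for c
  proof -
    let ?v = "vec n (\<lambda>k. (if k = i then 1 else 0) + (if k = j then c else 0))"
    have "(A *\<^sub>v ?v) \<bullet>c ?v = (\<Sum>k<n. (\<Sum>l<n. A $$ (k, l) * ((if l = i then 1 else 0) + (if l = j then c else 0))) *
        ((if k = i then 1 else 0) + (if k = j then cnj c else 0)))"
      by (subst e) (auto simp: sum_distrib_right intro!: sum.cong)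
    also have "\<dots> = A $$ (i, i) + c * A $$ (i, j) + cnj c * A $$ (j, i) + c * cnj c * A $$ (j, j)"
      unfolding sum_two_delta[OF ij] by (simp add: algebra_simps)
    finally show ?thesis using q[of ?v] by simp
  qed
  have diag: "0 \<le> A $$ (k, k)" if k: "k < n" for k
  proof -
    show ?thesis using q[of "unit_vec n k"] quadratic_form_unit[OF A k] by simp
  qed
  have ad: "mat_adjoint A $$ (i, j) = cnj (A $$ (j, i))" using A ij by simp
  show "mat_adjoint A $$ (i, j) = A $$ (i, j)"
  proof (cases "i = j")
    case True
    then show ?thesis unfolding ad using diag[OF ij(1)] by (simp add: less_eq_complex_def complex_eq_iff)
  next
    case False
    show ?thesis unfolding ad
      using qq[OF False, of 1] qq[OF False, of \<i>] diag[OF ij(1)] diag[OF ij(2)]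
      by (simp add: less_eq_complex_def complex_eq_iff)
  qed
qed (use assms in \<open>auto simp: psd_mat_def\<close>)

text \<open>Positive definiteness is encoded by a spectral decomposition, so that square roots and
  inverses come from the functional calculus without choosing a decomposition anew.\<close>

definition pd_mat :: "nat \<Rightarrow> complex mat \<Rightarrow> bool" where
  "pd_mat n A \<longleftrightarrow> (\<exists>U d. unitary_mat n U \<and> (\<forall>i<n. 0 < d i) \<and> A = diag_conj n U d)"

lemma pd_mat_carrier: "pd_mat n A \<Longrightarrow> A \<in> carrier_mat n n"
  by (auto simp: pd_mat_def diag_conj_carrier)

text \<open>The eigenvalues are values of the quadratic form of a compressed matrix, hence
  nonnegative. A zero eigenvalue would give a zero row in a product that equals the
  identity.\<close>

lemma psd_invertible_pd:
  assumes A: "psd_mat n A" and inv: "invertible_mat A"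
  shows "pd_mat n A"
proof -
  have Ac: "A \<in> carrier_mat n n" using A by (simp add: psd_mat_def)
  obtain U d where U: "unitary_mat n U" and AU: "A = diag_conj n U d"
    using hermitian_unitary_diagonalization[OF Ac psd_mat_hermitian[OF A]] by (auto simp: diag_conj_def)
  note [simp] = unitary_matD[OF U] carrier_matD[OF Ac]
  have diag: "mat_adjoint U * A * U = mat_diag n d" by (simp add: AU diag_conj_def mat_assoc)
  obtain B where B: "A * B = 1\<^sub>m n" "B * A = 1\<^sub>m (dim_row B)"
    using inv Ac by (auto simp: invertible_mat_def inverts_mat_def)
  from arg_cong[OF B(1), of dim_col] arg_cong[OF B(2), of dim_col]
  have [simp]: "dim_row B = n" "dim_col B = n" by simp_all
  have "0 < d i" if i: "i < n" for i
  proof -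
    have psd: "psd_mat n (mat_diag n d)"
      using psd_mat_compress[OF A unitary_matD(1)[OF U]] by (simp only: diag)
    have e: "(mat_diag n d *\<^sub>v unit_vec n i) \<bullet>c unit_vec n i = d i"
      using i by (simp add: quadratic_form_unit) (simp add: mat_diag_def)
    have "0 \<le> (mat_diag n d *\<^sub>v unit_vec n i) \<bullet>c unit_vec n i"
      using psd unfolding psd_mat_def by (elim conjE bspec) (rule unit_vec_carrier)
    then have "0 \<le> d i" unfolding e .
    moreover have "d i \<noteq> 0"
    proof
      assume d: "d i = 0"
      have "diag_conj n U d * B = 1\<^sub>m n" using B AU by simp
      then have "mat_adjoint U * (diag_conj n U d * B) * U = 1\<^sub>m n" by simp
      then have "mat_diag n d * (mat_adjoint U * B * U) = 1\<^sub>m n" by (simp add: diag_conj_def mat_assoc)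
      moreover have "mat_adjoint U * B * U \<in> carrier_mat n n" by simp
      ultimately have "mat n n (\<lambda>(i, j). d i * (mat_adjoint U * B * U) $$ (i, j)) = 1\<^sub>m n"
        using mat_diag_mult_left[of "mat_adjoint U * B * U" n n d] by simp
      from arg_cong[OF this, of "\<lambda>M. M $$ (i, i)"] show False using i d by simp
    qed
    ultimately show ?thesis by (simp add: order_less_le)
  qed
  then show ?thesis using U AU by (auto simp: pd_mat_def)
qed

lemma mat_cols_eqI:
  assumes "A \<in> carrier_mat n m" "B \<in> carrier_mat n m" "\<And>i. i < m \<Longrightarrow> col A i = col B i"
  shows "A = B"
  using assms by (intro mat_col_eqI) auto

text \<open>If \<open>u\<close> is an eigenvector of \<open>B\<^sup>2\<close> for \<open>x\<^sup>2\<close>, then \<open>w = B u - x u\<close> satisfies \<open>B w = -x w\<close>,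
  which positivity of \<open>B\<close> excludes unless \<open>w = 0\<close>.\<close>

lemma psd_mat_sqrt_unique:
  assumes U: "unitary_mat n U" and r: "\<And>i. i < n \<Longrightarrow> 0 < r i"
    and B: "psd_mat n B" and BB: "B * B = diag_conj n U (\<lambda>i. r i * r i)"
  shows "B = diag_conj n U r"
proof -
  note [simp] = unitary_matD[OF U]
  have Bc [simp]: "B \<in> carrier_mat n n" "dim_row B = n" "dim_col B = n" using B by (auto simp: psd_mat_def)
  \<comment> \<open>Treats all eigenvectors at once: column \<open>i\<close> of \<open>W\<close> is
    the vector \<open>w\<close> belonging to column \<open>i\<close> of \<open>U\<close> with
    \<open>x = r i\<close>.\<close>
  define W where "W = B * U - U * mat_diag n r"
  have Wc [simp]: "W \<in> carrier_mat n n" "dim_row W = n" "dim_col W = n" by (auto simp: W_def)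
  have "B * (B * U) = U * mat_diag n (\<lambda>i. r i * r i)"
    using arg_cong[OF BB, of "\<lambda>M. M * U"] by (simp add: mat_assoc diag_conj_def)
  moreover have "U * mat_diag n r * mat_diag n r = U * mat_diag n (\<lambda>i. r i * r i)"
    by (simp add: mat_assoc)
  ultimately have "B * W + W * mat_diag n r = 0\<^sub>m n n"
    by (simp add: W_def mat_distribs mat_assoc) (rule eq_matI, auto)
  then have BW: "B * W = - (W * mat_diag n r)"
    by (intro eq_matI) (auto simp: mat_eq_iff eq_neg_iff_add_eq_0)
  have "col W i = 0\<^sub>v n" if i: "i < n" for i
  proof -
    have w: "col W i \<in> carrier_vec n" by (rule carrier_vecI) simp
    have "B *\<^sub>v col W i = col (B * W) i"
      by (rule col_mult2[OF Bc(1) Wc(1) i, symmetric])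
    also have "\<dots> = (- r i) \<cdot>\<^sub>v col W i"
      unfolding BW mat_diag_mult_right[OF Wc(1)] using i by (intro eq_vecI) auto
    finally have "(B *\<^sub>v col W i) \<bullet>c col W i = - (r i * (col W i \<bullet>c col W i))"
      using w by simp
    moreover have "0 \<le> (B *\<^sub>v col W i) \<bullet>c col W i" using B w by (simp add: psd_mat_def)
    moreover have "0 \<le> r i * (col W i \<bullet>c col W i)"
      by (intro mult_nonneg_nonneg conjugate_square_ge_0_vec order_less_imp_le r i)
    ultimately have "r i * (col W i \<bullet>c col W i) = 0" by (metis neg_0_le_iff_le order_antisym)
    then have "col W i \<bullet>c col W i = 0" using r[OF i] by auto
    then show ?thesis using conjugate_square_eq_0_vec[OF w] by simp
  qed
  then have "W = 0\<^sub>m n n" by (intro mat_cols_eqI[of _ n n]) auto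
  then have "B * U = U * mat_diag n r"
    by (intro eq_matI) (auto simp: W_def mat_eq_iff)
  then have "B * U * mat_adjoint U = diag_conj n U r" by (simp add: diag_conj_def)
  then show ?thesis by (simp add: mat_assoc)
qed

lemma pos_complex_sqrt:
  assumes "0 < (z :: complex)"
  shows "\<exists>r. 0 < r \<and> z = r * r \<and> cnj r = r"
proof -
  have "z = of_real (Re z)" "0 < Re z" using assms by (auto simp: less_complex_def complex_eq_iff)
  then have "z = of_real (sqrt (Re z)) * of_real (sqrt (Re z))" "0 < complex_of_real (sqrt (Re z))"
    by (simp_all add: less_complex_def flip: of_real_mult)
  then show ?thesis by (intro exI[of _ "of_real (sqrt (Re z))"]) simp
qed

text \<open>The root and its inverse are functions of \<open>A\<close>, hence members of any von
  Neumann algebra containing \<open>A\<close>. Uniqueness of the positive root identifies the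
  explicit matrices with the values of the definite descriptions.\<close>

lemma pd_mat_sqrt:
  assumes N: "vn_algebra n N" and A: "A \<in> N" "pd_mat n A"
  shows "psd_sqrt A \<in> N" "mat_adjoint (psd_sqrt A) = psd_sqrt A" "psd_sqrt A * psd_sqrt A = A"
    "psd_inv_sqrt A \<in> N" "mat_adjoint (psd_inv_sqrt A) = psd_inv_sqrt A"
    "psd_sqrt A * psd_inv_sqrt A = 1\<^sub>m n" "psd_inv_sqrt A * psd_sqrt A = 1\<^sub>m n"
proof -
  obtain U d where U: "unitary_mat n U" and d: "\<forall>i<n. 0 < d i" and AU: "A = diag_conj n U d"
    using A(2) by (auto simp: pd_mat_def)
  note [simp] = unitary_matD(2,3)[OF U]
  \<comment> \<open>One choice function for all complex numbers, rather than one root for each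
    index, makes the root a function of the eigenvalue, as the functional calculus requires.\<close>
  define f where "f z = (SOME r. 0 < r \<and> z = r * r \<and> cnj r = r)" for z :: complex
  have f: "0 < f z" "z = f z * f z" "cnj (f z) = f z" if "0 < z" for z
    using someI_ex[OF pos_complex_sqrt[OF that]] by (auto simp: f_def)
  define r where "r i = f (d i)" for i
  have r: "0 < r i" "d i = r i * r i" "cnj (r i) = r i" if "i < n" for i
    using f[of "d i"] d that by (auto simp: r_def)
  have nz: "r i \<noteq> 0" if "i < n" for i using r(1)[OF that] by auto
  define s where "s = diag_conj n U r"
  define si where "si = diag_conj n U (\<lambda>i. inverse (r i))"
  have sN: "s \<in> N" and siN: "si \<in> N"
    using vn_algebra_functional_calculus[OF N U, of d f] vn_algebra_functional_calculus[OF N U, of d "\<lambda>x. inverse (f x)"] A(1)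
    unfolding s_def si_def AU r_def by auto
  have ss: "s * s = A" unfolding s_def AU diag_conj_mult[OF U] using r by (intro diag_conj_cong) auto
  have sa: "mat_adjoint s = s" unfolding s_def diag_conj_adjoint[OF U] using r by (intro diag_conj_cong) auto
  have sia: "mat_adjoint si = si" unfolding si_def diag_conj_adjoint[OF U] using r by (intro diag_conj_cong) auto
  have i1: "s * si = 1\<^sub>m n"
    unfolding s_def si_def diag_conj_mult[OF U] diag_conj_one[OF U, symmetric]
    using nz by (intro diag_conj_cong) auto
  have i2: "si * s = 1\<^sub>m n"
    unfolding s_def si_def diag_conj_mult[OF U] diag_conj_one[OF U, symmetric]
    using nz by (intro diag_conj_cong) auto
  have psd: "psd_mat n s"
  proof -
    \<comment> \<open>\<open>R\<close> is a fourth root of \<open>A\<close>; it exhibits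
      \<open>s\<close> as a Gram matrix and so as positive.\<close>
    define R where "R = diag_conj n U (\<lambda>i. f (r i))"
    have fr: "r i = f (r i) * f (r i)" "cnj (f (r i)) = f (r i)" if "i < n" for i using f[OF r(1)[OF that]] by auto
    have "mat_adjoint R * R = s"
      unfolding R_def s_def diag_conj_adjoint[OF U] diag_conj_mult[OF U] using fr by (intro diag_conj_cong) auto
    then show ?thesis using psd_mat_gram[of R n n] diag_conj_carrier[OF U] by (simp add: R_def)
  qed
  have Ar: "A = diag_conj n U (\<lambda>i. r i * r i)" unfolding AU using r by (intro diag_conj_cong) auto
  have dr: "dim_row A = n" using vn_algebraD(2)[OF N A(1)] .
  have s: "psd_sqrt A = s"
    unfolding psd_sqrt_def dr
  proof (rule the_equality)
    show "psd_mat n s \<and> s * s = A" using psd ss by simp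
    fix B assume "psd_mat n B \<and> B * B = A"
    then show "B = s" unfolding s_def Ar by (intro psd_mat_sqrt_unique[OF U r(1)]) simp_all
  qed
  have si: "psd_inv_sqrt A = si"
  proof -
    have sc: "s \<in> carrier_mat n n" "si \<in> carrier_mat n n" using vn_algebraD(1)[OF N] sN siN by auto
    have "s \<in> Units (ring_mat TYPE(complex) n ())"
      unfolding Units_def using sc i1 i2 by (auto simp: ring_mat_def)
    then obtain B where B: "mat_inverse s = Some B" using mat_inverse(1)[OF sc(1), where b = "()"] by (cases "mat_inverse s") auto
    then have Bs: "B * s = 1\<^sub>m n" and Bc: "B \<in> carrier_mat n n" using mat_inverse(2)[OF sc(1)] by auto
    have "B = B * 1\<^sub>m n" using right_mult_one_mat[OF Bc] by simp
    also have "\<dots> = B * s * si" unfolding i1[symmetric] using sc Bc by (intro mat_assoc[symmetric]) auto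
    also have "\<dots> = si" unfolding Bs by (rule left_mult_one_mat[OF sc(2)])
    finally have "B = si" .
    then show ?thesis by (simp add: psd_inv_sqrt_def s B)
  qed
  show "psd_sqrt A \<in> N" "mat_adjoint (psd_sqrt A) = psd_sqrt A" "psd_sqrt A * psd_sqrt A = A"
    "psd_inv_sqrt A \<in> N" "mat_adjoint (psd_inv_sqrt A) = psd_inv_sqrt A"
    "psd_sqrt A * psd_inv_sqrt A = 1\<^sub>m n" "psd_inv_sqrt A * psd_sqrt A = 1\<^sub>m n"
    unfolding s si using sN siN sa sia ss i1 i2 by auto
qed

lemma vn_algebra_full: "vn_algebra n (carrier_mat n n)"
  by (auto simp: vn_algebra_def)

text \<open>The trace is the squared Hilbert-Schmidt norm of \<open>S * Y\<close> with
  \<open>S\<close> the square root of \<open>A\<close>, and \<open>S\<close> is invertible. This is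
  faithfulness of the functional given by \<open>A\<close>, in a form that also allows rectangular
  \<open>Y\<close>.\<close>

lemma pd_mat_tr_pos:
  assumes A: "pd_mat n A" and Y: "Y \<in> carrier_mat n m" "Y \<noteq> 0\<^sub>m n m"
  shows "0 < mat_tr (mat_adjoint Y * A * Y)"
proof -
  note s = pd_mat_sqrt[OF vn_algebra_full pd_mat_carrier[OF A] A]
  define S where "S = psd_sqrt A"
  define T where "T = psd_inv_sqrt A"
  note s = s[folded S_def T_def]
  note [simp] = carrier_matD[OF s(1)] carrier_matD[OF s(4)] carrier_matD[OF Y(1)]
  have SY: "S * Y \<in> carrier_mat n m" by simp
  have "S * Y \<noteq> 0\<^sub>m n m"
  proof
    assume "S * Y = 0\<^sub>m n m"
    then have "T * (S * Y) = 0\<^sub>m n m" using right_mult_zero_mat[OF s(4)] by simp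
    then have "Y = 0\<^sub>m n m" using s(7) by (simp add: mat_assoc[symmetric])
    then show False using Y by simp
  qed
  from hs_inner_self_pos[OF SY this]
  have "0 < mat_tr (mat_adjoint Y * (S * S) * Y)"
    by (simp add: hs_inner_def mat_adjoint_mult s(2) mat_assoc)
  then show ?thesis by (simp add: s(3))
qed

text \<open>For an eigenvalue \<open>d k\<close> of the expectation, the spectral projection
  \<open>Q\<close> lies in \<open>N\<close> and can serve as a test element: \<open>d k\<close>
  times the trace of \<open>Q\<close> is the trace of \<open>Q * A * Q\<close>, which is positive.
  Invertibility of \<open>\<rho>N\<close> and of \<kappa> rests on this.\<close>

lemma tracial_exp_pd:
  assumes N: "vn_algebra n N" and A: "pd_mat n A"
  shows "pd_mat n (tracial_exp N A)"
proof -
  have Ac: "A \<in> carrier_mat n n" using pd_mat_carrier[OF A] .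
  define H where "H = tracial_exp N A"
  have HN: "H \<in> N" using tracial_exp_in[OF N Ac] by (simp add: H_def)
  have Hc: "H \<in> carrier_mat n n" using vn_algebraD(1)[OF N HN] .
  note sA = pd_mat_sqrt(1,2,3)[OF vn_algebra_full Ac A]
  have "mat_adjoint A = mat_adjoint (psd_sqrt A * psd_sqrt A)" by (simp add: sA)
  also have "\<dots> = mat_adjoint (psd_sqrt A) * mat_adjoint (psd_sqrt A)"
    using carrier_matD[OF sA(1)] by (intro mat_adjoint_mult) simp
  also have "\<dots> = A" by (simp only: sA)
  finally have "mat_adjoint H = H"
    unfolding H_def using tracial_exp_adjoint[OF N Ac] by simp
  then obtain U d where U: "unitary_mat n U" and HU: "H = diag_conj n U d"
    using hermitian_unitary_diagonalization[OF Hc] by (auto simp: diag_conj_def)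
  note [simp] = unitary_matD(2,3)[OF U] carrier_matD[OF Ac]
  have "0 < d k" if k: "k < n" for k
  proof -
    define Q where "Q = diag_conj n U (\<lambda>i. if d i = d k then 1 else 0)"
    have QN: "Q \<in> N"
      unfolding Q_def using vn_algebra_functional_calculus[OF N U, of d "\<lambda>x. if x = d k then 1 else 0"] HN HU by simp
    have Qc: "Q \<in> carrier_mat n n" using vn_algebraD(1)[OF N QN] .
    note [simp] = carrier_matD[OF Qc]
    have Qa: "mat_adjoint Q = Q" unfolding Q_def diag_conj_adjoint[OF U] by (rule diag_conj_cong) auto
    have QQ: "Q * Q = Q" unfolding Q_def diag_conj_mult[OF U] by (rule diag_conj_cong) auto
    have "Q * H = d k \<cdot>\<^sub>m Q" unfolding Q_def HU diag_conj_mult[OF U] diag_conj_smult[OF U] by (rule diag_conj_cong) auto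
    then have "d k * mat_tr Q = mat_tr (Q * H)" by simp
    also have "\<dots> = mat_tr (Q * A)" unfolding H_def by (rule tracial_exp_tr_left[OF N Ac QN])
    also have "\<dots> = mat_tr (Q * (Q * A))" by (simp add: QQ mat_assoc[symmetric])
    also have "\<dots> = mat_tr (mat_adjoint Q * A * Q)" by (subst mat_tr_comm) (simp_all add: Qa)
    finally have e: "d k * mat_tr Q = mat_tr (mat_adjoint Q * A * Q)" .
    have trQ: "mat_tr Q = of_nat (card {i. i < n \<and> d i = d k})"
      unfolding Q_def diag_conj_tr[OF U] by (simp add: sum.If_cases lessThan_def Int_def)
    have "{i. i < n \<and> d i = d k} \<noteq> {}" using k by auto
    then have c: "0 < card {i. i < n \<and> d i = d k}" by (simp add: card_gt_0_iff)
    have "mat_tr Q \<noteq> 0" using c unfolding trQ of_nat_eq_0_iff by (rule gr_implies_not0)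
    then have "Q \<noteq> 0\<^sub>m n n" by (metis mat_tr_zero)
    from pd_mat_tr_pos[OF A Qc this] have "0 < d k * of_nat (card {i. i < n \<and> d i = d k})"
      using e trQ by simp
    moreover have "0 < z" if "0 < z * of_nat m" "0 < m" for z :: complex and m :: nat
      using that by (auto simp: less_complex_def zero_less_mult_iff)
    ultimately show ?thesis using c by blast
  qed
  then show ?thesis using U HU by (auto simp: pd_mat_def H_def)
qed

section \<open>The fixed-point algebra of the coarse graining operator\<close>

locale coarse_graining =
  fixes n :: nat and M N :: "complex mat set" and \<rho> :: "complex mat"
  assumes vn_M: "vn_algebra n M" and vn_N: "vn_algebra n N" and N_M: "N \<subseteq> M"
    and \<rho>_M: "\<rho> \<in> M" and pd_\<rho>: "pd_mat n \<rho>"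
begin

definition "\<rho>N = tracial_exp N \<rho>"
definition "s = psd_sqrt \<rho>"
definition "si = psd_inv_sqrt \<rho>"
definition "t = psd_sqrt \<rho>N"
definition "ti = psd_inv_sqrt \<rho>N"
abbreviation "C \<equiv> ac_fixed M N \<rho>"

lemma \<rho>_carrier: "\<rho> \<in> carrier_mat n n"
  using vn_algebraD(1)[OF vn_M \<rho>_M] .

lemma \<rho>N_N: "\<rho>N \<in> N"
  using tracial_exp_in[OF vn_N \<rho>_carrier] by (simp add: \<rho>N_def)

lemma pd_\<rho>N: "pd_mat n \<rho>N"
  unfolding \<rho>N_def by (rule tracial_exp_pd[OF vn_N pd_\<rho>])

lemmas s_props = pd_mat_sqrt[OF vn_M \<rho>_M pd_\<rho>, folded s_def si_def]
lemmas t_props = pd_mat_sqrt[OF vn_N \<rho>N_N pd_\<rho>N, folded t_def ti_def]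

lemma in_M_dim: "X \<in> M \<Longrightarrow> dim_row X = n" "X \<in> M \<Longrightarrow> dim_col X = n"
  using vn_algebraD[OF vn_M] by auto

lemma in_N_dim: "X \<in> N \<Longrightarrow> dim_row X = n" "X \<in> N \<Longrightarrow> dim_col X = n"
  using vn_algebraD[OF vn_N] by auto

lemma dims [simp]:
  "dim_row s = n" "dim_col s = n" "dim_row si = n" "dim_col si = n" "dim_row t = n" "dim_col t = n"
  "dim_row ti = n" "dim_col ti = n" "dim_row \<rho> = n" "dim_col \<rho> = n" "dim_row \<rho>N = n" "dim_col \<rho>N = n"
  using s_props t_props \<rho>_M \<rho>N_N in_M_dim in_N_dim by auto

text \<open>The versions with a trailing \<open>X\<close> are the ones that match inside products
  bracketed to the right.\<close>

lemma cancel [simp]: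
  "s * si = 1\<^sub>m n" "si * s = 1\<^sub>m n" "t * ti = 1\<^sub>m n" "ti * t = 1\<^sub>m n"
  "dim_row X = n \<Longrightarrow> s * (si * X) = X" "dim_row X = n \<Longrightarrow> si * (s * X) = X"
  "dim_row X = n \<Longrightarrow> t * (ti * X) = X" "dim_row X = n \<Longrightarrow> ti * (t * X) = X"
  using s_props(6,7) t_props(6,7) by (auto simp: mat_assoc[symmetric])

lemma squares: "s * s = \<rho>" "t * t = \<rho>N" "dim_row X = n \<Longrightarrow> s * (s * X) = \<rho> * X"
  "dim_row X = n \<Longrightarrow> t * (t * X) = \<rho>N * X"
  using s_props(3) t_props(3) by (auto simp: mat_assoc[symmetric])

lemma square_cancel [simp]:
  "si * \<rho> = s" "\<rho> * si = s" "ti * \<rho>N = t" "\<rho>N * ti = t"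
  "dim_row X = n \<Longrightarrow> si * (\<rho> * X) = s * X" "dim_row X = n \<Longrightarrow> \<rho> * (si * X) = s * X"
  "dim_row X = n \<Longrightarrow> ti * (\<rho>N * X) = t * X" "dim_row X = n \<Longrightarrow> \<rho>N * (ti * X) = t * X"
proof -
  have "si * (s * s) = s" "s * s * si = s" "ti * (t * t) = t" "t * t * ti = t"
    by (simp_all add: mat_assoc)
  then show e: "si * \<rho> = s" "\<rho> * si = s" "ti * \<rho>N = t" "\<rho>N * ti = t"
    by (simp_all only: squares)
  show "dim_row X = n \<Longrightarrow> si * (\<rho> * X) = s * X" "dim_row X = n \<Longrightarrow> \<rho> * (si * X) = s * X"
    "dim_row X = n \<Longrightarrow> ti * (\<rho>N * X) = t * X" "dim_row X = n \<Longrightarrow> \<rho>N * (ti * X) = t * X"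
    by (simp_all add: mat_assoc[symmetric] e)
qed

lemma self_adjoint: "mat_adjoint s = s" "mat_adjoint si = si" "mat_adjoint t = t" "mat_adjoint ti = ti"
  "mat_adjoint \<rho> = \<rho>" "mat_adjoint \<rho>N = \<rho>N"
proof -
  show "mat_adjoint s = s" "mat_adjoint si = si" "mat_adjoint t = t" "mat_adjoint ti = ti"
    using s_props t_props by auto
  then have "mat_adjoint (s * s) = s * s" "mat_adjoint (t * t) = t * t"
    by (simp_all add: mat_adjoint_mult del: assoc_mult_mat)
  then show "mat_adjoint \<rho> = \<rho>" "mat_adjoint \<rho>N = \<rho>N"
    by (simp_all only: squares)
qed

lemma accardi_cecchini_eq: "accardi_cecchini N \<rho> X = ti * tracial_exp N (s * X * s) * ti"
  by (simp add: accardi_cecchini_def s_def ti_def \<rho>N_def)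

text \<open>A fixed point equals its own image, and the coarse graining operator takes values in
  \<open>N\<close>.\<close>

lemma C_subset_N: "X \<in> C \<Longrightarrow> X \<in> N"
proof -
  assume X: "X \<in> C"
  then have e: "X = ti * tracial_exp N (s * X * s) * ti" and "X \<in> M"
    by (auto simp: ac_fixed_def accardi_cecchini_eq)
  have "tracial_exp N (s * X * s) \<in> N" by (rule tracial_exp_in[OF vn_N]) simp
  then have "ti * tracial_exp N (s * X * s) * ti \<in> N"
    using t_props(4) by (intro vn_algebraD(6)[OF vn_N])
  with e show "X \<in> N" by simp
qed

lemma C_iff: "X \<in> C \<longleftrightarrow> X \<in> N \<and> tracial_exp N (s * X * s) = t * X * t"
proof
  assume X: "X \<in> C"
  then have XN: "X \<in> N" by (rule C_subset_N)
  note [simp] = in_N_dim[OF XN]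
  define F where "F = tracial_exp N (s * X * s)"
  have e: "ti * F * ti = X" using X by (auto simp: ac_fixed_def accardi_cecchini_eq F_def)
  have d [simp]: "dim_row F = n" "dim_col F = n"
    unfolding F_def by (rule tracial_exp_dim[OF vn_N]; simp)+
  have "t * (ti * F * ti) * t = F"
    by (simp add: mat_assoc)
  then have "F = t * X * t" unfolding e by (rule sym)
  then show "X \<in> N \<and> tracial_exp N (s * X * s) = t * X * t" using XN by (simp add: F_def)
next
  assume X: "X \<in> N \<and> tracial_exp N (s * X * s) = t * X * t"
  then have "dim_row X = n" "dim_col X = n" using in_N_dim by auto
  then show "X \<in> C" using X N_M by (auto simp: ac_fixed_def accardi_cecchini_eq mat_assoc)
qed

lemma tr_\<rho>_N: "X \<in> N \<Longrightarrow> mat_tr (\<rho> * X) = mat_tr (\<rho>N * X)"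
  using tracial_exp_tr_right[OF vn_N \<rho>_carrier] by (simp add: \<rho>N_def)

text \<open>All four terms of the squared norm of \<open>s X - t X t\<^sup>-\<^sup>1 s\<close> equal \<open>Tr[X\<^sup>* \<rho>\<^sub>N X]\<close>.\<close>

lemma C_intertwines:
  assumes X: "X \<in> C"
  shows "s * X = t * X * ti * s"
proof -
  have XN: "X \<in> N" using C_subset_N[OF X] .
  have XaN: "mat_adjoint X \<in> N" using vn_algebraD(7)[OF vn_N XN] .
  note [simp] = in_N_dim[OF XN]
  note N_mult = vn_algebraD(6)[OF vn_N]
  define W where "W = s * X - t * X * ti * s"
  define q where "q = mat_tr (mat_adjoint X * \<rho>N * X)"
  have Wa: "mat_adjoint W = mat_adjoint X * s - s * ti * mat_adjoint X * t"
    by (simp add: W_def mat_adjoint_minus mat_adjoint_mult self_adjoint mat_assoc)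
  have E: "tracial_exp N (s * mat_adjoint X * s) = t * mat_adjoint X * t"
  proof -
    have "tracial_exp N (s * mat_adjoint X * s) = tracial_exp N (mat_adjoint (s * X * s))"
      by (simp add: mat_adjoint_mult self_adjoint mat_assoc)
    also have "\<dots> = mat_adjoint (tracial_exp N (s * X * s))" by (rule tracial_exp_adjoint[OF vn_N]) simp
    also have "\<dots> = mat_adjoint (t * X * t)" using X by (simp add: C_iff)
    also have "\<dots> = t * mat_adjoint X * t" by (simp add: mat_adjoint_mult self_adjoint mat_assoc)
    finally show ?thesis .
  qed
  have a: "mat_tr (mat_adjoint X * s * (s * X)) = q"
  proof -
    have "mat_tr (mat_adjoint X * s * (s * X)) = mat_tr (\<rho> * (X * mat_adjoint X))"
      by (simp add: mat_assoc squares) (subst mat_tr_comm, simp_all add: mat_assoc)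
    also have "\<dots> = mat_tr (\<rho>N * X * mat_adjoint X)"
      using tr_\<rho>_N[OF N_mult[OF XN XaN]] by (simp add: mat_assoc)
    also have "\<dots> = q" unfolding q_def by (subst mat_tr_comm) (simp_all add: mat_assoc)
    finally show ?thesis .
  qed
  \<comment> \<open>Only this cross term and its conjugate use the fixed-point equation: after a
    cyclic rotation \<open>s * mat_adjoint X * s\<close> is paired with an element of
    \<open>N\<close> and may be replaced by its expectation. The two diagonal terms take the value
    \<open>q\<close> for every element of \<open>N\<close>.\<close>
  have b: "mat_tr (mat_adjoint X * s * (t * X * ti * s)) = q"
  proof -
    have "mat_tr (mat_adjoint X * s * (t * X * ti * s)) = mat_tr (s * mat_adjoint X * s * (t * X * ti))"
      using mat_tr_comm[of "mat_adjoint X * s * t * X * ti" s] by (simp add: mat_assoc)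
    also have "\<dots> = mat_tr (t * mat_adjoint X * t * (t * X * ti))"
      unfolding E[symmetric] using XN t_props N_mult
      by (intro tracial_exp_tr_right[OF vn_N, symmetric]) auto
    also have "\<dots> = mat_tr (t * mat_adjoint X * \<rho>N * X * ti)" by (simp add: mat_assoc squares)
    also have "\<dots> = q" unfolding q_def
      using mat_tr_comm[of "t * mat_adjoint X * \<rho>N * X" ti] by (simp add: mat_assoc)
    finally show ?thesis .
  qed
  have c: "mat_tr (s * ti * mat_adjoint X * t * (s * X)) = cnj q"
    unfolding b[symmetric] by (subst mat_tr_adjoint[symmetric]) (simp_all add: mat_adjoint_mult self_adjoint mat_assoc)
  have d: "mat_tr (s * ti * mat_adjoint X * t * (t * X * ti * s)) = q"
  proof -
    have "mat_tr (s * ti * mat_adjoint X * t * (t * X * ti * s)) = mat_tr (\<rho> * (ti * mat_adjoint X * \<rho>N * X * ti))"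
      using mat_tr_comm[of "s * ti * mat_adjoint X * \<rho>N * X * ti" s] by (simp add: mat_assoc squares)
    also have "\<dots> = mat_tr (\<rho>N * (ti * mat_adjoint X * \<rho>N * X * ti))"
      using XN XaN t_props \<rho>N_N by (intro tr_\<rho>_N N_mult)
    also have "\<dots> = mat_tr (t * mat_adjoint X * \<rho>N * X * ti)" by (simp add: mat_assoc)
    also have "\<dots> = q" unfolding q_def
      using mat_tr_comm[of "t * mat_adjoint X * \<rho>N * X" ti] by (simp add: mat_assoc)
    finally show ?thesis .
  qed
  \<comment> \<open>The expansion below leaves \<open>q - cnj q\<close>, which vanishes because
    \<open>\<rho>N\<close> is self-adjoint.\<close>
  have "cnj q = q" unfolding q_def
    by (subst mat_tr_adjoint[symmetric]) (simp_all add: mat_adjoint_mult self_adjoint mat_assoc)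
  moreover have "hs_inner W W = q - q - cnj q + q"
    unfolding hs_inner_def Wa unfolding W_def
    by (simp add: mat_distribs mat_tr_minus a b c d)
  ultimately have "hs_inner W W = 0" by simp
  moreover have "W \<in> carrier_mat n n" by (auto simp: W_def)
  ultimately have W0: "W = 0\<^sub>m n n" using hs_inner_self(2) by blast
  show ?thesis
  proof (rule eq_matI)
    fix i j assume "i < dim_row (t * X * ti * s)" "j < dim_col (t * X * ti * s)"
    then show "(s * X) $$ (i, j) = (t * X * ti * s) $$ (i, j)"
      using arg_cong[OF W0, of "\<lambda>A. A $$ (i, j)"] by (simp add: W_def del: index_mult_mat(1))
  qed auto
qed

text \<open>For the converse, \<open>s * X * s\<close> is \<open>(s * X * si) * \<rho>\<close>, that
  is \<open>t * X * ti * \<rho>\<close>, and the factor in front of \<rho> lies in \<open>N\<close>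
  and leaves the expectation. The criterion equates two multiplicative maps, so closure of
  \<open>C\<close> under products becomes visible.\<close>

lemma C_modular: "X \<in> C \<longleftrightarrow> X \<in> N \<and> s * X * si = t * X * ti"
proof
  assume X: "X \<in> C"
  have XN: "X \<in> N" using C_subset_N[OF X] .
  note [simp] = in_N_dim[OF XN]
  have "s * X * si = t * X * ti" by (simp add: C_intertwines[OF X] mat_assoc)
  then show "X \<in> N \<and> s * X * si = t * X * ti" using XN by simp
next
  assume X: "X \<in> N \<and> s * X * si = t * X * ti"
  then have XN: "X \<in> N" by simp
  note [simp] = in_N_dim[OF XN]
  have "s * X * s = (s * X * si) * \<rho>" by (simp add: mat_assoc)
  also have "\<dots> = t * X * ti * \<rho>" using X by simp
  finally have "tracial_exp N (s * X * s) = t * X * ti * \<rho>N"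
    unfolding \<rho>N_def using tracial_exp_mult_left[OF vn_N \<rho>_carrier] XN t_props vn_algebraD(6)[OF vn_N] by simp
  then show "X \<in> C" using XN by (simp add: C_iff mat_assoc)
qed

lemma C_dim: "X \<in> C \<Longrightarrow> dim_row X = n" "X \<in> C \<Longrightarrow> dim_col X = n"
  using C_subset_N in_N_dim by auto

text \<open>Products use the conjugation criterion. Adjoints use \<open>C_iff\<close> instead: its
  equation is symmetric under adjoints, whereas the adjoint of \<open>s * X * si\<close> has the two
  roots exchanged.\<close>

lemma vn_C: "vn_algebra n C"
  unfolding vn_algebra_def
proof (intro conjI ballI allI)
  show "C \<subseteq> carrier_mat n n" using C_subset_N vn_algebraD(1)[OF vn_N] by blast
  show "1\<^sub>m n \<in> C" using vn_algebraD(4)[OF vn_N] by (simp add: C_modular)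
next
  fix A B assume AB: "A \<in> C" "B \<in> C"
  note d [simp] = C_dim[OF AB(1)] C_dim[OF AB(2)]
  have N: "A \<in> N" "B \<in> N" and m: "s * A * si = t * A * ti" "s * B * si = t * B * ti"
    using AB by (auto simp: C_modular)
  show "A + B \<in> C" using N m vn_algebraD(5)[OF vn_N] by (simp add: C_modular mat_distribs)
  have "s * (A * B) * si = (s * A * si) * (s * B * si)" by (simp add: mat_assoc)
  also have "\<dots> = t * (A * B) * ti" unfolding m by (simp add: mat_assoc)
  finally show "A * B \<in> C" using N vn_algebraD(6)[OF vn_N] by (simp add: C_modular)
next
  fix A c assume A: "A \<in> C"
  note d [simp] = C_dim[OF A]
  have N: "A \<in> N" and m: "s * A * si = t * A * ti" using A by (auto simp: C_modular)
  show "c \<cdot>\<^sub>m A \<in> C" using N m vn_algebraD(8)[OF vn_N] by (simp add: C_modular mat_distribs)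
next
  fix A assume A: "A \<in> C"
  note d [simp] = C_dim[OF A]
  have "tracial_exp N (s * mat_adjoint A * s) = tracial_exp N (mat_adjoint (s * A * s))"
    by (simp add: mat_adjoint_mult self_adjoint mat_assoc)
  also have "\<dots> = mat_adjoint (tracial_exp N (s * A * s))" by (rule tracial_exp_adjoint[OF vn_N]) simp
  also have "\<dots> = mat_adjoint (t * A * t)" using A by (simp add: C_iff)
  also have "\<dots> = t * mat_adjoint A * t" by (simp add: mat_adjoint_mult self_adjoint mat_assoc)
  finally show "mat_adjoint A \<in> C" using A vn_algebraD(7)[OF vn_N] by (simp add: C_iff)
qed

lemma C_modular_invariant:
  assumes X: "X \<in> C"
  shows "s * X * si \<in> C"
proof -
  note [simp] = C_dim[OF X]
  have XN: "X \<in> N" and m: "s * X * si = t * X * ti" using X by (auto simp: C_modular)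
  have "s * X * si \<in> N" unfolding m using XN t_props vn_algebraD(6)[OF vn_N] by simp
  moreover have "tracial_exp N (s * (s * X * si) * s) = \<rho>N * X"
    using tracial_exp_mult_right[OF vn_N \<rho>_carrier XN] by (simp add: mat_assoc squares \<rho>N_def)
  moreover have "\<rho>N * X = t * (s * X * si) * t" unfolding m by (simp add: mat_assoc squares)
  ultimately show ?thesis by (simp add: C_iff)
qed

text \<open>Taking adjoints exchanges \<open>s\<close> with \<open>si\<close>, so the reverse
  conjugation follows from the previous one.\<close>

lemma C_modular_invariant':
  assumes X: "X \<in> C"
  shows "si * X * s \<in> C"
proof -
  note [simp] = C_dim[OF X]
  have "mat_adjoint (s * mat_adjoint X * si) \<in> C"
    using X vn_algebraD(7)[OF vn_C] C_modular_invariant by blast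
  then show ?thesis by (simp add: mat_adjoint_mult self_adjoint mat_assoc)
qed

section \<open>The density of \<rho> on the fixed-point algebra and the commutant\<close>

definition "\<kappa> = tracial_exp C \<rho>"
text \<open>The inverse of \<kappa>, written through the inverse root because that root is already
  known to lie in \<open>C\<close>.\<close>

definition "\<kappa>i = psd_inv_sqrt \<kappa> * psd_inv_sqrt \<kappa>"

lemma \<kappa>_C: "\<kappa> \<in> C"
  unfolding \<kappa>_def by (rule tracial_exp_in[OF vn_C \<rho>_carrier])

lemma pd_\<kappa>: "pd_mat n \<kappa>"
  unfolding \<kappa>_def by (rule tracial_exp_pd[OF vn_C pd_\<rho>])

lemma \<kappa>i_C: "\<kappa>i \<in> C"
  unfolding \<kappa>i_def using pd_mat_sqrt(4)[OF vn_C \<kappa>_C pd_\<kappa>] vn_algebraD(6)[OF vn_C] by simp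

lemma \<kappa>_dims [simp]: "dim_row \<kappa> = n" "dim_col \<kappa> = n" "dim_row \<kappa>i = n" "dim_col \<kappa>i = n"
  using C_dim \<kappa>_C \<kappa>i_C by auto

lemma \<kappa>_cancel [simp]: "\<kappa> * \<kappa>i = 1\<^sub>m n" "\<kappa>i * \<kappa> = 1\<^sub>m n"
  "dim_row X = n \<Longrightarrow> \<kappa> * (\<kappa>i * X) = X" "dim_row X = n \<Longrightarrow> \<kappa>i * (\<kappa> * X) = X"
proof -
  note r = pd_mat_sqrt[OF vn_C \<kappa>_C pd_\<kappa>]
  define k where "k = psd_sqrt \<kappa>"
  define ki where "ki = psd_inv_sqrt \<kappa>"
  note r = r[folded k_def ki_def]
  note [simp] = C_dim[OF r(1)] C_dim[OF r(4)]
  have "k * k * (ki * ki) = k * (k * ki) * ki" "ki * ki * (k * k) = ki * (ki * k) * k"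
    by (simp_all add: mat_assoc)
  then have "k * k * (ki * ki) = 1\<^sub>m n" "ki * ki * (k * k) = 1\<^sub>m n" using r(6,7) by simp_all
  then show 1: "\<kappa> * \<kappa>i = 1\<^sub>m n" "\<kappa>i * \<kappa> = 1\<^sub>m n"
    by (simp_all only: r(3) \<kappa>i_def ki_def)
  show "dim_row X = n \<Longrightarrow> \<kappa> * (\<kappa>i * X) = X" "dim_row X = n \<Longrightarrow> \<kappa>i * (\<kappa> * X) = X"
    using 1 by (simp_all add: mat_assoc[symmetric])
qed

text \<open>\<open>Y\<close> is \<open>X\<close> conjugated by \<rho>, written as two conjugations
  by the square root: each stays in \<open>C\<close>, and each may be replaced by conjugation with
  \<open>t\<close>, which gives the relation for \<open>\<rho>N\<close>.\<close>

lemma intertwine: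
  assumes X: "X \<in> C"
  defines "Y \<equiv> s * (s * X * si) * si"
  shows "Y \<in> C" "\<rho> * X = Y * \<rho>" "\<rho>N * X = Y * \<rho>N" "\<kappa> * X = Y * \<kappa>"
proof -
  note [simp] = C_dim[OF X]
  have X': "s * X * si \<in> C" by (rule C_modular_invariant[OF X])
  show YC: "Y \<in> C" unfolding Y_def by (rule C_modular_invariant[OF X'])
  note [simp] = C_dim[OF YC]
  show \<rho>X: "\<rho> * X = Y * \<rho>" by (simp add: Y_def mat_assoc squares)
  have "s * X * si = t * X * ti" "s * (s * X * si) * si = t * (s * X * si) * ti"
    using X X' by (auto simp: C_modular)
  then have "Y = t * (t * X * ti) * ti" by (simp add: Y_def)
  then show "\<rho>N * X = Y * \<rho>N" by (simp add: mat_assoc squares)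
  show "\<kappa> * X = Y * \<kappa>"
    using tracial_exp_mult_right[OF vn_C \<rho>_carrier X] tracial_exp_mult_left[OF vn_C \<rho>_carrier YC] \<rho>X
    by (simp add: \<kappa>_def)
qed

lemma commutant:
  assumes X: "X \<in> C"
  shows "\<kappa>i * \<rho> * X = X * (\<kappa>i * \<rho>)" "\<kappa>i * \<rho>N * X = X * (\<kappa>i * \<rho>N)"
proof -
  define Y where "Y = s * (s * X * si) * si"
  note i = intertwine[OF X, folded Y_def]
  note [simp] = C_dim[OF X] C_dim[OF i(1)]
  have "\<kappa>i * (Y * \<kappa>) * \<kappa>i = \<kappa>i * (\<kappa> * X) * \<kappa>i" by (simp add: i)
  then have "\<kappa>i * Y = X * \<kappa>i" by (simp add: mat_assoc)
  then have k: "\<kappa>i * (Y * Z) = X * (\<kappa>i * Z)" if "dim_row Z = n" for Z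
    using that by (simp add: mat_assoc[symmetric])
  show "\<kappa>i * \<rho> * X = X * (\<kappa>i * \<rho>)" "\<kappa>i * \<rho>N * X = X * (\<kappa>i * \<rho>N)"
    by (simp_all add: mat_assoc i k)
qed

text \<open>With \<open>Z = si * \<sigma> * si\<close> the Petz equation reads exactly as the
  fixed-point equation for \<open>Z\<close>. Then
  \<open>\<sigma> = s * Z * s = \<rho> * (si * Z * s)\<close>, and the last factor stays in
  \<open>C\<close> by modular invariance.\<close>

lemma petz_iff:
  assumes \<sigma>: "\<sigma> \<in> M"
  shows "petz_recovery N \<rho> (tracial_exp N \<sigma>) = \<sigma> \<longleftrightarrow> (\<exists>Z\<in>C. \<sigma> = \<rho> * Z)"
proof -
  note [simp] = in_M_dim[OF \<sigma>]
  have \<sigma>c: "\<sigma> \<in> carrier_mat n n" using vn_algebraD(1)[OF vn_M \<sigma>] .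
  note [simp] = tracial_exp_dim[OF vn_N \<sigma>c]
  have petz: "petz_recovery N \<rho> Y = s * ti * Y * ti * s" for Y
    by (simp add: petz_recovery_def s_def ti_def \<rho>N_def)
  show ?thesis
  proof
    assume "petz_recovery N \<rho> (tracial_exp N \<sigma>) = \<sigma>"
    then have e: "s * ti * tracial_exp N \<sigma> * ti * s = \<sigma>" by (simp add: petz)
    define Z where "Z = si * \<sigma> * si"
    have ZM: "Z \<in> M" unfolding Z_def using \<sigma> s_props vn_algebraD(6)[OF vn_M] by simp
    have Z: "Z = ti * tracial_exp N \<sigma> * ti" unfolding Z_def by (subst e[symmetric]) (simp add: mat_assoc)
    have sZs: "s * Z * s = \<sigma>" by (simp add: Z_def mat_assoc)
    have "accardi_cecchini N \<rho> Z = Z" unfolding accardi_cecchini_eq sZs by (rule Z[symmetric])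
    then have "Z \<in> C" using ZM by (simp add: ac_fixed_def)
    then have "si * Z * s \<in> C" by (rule C_modular_invariant')
    moreover have "\<sigma> = \<rho> * (si * Z * s)"
      unfolding Z_def by (simp add: mat_assoc)
    ultimately show "\<exists>Z\<in>C. \<sigma> = \<rho> * Z" by blast
  next
    assume "\<exists>Z\<in>C. \<sigma> = \<rho> * Z"
    then obtain Z where Z: "Z \<in> C" and \<sigma>Z: "\<sigma> = \<rho> * Z" by blast
    note [simp] = C_dim[OF Z]
    have ZN: "Z \<in> N" and m: "s * Z * si = t * Z * ti" using Z by (auto simp: C_modular)
    have "tracial_exp N \<sigma> = \<rho>N * Z"
      using tracial_exp_mult_right[OF vn_N \<rho>_carrier ZN] by (simp add: \<sigma>Z \<rho>N_def)
    then have "petz_recovery N \<rho> (tracial_exp N \<sigma>) = s * (t * Z * ti) * s"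
      by (simp add: petz mat_assoc)
    also have "\<dots> = \<sigma>" unfolding m[symmetric] by (simp add: \<sigma>Z mat_assoc squares)
    finally show "petz_recovery N \<rho> (tracial_exp N \<sigma>) = \<sigma>" .
  qed
qed

text \<open>By cyclicity \<rho> moves to the right of \<open>X\<close>. The orthogonality condition
  then says that \<open>X * \<rho>\<close> and \<open>Y * \<kappa>\<close> have the same trace
  against all of \<open>C\<close>, and \<kappa> is invertible in \<open>C\<close>.\<close>

lemma gns_exp_eq:
  assumes X: "X \<in> carrier_mat n n"
  shows "gns_exp C \<rho> X = tracial_exp C (X * \<rho>) * \<kappa>i"
  unfolding gns_exp_def orth_proj_def
proof (rule the_equality, intro conjI ballI)
  note [simp] = carrier_matD[OF X] C_dim
  have X\<rho>: "X * \<rho> \<in> carrier_mat n n" by simp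
  define Y where "Y = tracial_exp C (X * \<rho>) * \<kappa>i"
  note [simp] = tracial_exp_dim[OF vn_C X\<rho>]
  have YC: "Y \<in> C"
    unfolding Y_def using tracial_exp_in[OF vn_C X\<rho>] \<kappa>i_C vn_algebraD(6)[OF vn_C] by simp
  show "tracial_exp C (X * \<rho>) * \<kappa>i \<in> C" using YC by (simp add: Y_def)
  have inner: "gns_inner \<rho> Z (X - B) = mat_tr (mat_adjoint Z * (X * \<rho>)) - mat_tr (mat_adjoint Z * B * \<kappa>)"
    if Z: "Z \<in> C" and B: "B \<in> C" for Z B
  proof -
    note [simp] = C_dim[OF Z] C_dim[OF B]
    have "gns_inner \<rho> Z (X - B) = mat_tr (\<rho> * (mat_adjoint Z * X)) - mat_tr (\<rho> * (mat_adjoint Z * B))"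
      by (simp add: gns_inner_def mat_assoc mat_distribs mat_tr_minus)
    also have "mat_tr (\<rho> * (mat_adjoint Z * X)) = mat_tr (mat_adjoint Z * (X * \<rho>))"
      by (subst mat_tr_comm) (simp_all add: mat_assoc)
    also have "mat_tr (\<rho> * (mat_adjoint Z * B)) = mat_tr (\<kappa> * (mat_adjoint Z * B))"
      unfolding \<kappa>_def using Z B vn_algebraD(6,7)[OF vn_C]
      by (intro tracial_exp_tr_right[OF vn_C \<rho>_carrier, symmetric]) simp
    also have "\<dots> = mat_tr (mat_adjoint Z * B * \<kappa>)" by (subst mat_tr_comm) simp_all
    finally show ?thesis .
  qed
  have orth: "gns_inner \<rho> Z (X - Y) = 0" if Z: "Z \<in> C" for Z
    using tracial_exp_tr_left[OF vn_C X\<rho> vn_algebraD(7)[OF vn_C Z]] C_dim[OF Z]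
    unfolding inner[OF Z YC] by (simp add: Y_def mat_assoc)
  show "gns_inner \<rho> Z (X - tracial_exp C (X * \<rho>) * \<kappa>i) = 0" if Z: "Z \<in> C" for Z
    using orth[OF Z] by (simp add: Y_def)
  fix B assume "B \<in> C \<and> (\<forall>Z\<in>C. gns_inner \<rho> Z (X - B) = 0)"
  then have B: "B \<in> C" and oB: "\<And>Z. Z \<in> C \<Longrightarrow> gns_inner \<rho> Z (X - B) = 0" by auto
  note [simp] = C_dim[OF B] C_dim[OF YC]
  define D where "D = B - Y"
  have D: "D \<in> C" unfolding D_def by (rule mat_subspace_minus[OF vn_algebra_subspace[OF vn_C] B YC])
  note [simp] = C_dim[OF D]
  have Dc: "mat_adjoint D \<in> carrier_mat n n" using vn_algebraD(1,7)[OF vn_C] D by blast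
  \<comment> \<open>The GNS norm has \<rho> outside the product, so faithfulness is applied to the
    adjoint of \<open>D\<close>.\<close>
  have "mat_tr (mat_adjoint (mat_adjoint D) * \<rho> * mat_adjoint D) = gns_inner \<rho> D D"
    unfolding gns_inner_def by (subst mat_tr_comm) (simp_all add: mat_assoc, subst mat_tr_comm, simp_all add: mat_assoc)
  also have "\<dots> = gns_inner \<rho> D (X - Y) - gns_inner \<rho> D (X - B)"
  proof -
    have "X - Y = D + (X - B)" by (rule eq_matI) (auto simp: D_def)
    then show ?thesis by (simp add: gns_inner_def mat_distribs mat_tr_add)
  qed
  also have "\<dots> = 0" using orth[OF D] oB[OF D] by simp
  finally have "mat_adjoint D = 0\<^sub>m n n"
    using pd_mat_tr_pos[OF pd_\<rho> Dc] by (metis order_less_irrefl)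
  then have "D = mat_adjoint (0\<^sub>m n n)" by (metis mat_adjoint_adjoint)
  also have "\<dots> = 0\<^sub>m n n" by (rule eq_matI) auto
  finally have D0: "D = 0\<^sub>m n n" .
  have "B = Y"
  proof (rule eq_matI)
    fix i j assume "i < dim_row Y" "j < dim_col Y"
    then show "B $$ (i, j) = Y $$ (i, j)"
      using arg_cong[OF D0, of "\<lambda>A. A $$ (i, j)"] by (simp add: D_def)
  qed simp_all
  then show "B = tracial_exp C (X * \<rho>) * \<kappa>i" by (simp add: Y_def)
qed

text \<open>Composing \<sigma> with the conditional expectation gives the functional with density
  \<open>\<rho> * Z\<close>, where \<open>Z\<close> is \<open>\<kappa>i\<close> times the tracial
  projection of \<sigma> to \<open>C\<close>. Preservation therefore means
  \<open>\<sigma> = \<rho> * Z\<close>, as testing with the adjoint of the difference shows;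
  conversely \<open>\<sigma> = \<rho> * Z'\<close> forces \<open>Z = Z'\<close>.\<close>

lemma gns_preserved_iff:
  assumes \<sigma>: "\<sigma> \<in> M"
  shows "(\<forall>X\<in>M. mat_tr (\<sigma> * X) = mat_tr (\<sigma> * gns_exp C \<rho> X)) \<longleftrightarrow> (\<exists>Z\<in>C. \<sigma> = \<rho> * Z)"
proof -
  note [simp] = in_M_dim[OF \<sigma>]
  have \<sigma>c: "\<sigma> \<in> carrier_mat n n" using vn_algebraD(1)[OF vn_M \<sigma>] .
  define Z where "Z = \<kappa>i * tracial_exp C \<sigma>"
  have ZC: "Z \<in> C" unfolding Z_def using \<kappa>i_C tracial_exp_in[OF vn_C \<sigma>c] vn_algebraD(6)[OF vn_C] by simp
  have ZE: "Z = tracial_exp C (\<kappa>i * \<sigma>)" unfolding Z_def by (rule tracial_exp_mult_left[OF vn_C \<sigma>c \<kappa>i_C, symmetric])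
  note [simp] = C_dim[OF ZC]
  have tr: "mat_tr (\<sigma> * gns_exp C \<rho> X) = mat_tr (\<rho> * Z * X)" if X: "X \<in> M" for X
  proof -
    note [simp] = in_M_dim[OF X]
    have Xc: "X \<in> carrier_mat n n" using vn_algebraD(1)[OF vn_M X] .
    have X\<rho>: "X * \<rho> \<in> carrier_mat n n" and \<kappa>\<sigma>: "\<kappa>i * \<sigma> \<in> carrier_mat n n" by simp_all
    define F where "F = tracial_exp C (X * \<rho>)"
    have F: "F \<in> C" unfolding F_def by (rule tracial_exp_in[OF vn_C X\<rho>])
    note [simp] = C_dim[OF F]
    have "mat_tr (\<sigma> * gns_exp C \<rho> X) = mat_tr (\<sigma> * (F * \<kappa>i))" by (simp add: gns_exp_eq[OF Xc] F_def)
    also have "\<dots> = mat_tr (\<kappa>i * \<sigma> * F)" using mat_tr_comm[of "\<sigma> * F" \<kappa>i] by (simp add: mat_assoc)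
    also have "\<dots> = mat_tr (Z * F)" unfolding ZE by (rule tracial_exp_tr_right[OF vn_C \<kappa>\<sigma> F, symmetric])
    also have "\<dots> = mat_tr (Z * (X * \<rho>))" unfolding F_def by (rule tracial_exp_tr_left[OF vn_C X\<rho> ZC])
    also have "\<dots> = mat_tr (\<rho> * Z * X)" using mat_tr_comm[of "Z * X" \<rho>] by (simp add: mat_assoc)
    finally show ?thesis .
  qed
  show ?thesis
  proof
    assume L: "\<forall>X\<in>M. mat_tr (\<sigma> * X) = mat_tr (\<sigma> * gns_exp C \<rho> X)"
    define D where "D = \<sigma> - \<rho> * Z"
    have "\<rho> * Z \<in> M" using \<rho>_M ZC C_subset_N N_M vn_algebraD(6)[OF vn_M] by blast
    then have DM: "D \<in> M" unfolding D_def by (intro mat_subspace_minus[OF vn_algebra_subspace[OF vn_M] \<sigma>])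
    note [simp] = in_M_dim[OF DM]
    have aM: "mat_adjoint D \<in> M" using vn_algebraD(7)[OF vn_M DM] .
    have "mat_tr (D * mat_adjoint D) = mat_tr (\<sigma> * mat_adjoint D) - mat_tr (\<rho> * Z * mat_adjoint D)"
      by (subst D_def) (simp add: mat_distribs mat_tr_minus)
    also have "\<dots> = 0" using L tr[OF aM] aM by simp
    finally have "hs_inner D D = 0" unfolding hs_inner_def by (subst mat_tr_comm) simp_all
    then have D0: "D = 0\<^sub>m n n" using hs_inner_self(2) vn_algebraD(1)[OF vn_M DM] by blast
    have "\<sigma> = \<rho> * Z"
    proof (rule eq_matI)
      fix i j assume "i < dim_row (\<rho> * Z)" "j < dim_col (\<rho> * Z)"
      then show "\<sigma> $$ (i, j) = (\<rho> * Z) $$ (i, j)"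
        using arg_cong[OF D0, of "\<lambda>A. A $$ (i, j)"] by (simp add: D_def del: index_mult_mat(1))
    qed simp_all
    then show "\<exists>Z\<in>C. \<sigma> = \<rho> * Z" using ZC by blast
  next
    assume "\<exists>Z\<in>C. \<sigma> = \<rho> * Z"
    then obtain Z' where Z': "Z' \<in> C" "\<sigma> = \<rho> * Z'" by blast
    have "Z = \<kappa>i * (\<kappa> * Z')"
      using tracial_exp_mult_right[OF vn_C \<rho>_carrier Z'(1)] by (simp add: Z_def Z'(2) \<kappa>_def)
    then have "\<rho> * Z = \<sigma>" using Z' C_dim[OF Z'(1)] by simp
    then show "\<forall>X\<in>M. mat_tr (\<sigma> * X) = mat_tr (\<sigma> * gns_exp C \<rho> X)" using tr by simp
  qed
qed

end

section \<open>Tensor products and block decompositions\<close>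

lemma mat_tensor_dim [simp]:
  "dim_row (A \<otimes>\<^sub>m B) = dim_row A * dim_row B" "dim_col (A \<otimes>\<^sub>m B) = dim_col A * dim_col B"
  by (simp_all add: mat_tensor_def)

lemma mat_tensor_index:
  "i < dim_row A * dim_row B \<Longrightarrow> j < dim_col A * dim_col B \<Longrightarrow>
   (A \<otimes>\<^sub>m B) $$ (i, j) = A $$ (i div dim_row B, j div dim_col B) * B $$ (i mod dim_row B, j mod dim_col B)"
  by (simp add: mat_tensor_def)

lemma tensor_bounds:
  fixes i p q :: nat
  assumes "i < p * q"
  shows "i div q < p" "i mod q < q"
  using assms by (auto simp: less_mult_imp_div_less intro!: mod_less_divisor gr0I)

lemma tensor_index_less:
  fixes a b p q :: nat
  assumes "a < p" "b < q"
  shows "a * q + b < p * q"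
proof -
  have "a * q + b < Suc a * q" using assms by simp
  also have "\<dots> \<le> p * q" using assms by (intro mult_right_mono) auto
  finally show ?thesis .
qed

lemma sum_div_mod:
  fixes h :: "nat \<Rightarrow> nat \<Rightarrow> complex"
  shows "(\<Sum>l<p * q. h (l div q) (l mod q)) = (\<Sum>a<p. \<Sum>b<q. h a b)"
proof -
  have "(\<Sum>l<p * q. h (l div q) (l mod q)) = (\<Sum>a<p. \<Sum>l\<in>{a * q..<a * q + q}. h (l div q) (l mod q))"
    by (rule sum.nat_group[symmetric])
  also have "\<dots> = (\<Sum>a<p. \<Sum>b<q. h a b)"
  proof (rule sum.cong)
    fix a
    have "(\<Sum>l\<in>{a * q..<a * q + q}. h (l div q) (l mod q)) = (\<Sum>b<q. h ((a * q + b) div q) ((a * q + b) mod q))"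
      by (rule sum.reindex_bij_witness[of _ "\<lambda>b. a * q + b" "\<lambda>l. l - a * q"]) auto
    also have "\<dots> = (\<Sum>b<q. h a b)"
      by (rule sum.cong) auto
    finally show "(\<Sum>l\<in>{a * q..<a * q + q}. h (l div q) (l mod q)) = (\<Sum>b<q. h a b)" .
  qed simp
  finally show ?thesis .
qed

lemma mat_tensor_mult:
  assumes "dim_col A = dim_row A'" "dim_col B = dim_row B'"
  shows "(A \<otimes>\<^sub>m B) * (A' \<otimes>\<^sub>m B') = (A * A') \<otimes>\<^sub>m (B * B')"
proof (rule eq_matI)
  fix i j assume "i < dim_row ((A * A') \<otimes>\<^sub>m (B * B'))" "j < dim_col ((A * A') \<otimes>\<^sub>m (B * B'))"
  then have ij: "i < dim_row A * dim_row B" "j < dim_col A' * dim_col B'" by auto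
  let ?p = "dim_row A'" and ?q = "dim_row B'"
  let ?a = "i div dim_row B" and ?b = "i mod dim_row B" and ?c = "j div dim_col B'" and ?d = "j mod dim_col B'"
  note bd = tensor_bounds[OF ij(1)] tensor_bounds[OF ij(2)]
  have "((A \<otimes>\<^sub>m B) * (A' \<otimes>\<^sub>m B')) $$ (i, j) =
      (\<Sum>l<?p * ?q. (A $$ (?a, l div ?q) * B $$ (?b, l mod ?q)) * (A' $$ (l div ?q, ?c) * B' $$ (l mod ?q, ?d)))"
    using ij assms by (simp add: mat_mult_index mat_tensor_index del: index_mult_mat(1))
  also have "\<dots> = (\<Sum>k<?p. \<Sum>l<?q. (A $$ (?a, k) * B $$ (?b, l)) * (A' $$ (k, ?c) * B' $$ (l, ?d)))"
    by (rule sum_div_mod)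
  also have "\<dots> = (\<Sum>k<?p. A $$ (?a, k) * A' $$ (k, ?c)) * (\<Sum>l<?q. B $$ (?b, l) * B' $$ (l, ?d))"
    by (simp add: sum_product mult_ac)
  also have "\<dots> = ((A * A') \<otimes>\<^sub>m (B * B')) $$ (i, j)"
    using ij assms bd by (simp add: mat_tensor_index mat_mult_index del: index_mult_mat(1))
  finally show "((A \<otimes>\<^sub>m B) * (A' \<otimes>\<^sub>m B')) $$ (i, j) = ((A * A') \<otimes>\<^sub>m (B * B')) $$ (i, j)" .
qed auto

lemma mat_tensor_smult:
  "(c \<cdot>\<^sub>m A) \<otimes>\<^sub>m B = c \<cdot>\<^sub>m (A \<otimes>\<^sub>m B)" "A \<otimes>\<^sub>m (c \<cdot>\<^sub>m B) = c \<cdot>\<^sub>m (A \<otimes>\<^sub>m B)"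
  by (rule eq_matI; auto simp: mat_tensor_index tensor_bounds)+

lemma mat_tensor_zero [simp]: "A \<otimes>\<^sub>m 0\<^sub>m q r = 0\<^sub>m (dim_row A * q) (dim_col A * r)"
  by (rule eq_matI) (auto simp: mat_tensor_index tensor_bounds)

lemma partial_trace_left_tensor:
  assumes "A \<in> carrier_mat p p" "B \<in> carrier_mat q q"
  shows "partial_trace_left p q (A \<otimes>\<^sub>m B) = mat_tr A \<cdot>\<^sub>m B"
proof (rule eq_matI)
  fix a b assume "a < dim_row (mat_tr A \<cdot>\<^sub>m B)" "b < dim_col (mat_tr A \<cdot>\<^sub>m B)"
  then have ab: "a < q" "b < q" using assms by auto
  have "(A \<otimes>\<^sub>m B) $$ (i * q + a, i * q + b) = A $$ (i, i) * B $$ (a, b)" if "i < p" for i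
    using assms ab tensor_index_less[OF that] by (simp add: mat_tensor_index)
  then show "partial_trace_left p q (A \<otimes>\<^sub>m B) $$ (a, b) = (mat_tr A \<cdot>\<^sub>m B) $$ (a, b)"
    using ab assms by (simp add: partial_trace_left_def mat_tr_def sum_distrib_right)
qed (use assms in \<open>auto simp: partial_trace_left_def\<close>)

text \<open>The isometry \<open>v \<mapsto> v \<otimes> e\<^sub>0\<close>.\<close>

definition corner_incl :: "nat \<Rightarrow> nat \<Rightarrow> complex mat" where
  "corner_incl p q = mat (p * q) p (\<lambda>(i, a). if i = a * q then 1 else 0)"

text \<open>Slicing by the vector e_0 of the right factor. It recovers \<open>A\<close> from
  \<open>A \<otimes>\<^sub>m 1\<^sub>m q\<close> and, being a compression by an isometry, preserves
  positivity.\<close>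

definition corner :: "nat \<Rightarrow> nat \<Rightarrow> complex mat \<Rightarrow> complex mat" where
  "corner p q X = mat_adjoint (corner_incl p q) * X * corner_incl p q"

lemma corner_incl_dim [simp]: "dim_row (corner_incl p q) = p * q" "dim_col (corner_incl p q) = p"
  by (simp_all add: corner_incl_def)

lemma corner_index:
  assumes X: "X \<in> carrier_mat (p * q) (p * q)" and q: "0 < q" and ab: "a < p" "b < p"
  shows "corner p q X $$ (a, b) = X $$ (a * q, b * q)"
proof -
  have l: "a * q < p * q" "b * q < p * q" using ab q by auto
  have "(mat_adjoint (corner_incl p q) * X) $$ (a, k) = X $$ (a * q, k)" if "k < p * q" for k
  proof -
    have "(mat_adjoint (corner_incl p q) * X) $$ (a, k) = (\<Sum>i<p * q. (if i = a * q then 1 else 0) * X $$ (i, k))"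
      using that X ab by (auto simp: mat_mult_index corner_incl_def simp del: index_mult_mat(1) intro!: sum.cong)
    also have "\<dots> = (\<Sum>i<p * q. if i = a * q then X $$ (i, k) else 0)" by (rule sum.cong) auto
    finally show ?thesis using l by simp
  qed
  then have "corner p q X $$ (a, b) = (\<Sum>k<p * q. X $$ (a * q, k) * (if k = b * q then 1 else 0))"
    using X ab by (auto simp: corner_def mat_mult_index corner_incl_def simp del: index_mult_mat(1) intro!: sum.cong)
  also have "\<dots> = (\<Sum>k<p * q. if k = b * q then X $$ (a * q, k) else 0)" by (rule sum.cong) auto
  finally show ?thesis using l by simp
qed

lemma corner_tensor:
  assumes "A \<in> carrier_mat p p" "B \<in> carrier_mat q q" "0 < q"
  shows "corner p q (A \<otimes>\<^sub>m B) = B $$ (0, 0) \<cdot>\<^sub>m A"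
proof (rule eq_matI)
  fix a b assume "a < dim_row (B $$ (0, 0) \<cdot>\<^sub>m A)" "b < dim_col (B $$ (0, 0) \<cdot>\<^sub>m A)"
  then have ab: "a < p" "b < p" using assms by auto
  have c: "A \<otimes>\<^sub>m B \<in> carrier_mat (p * q) (p * q)" using assms by (auto intro!: carrier_matI)
  show "corner p q (A \<otimes>\<^sub>m B) $$ (a, b) = (B $$ (0, 0) \<cdot>\<^sub>m A) $$ (a, b)"
    using ab assms by (simp add: corner_index[OF c assms(3) ab] mat_tensor_index)
qed (use assms in \<open>auto simp: corner_def\<close>)

lemma corner_incl_isometry:
  assumes "0 < q"
  shows "mat_adjoint (corner_incl p q) * corner_incl p q = 1\<^sub>m p"
proof -
  have "corner p q (1\<^sub>m (p * q)) = 1\<^sub>m p"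
  proof (rule eq_matI)
    fix i j assume "i < dim_row (1\<^sub>m p :: complex mat)" "j < dim_col (1\<^sub>m p :: complex mat)"
    then have ij: "i < p" "j < p" by auto
    then show "corner p q (1\<^sub>m (p * q)) $$ (i, j) = 1\<^sub>m p $$ (i, j)"
      using assms by (simp add: corner_index[OF one_carrier_mat assms ij])
  qed (auto simp: corner_def)
  then show ?thesis by (simp add: corner_def)
qed

lemma tensor_commutant:
  assumes Z: "Z \<in> carrier_mat (p * q) (p * q)" and q: "0 < q"
    and comm: "\<And>A. A \<in> carrier_mat q q \<Longrightarrow> Z * (1\<^sub>m p \<otimes>\<^sub>m A) = (1\<^sub>m p \<otimes>\<^sub>m A) * Z"
  shows "Z = corner p q Z \<otimes>\<^sub>m 1\<^sub>m q"
proof (rule eq_matI)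
  have entry: "Z $$ (a * q + b, a' * q + c) = (if b = c then Z $$ (a * q, a' * q) else 0)"
    if a: "a < p" "a' < p" and bc: "b < q" "c < q" for a a' b c
  proof -
    \<comment> \<open>The matrix unit with its 1 in row \<open>c\<close> and column 0. Comparing
      both products at row \<open>a * q + b\<close> and column \<open>a' * q\<close> isolates one
      entry of \<open>Z\<close> on each side.\<close>
    define E where "E = mat q q (\<lambda>(x, y). if x = c \<and> y = 0 then 1 else 0 :: complex)"
    have E: "E \<in> carrier_mat q q" by (simp add: E_def)
    let ?i = "a * q + b" and ?j = "a' * q"
    have i: "?i < p * q" by (rule tensor_index_less[OF a(1) bc(1)])
    have j: "?j < p * q" using tensor_index_less[OF a(2) q] by simp
    have Eij: "(1\<^sub>m p \<otimes>\<^sub>m E) $$ (k, l) = (if k div q = l div q \<and> k mod q = c \<and> l mod q = 0 then 1 else 0)"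
      if "k < p * q" "l < p * q" for k l
      using that tensor_bounds[OF that(1)] tensor_bounds[OF that(2)] E by (auto simp: mat_tensor_index E_def)
    have "(Z * (1\<^sub>m p \<otimes>\<^sub>m E)) $$ (?i, ?j) = (\<Sum>k<p * q. Z $$ (?i, k) * (1\<^sub>m p \<otimes>\<^sub>m E) $$ (k, ?j))"
      using i j Z E by (simp add: mat_mult_index del: index_mult_mat(1))
    also have "\<dots> = (\<Sum>k<p * q. if k = a' * q + c then Z $$ (?i, k) else 0)"
    proof (rule sum.cong)
      fix k assume k: "k \<in> {..<p * q}"
      have "k div q = a' \<and> k mod q = c \<longleftrightarrow> k = a' * q + c" using bc by (auto simp: div_mult_mod_eq)
      then show "Z $$ (?i, k) * (1\<^sub>m p \<otimes>\<^sub>m E) $$ (k, ?j) = (if k = a' * q + c then Z $$ (?i, k) else 0)"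
        using k j q by (simp add: Eij)
    qed simp
    also have "\<dots> = Z $$ (?i, a' * q + c)" using tensor_index_less[OF a(2) bc(2)] by simp
    finally have L: "(Z * (1\<^sub>m p \<otimes>\<^sub>m E)) $$ (?i, ?j) = Z $$ (?i, a' * q + c)" .
    have "((1\<^sub>m p \<otimes>\<^sub>m E) * Z) $$ (?i, ?j) = (\<Sum>k<p * q. (1\<^sub>m p \<otimes>\<^sub>m E) $$ (?i, k) * Z $$ (k, ?j))"
      using i j Z E by (simp add: mat_mult_index del: index_mult_mat(1))
    also have "\<dots> = (\<Sum>k<p * q. if k = a * q then if b = c then Z $$ (k, ?j) else 0 else 0)"
    proof (rule sum.cong)
      fix k assume k: "k \<in> {..<p * q}"
      have "k div q = a \<and> k mod q = 0 \<longleftrightarrow> k = a * q" using q by auto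
      then show "(1\<^sub>m p \<otimes>\<^sub>m E) $$ (?i, k) * Z $$ (k, ?j) = (if k = a * q then if b = c then Z $$ (k, ?j) else 0 else 0)"
        using k i bc by (auto simp: Eij)
    qed simp
    also have "\<dots> = (if b = c then Z $$ (a * q, ?j) else 0)" using tensor_index_less[OF a(1) q] by simp
    finally show ?thesis using comm[OF E] L by simp
  qed
  fix i j assume "i < dim_row (corner p q Z \<otimes>\<^sub>m 1\<^sub>m q)" "j < dim_col (corner p q Z \<otimes>\<^sub>m 1\<^sub>m q)"
  then have ij: "i < p * q" "j < p * q" by (auto simp: corner_def)
  note b = tensor_bounds[OF ij(1)] tensor_bounds[OF ij(2)]
  have "Z $$ (i, j) = (if i mod q = j mod q then Z $$ (i div q * q, j div q * q) else 0)"
    using entry[OF b(1,3,2,4)] by simp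
  then show "Z $$ (i, j) = (corner p q Z \<otimes>\<^sub>m 1\<^sub>m q) $$ (i, j)"
    using ij b by (simp add: mat_tensor_index corner_def[THEN arg_cong[of _ _ dim_row]]
        corner_def[THEN arg_cong[of _ _ dim_col]] corner_index[OF Z q b(1,3)])
qed (use Z in \<open>auto simp: corner_def\<close>)

section \<open>Finite sums of square matrices\<close>

lemma msum_0 [simp]: "msum n X 0 = 0\<^sub>m n n"
proof -
  interpret abelian_group "module_mat TYPE(complex) n n" by (rule abelian_group_mat)
  show ?thesis unfolding msum_def by (simp add: module_mat_simps)
qed

lemma msum_Suc:
  assumes "\<And>j. j \<le> J \<Longrightarrow> X j \<in> carrier_mat n n"
  shows "msum n X (Suc J) = X J + msum n X J"
proof -
  interpret abelian_group "module_mat TYPE(complex) n n" by (rule abelian_group_mat)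
  show ?thesis unfolding msum_def lessThan_Suc using assms
    by (subst finsum_insert) (auto simp: module_mat_simps)
qed

lemma msum_carrier:
  assumes "\<And>j. j < J \<Longrightarrow> X j \<in> carrier_mat n n"
  shows "msum n X J \<in> carrier_mat n n"
  using assms by (induction J) (simp_all add: msum_Suc)

lemma msum_mult_left:
  assumes "A \<in> carrier_mat m n" "\<And>j. j < J \<Longrightarrow> X j \<in> carrier_mat n n" "m = n"
  shows "A * msum n X J = msum n (\<lambda>j. A * X j) J"
  using assms(2)
proof (induction J)
  case 0
  then show ?case using assms by simp
next
  case (Suc J)
  have c: "X J \<in> carrier_mat n n" "msum n X J \<in> carrier_mat n n"
    using Suc.prems by (auto intro!: msum_carrier)
  have "A * msum n X (Suc J) = A * X J + A * msum n X J"
    using c Suc.prems assms by (simp add: msum_Suc mult_add_distrib_mat[of _ n n _ n])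
  also have "\<dots> = msum n (\<lambda>j. A * X j) (Suc J)"
    using Suc assms(1,3) carrier_matD[OF Suc.prems] by (subst msum_Suc) auto
  finally show ?case .
qed

lemma msum_cong:
  assumes "\<And>j. j < J \<Longrightarrow> X j = Y j" "\<And>j. j < J \<Longrightarrow> X j \<in> carrier_mat n n"
  shows "msum n X J = msum n Y J"
  using assms by (induction J) (simp_all add: msum_Suc)

lemma msum_single:
  assumes "i < J" "X \<in> carrier_mat n n"
  shows "msum n (\<lambda>j. if j = i then X else 0\<^sub>m n n) J = X"
proof -
  have "msum n (\<lambda>j. if j = i then X else 0\<^sub>m n n) K = (if i < K then X else 0\<^sub>m n n)" for K
    using assms(2) by (induction K) (auto simp: msum_Suc less_Suc_eq)
  then show ?thesis using assms by simp
qed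

section \<open>Operators in block form relative to a decomposition\<close>

locale decomposition =
  fixes n :: nat and C :: "complex mat set" and D :: block_decomp
  assumes decomposes: "decomposes n C D" and C_carrier: "X \<in> C \<Longrightarrow> X \<in> carrier_mat n n"
begin

abbreviation "J \<equiv> nblocks D"
abbreviation "p \<equiv> ldim D"
abbreviation "q \<equiv> rdim D"
abbreviation "V \<equiv> incl D"
abbreviation "P \<equiv> block_proj D"

lemma block_dims:
  assumes "j < J"
  shows "0 < p j" "0 < q j" "dim_row (V j) = n" "dim_col (V j) = p j * q j" "V j \<in> carrier_mat n (p j * q j)"
  using assms decomposes unfolding decomposes_def by auto

lemma isometry:
  assumes "j < J"
  shows "mat_adjoint (V j) * V j = 1\<^sub>m (p j * q j)"
    "dim_row X = p j * q j \<Longrightarrow> mat_adjoint (V j) * (V j * X) = X"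
  using assms decomposes block_dims[OF assms] unfolding decomposes_def by (auto simp: mat_assoc[symmetric])

text \<open>The isometry relations insert \<open>P i * P j\<close> between the two inclusions, and
  this product vanishes.\<close>

lemma block_orthogonal:
  assumes "i < J" "j < J" "i \<noteq> j"
  shows "mat_adjoint (V i) * V j = 0\<^sub>m (p i * q i) (p j * q j)"
proof -
  note [simp] = block_dims[OF assms(1)] block_dims[OF assms(2)] isometry[OF assms(1)] isometry[OF assms(2)]
  have "mat_adjoint (V i) * V j = mat_adjoint (V i) * (P i * P j) * V j"
    by (simp add: block_proj_def mat_assoc)
  also have "P i * P j = 0\<^sub>m n n" using assms decomposes unfolding decomposes_def by blast
  also have "mat_adjoint (V i) * 0\<^sub>m n n = 0\<^sub>m (p i * q i) n"
    by (rule right_mult_zero_mat) simp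
  also have "0\<^sub>m (p i * q i) n * V j = 0\<^sub>m (p i * q i) (p j * q j)"
    by (rule left_mult_zero_mat) simp
  finally show ?thesis .
qed

lemma block_proj_carrier: "j < J \<Longrightarrow> P j \<in> carrier_mat n n"
  using block_dims by (simp add: block_proj_def)

lemma block_embed_carrier: "j < J \<Longrightarrow> block_embed D j X \<in> carrier_mat n n"
  using block_dims by (simp add: block_embed_def)

lemma block_sum_carrier: "block_sum n D X \<in> carrier_mat n n"
  unfolding block_sum_def by (intro msum_carrier block_embed_carrier)

lemma block_proj_center: "j < J \<Longrightarrow> P j \<in> mat_center C"
proof -
  assume j: "j < J"
  have "msum n (\<lambda>i. (if i = j then 1 else 0) \<cdot>\<^sub>m P i) J = msum n (\<lambda>i. if i = j then P j else 0\<^sub>m n n) J"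
  proof (rule msum_cong)
    fix i assume i: "i < J"
    note c = block_proj_carrier[OF i]
    then show "(if i = j then 1 else 0) \<cdot>\<^sub>m P i = (if i = j then P j else 0\<^sub>m n n)"
      by (intro eq_matI) auto
    show "(if i = j then 1 else 0) \<cdot>\<^sub>m P i \<in> carrier_mat n n" using c by simp
  qed
  also have "\<dots> = P j" by (rule msum_single[OF j block_proj_carrier[OF j]])
  finally have "P j \<in> {msum n (\<lambda>j. c j \<cdot>\<^sub>m P j) J | c. True}"
    by (intro CollectI exI[of _ "\<lambda>i. if i = j then 1 else 0"]) simp
  moreover have "mat_center C = {msum n (\<lambda>j. c j \<cdot>\<^sub>m P j) J | c. True}"
    using decomposes unfolding decomposes_def by blast
  ultimately show ?thesis by (simp only:)
qed

lemma block_proj_C: "j < J \<Longrightarrow> P j \<in> C"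
  and block_proj_commutes: "j < J \<Longrightarrow> X \<in> C \<Longrightarrow> P j * X = X * P j"
  using block_proj_center by (auto simp: mat_center_def)

lemma C_eq:
  "C = {block_sum n D (\<lambda>j. 1\<^sub>m (p j) \<otimes>\<^sub>m A j) | A. \<forall>j<J. A j \<in> carrier_mat (q j) (q j)}"
  using decomposes unfolding decomposes_def by blast

lemma block_embed_C:
  assumes j: "j < J" and A: "A \<in> carrier_mat (q j) (q j)"
  shows "block_embed D j (1\<^sub>m (p j) \<otimes>\<^sub>m A) \<in> C"
proof -
  define B where "B i = (if i = j then A else 0\<^sub>m (q i) (q i))" for i
  have "block_sum n D (\<lambda>i. 1\<^sub>m (p i) \<otimes>\<^sub>m B i) =
      msum n (\<lambda>i. if i = j then block_embed D j (1\<^sub>m (p j) \<otimes>\<^sub>m A) else 0\<^sub>m n n) J"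
    unfolding block_sum_def
  proof (rule msum_cong)
    fix i assume i: "i < J"
    show "block_embed D i (1\<^sub>m (p i) \<otimes>\<^sub>m B i) = (if i = j then block_embed D j (1\<^sub>m (p j) \<otimes>\<^sub>m A) else 0\<^sub>m n n)"
    proof (cases "i = j")
      case False
      note [simp] = block_dims[OF i]
      have "V i * 0\<^sub>m (p i * q i) (p i * q i) = 0\<^sub>m n (p i * q i)"
        by (rule right_mult_zero_mat) (rule block_dims(5)[OF i])
      moreover have "0\<^sub>m n (p i * q i) * mat_adjoint (V i) = 0\<^sub>m n n"
        by (rule left_mult_zero_mat) (simp add: block_dims(5)[OF i])
      ultimately show ?thesis using False by (simp add: B_def block_embed_def)
    qed (simp add: B_def)
    show "block_embed D i (1\<^sub>m (p i) \<otimes>\<^sub>m B i) \<in> carrier_mat n n" by (rule block_embed_carrier[OF i])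
  qed
  also have "\<dots> = block_embed D j (1\<^sub>m (p j) \<otimes>\<^sub>m A)"
    by (rule msum_single[OF j block_embed_carrier[OF j]])
  finally show ?thesis unfolding C_eq using A
    by (intro CollectI exI[of _ B]) (auto simp: B_def)
qed

lemma block_restrict_carrier: "j < J \<Longrightarrow> block_restrict D j Y \<in> carrier_mat (p j * q j) (p j * q j)"
  using block_dims by (simp add: block_restrict_def)

text \<open>Multiplication by \<open>P i\<close> removes all other summands. Blocks are thus
  determined by their sum, the source of uniqueness in (a).\<close>

lemma block_restrict_sum:
  assumes X: "\<And>j. j < J \<Longrightarrow> X j \<in> carrier_mat (p j * q j) (p j * q j)" and i: "i < J"
  shows "block_restrict D i (block_sum n D X) = X i"
proof -
  note [simp] = block_dims[OF i] isometry[OF i] carrier_matD[OF X[OF i]]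
  have S: "dim_row (block_sum n D X) = n" "dim_col (block_sum n D X) = n"
    using block_sum_carrier by auto
  have "P i * block_sum n D X = msum n (\<lambda>j. P i * block_embed D j (X j)) J"
    unfolding block_sum_def
    by (rule msum_mult_left[OF block_proj_carrier[OF i] block_embed_carrier refl])
  also have "\<dots> = msum n (\<lambda>j. if j = i then block_embed D i (X i) else 0\<^sub>m n n) J"
  proof (rule msum_cong)
    fix j assume j: "j < J"
    note [simp] = block_dims[OF j] carrier_matD[OF X[OF j]]
    show "P i * block_embed D j (X j) = (if j = i then block_embed D i (X i) else 0\<^sub>m n n)"
    proof (cases "j = i")
      case True
      then show ?thesis by (simp add: block_proj_def block_embed_def mat_assoc)
    next
      case False
      have "P i * block_embed D j (X j) = V i * (mat_adjoint (V i) * V j) * (X j * mat_adjoint (V j))"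
        by (simp add: block_proj_def block_embed_def mat_assoc)
      also have "V i * (mat_adjoint (V i) * V j) = 0\<^sub>m n (p j * q j)"
        using block_orthogonal[OF i j] False by (simp add: right_mult_zero_mat[OF block_dims(5)[OF i]])
      also have "0\<^sub>m n (p j * q j) * (X j * mat_adjoint (V j)) = 0\<^sub>m n n"
        by (rule left_mult_zero_mat) simp
      finally show ?thesis using False by simp
    qed
    show "P i * block_embed D j (X j) \<in> carrier_mat n n"
      using block_proj_carrier[OF i] block_embed_carrier[OF j] by auto
  qed
  also have "\<dots> = block_embed D i (X i)"
    by (rule msum_single[OF i block_embed_carrier[OF i]])
  finally have e: "P i * block_sum n D X = block_embed D i (X i)" .
  have "block_restrict D i (block_sum n D X) = mat_adjoint (V i) * (P i * block_sum n D X) * V i"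
    using S by (simp add: block_restrict_def block_proj_def mat_assoc)
  also have "\<dots> = X i" unfolding e by (simp add: block_embed_def mat_assoc)
  finally show ?thesis .
qed

text \<open>Commuting with each \<open>P j\<close> turns \<open>P j * Y * P j\<close> into
  \<open>Y * P j\<close>, and these add up to \<open>Y\<close> because the projections sum to
  1.\<close>

lemma block_sum_restrict:
  assumes Y: "Y \<in> carrier_mat n n" and comm: "\<And>j. j < J \<Longrightarrow> P j * Y = Y * P j"
  shows "block_sum n D (\<lambda>j. block_restrict D j Y) = Y"
proof -
  note [simp] = carrier_matD[OF Y]
  have "block_sum n D (\<lambda>j. block_restrict D j Y) = msum n (\<lambda>j. Y * P j) J"
    unfolding block_sum_def
  proof (rule msum_cong)
    fix j assume j: "j < J"
    note [simp] = block_dims[OF j] isometry[OF j] carrier_matD[OF block_proj_carrier[OF j]]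
    have "block_embed D j (block_restrict D j Y) = P j * Y * P j"
      by (simp add: block_embed_def block_restrict_def block_proj_def mat_assoc)
    also have "\<dots> = Y * (P j * P j)" by (simp only: comm[OF j]) (simp add: mat_assoc)
    also have "P j * P j = P j" by (simp add: block_proj_def mat_assoc)
    finally show "block_embed D j (block_restrict D j Y) = Y * P j" .
    show "block_embed D j (block_restrict D j Y) \<in> carrier_mat n n" by (rule block_embed_carrier[OF j])
  qed
  also have "\<dots> = Y * msum n P J"
    by (rule msum_mult_left[OF Y block_proj_carrier refl, symmetric])
  also have "msum n P J = 1\<^sub>m n" using decomposes unfolding decomposes_def by blast
  finally show ?thesis by simp
qed

text \<open>The product of the compressions has \<open>P j\<close> between the factors; it commutes
  past \<open>B\<close> and is absorbed by the inclusion.\<close>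

lemma block_restrict_mult:
  assumes j: "j < J" and A: "A \<in> carrier_mat n n" and B: "B \<in> carrier_mat n n" and comm: "P j * B = B * P j"
  shows "block_restrict D j (A * B) = block_restrict D j A * block_restrict D j B"
proof -
  note [simp] = block_dims[OF j] isometry[OF j] carrier_matD[OF block_proj_carrier[OF j]] carrier_matD[OF A] carrier_matD[OF B]
  have "block_restrict D j A * block_restrict D j B = mat_adjoint (V j) * A * (P j * B) * V j"
    by (simp add: block_restrict_def block_proj_def mat_assoc)
  also have "\<dots> = block_restrict D j (A * B)"
    unfolding comm by (simp add: block_restrict_def block_proj_def mat_assoc)
  finally show ?thesis ..
qed

text \<open>Each \<open>1 \<otimes> A\<close> on a single block extends by zero to an element of
  \<open>C\<close>, so commuting with \<open>C\<close> gives commuting with every such operator on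
  the block.\<close>

lemma commutant_form:
  assumes Y: "Y \<in> carrier_mat n n" and comm: "\<And>X. X \<in> C \<Longrightarrow> Y * X = X * Y" and j: "j < J"
  shows "block_restrict D j Y = corner (p j) (q j) (block_restrict D j Y) \<otimes>\<^sub>m 1\<^sub>m (q j)"
proof (rule tensor_commutant[OF block_restrict_carrier[OF j] block_dims(2)[OF j]])
  fix A :: "complex mat" assume A: "A \<in> carrier_mat (q j) (q j)"
  note [simp] = block_dims[OF j] isometry[OF j] carrier_matD[OF A] carrier_matD[OF Y]
  let ?A = "1\<^sub>m (p j) \<otimes>\<^sub>m A"
  have "block_restrict D j Y * ?A = mat_adjoint (V j) * (Y * block_embed D j ?A) * V j"
    by (simp add: block_restrict_def block_embed_def mat_assoc)
  also have "\<dots> = mat_adjoint (V j) * (block_embed D j ?A * Y) * V j"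
    using comm[OF block_embed_C[OF j A]] by simp
  also have "\<dots> = ?A * block_restrict D j Y"
    by (simp add: block_restrict_def block_embed_def mat_assoc)
  finally show "block_restrict D j Y * ?A = ?A * block_restrict D j Y" .
qed

lemma C_form:
  assumes "X \<in> C"
  shows "\<exists>k. \<forall>j<J. k j \<in> carrier_mat (q j) (q j) \<and> block_restrict D j X = 1\<^sub>m (p j) \<otimes>\<^sub>m k j"
proof -
  obtain k where k: "\<forall>j<J. k j \<in> carrier_mat (q j) (q j)" and X: "X = block_sum n D (\<lambda>j. 1\<^sub>m (p j) \<otimes>\<^sub>m k j)"
    using assms unfolding C_eq by blast
  have "1\<^sub>m (p j) \<otimes>\<^sub>m k j \<in> carrier_mat (p j * q j) (p j * q j)" if "j < J" for j
    using k that by (intro carrier_matI) auto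
  then have "block_restrict D j X = 1\<^sub>m (p j) \<otimes>\<^sub>m k j" if "j < J" for j
    unfolding X using that by (rule block_restrict_sum)
  then show ?thesis using k by blast
qed

lemma right_marginal_eq:
  assumes j: "j < J" and Y: "Y \<in> carrier_mat n n"
  shows "right_marginal D j Y = partial_trace_left (p j) (q j) (block_restrict D j Y)"
proof -
  note [simp] = block_dims[OF j] isometry[OF j] carrier_matD[OF Y]
  have "block_restrict D j (P j * Y * P j) = block_restrict D j Y"
    by (simp add: block_restrict_def block_proj_def mat_assoc)
  then show ?thesis by (simp add: right_marginal_def)
qed

lemma block_embed_restrict:
  assumes j: "j < J" and Y: "Y \<in> carrier_mat n n" and comm: "P j * Y = Y * P j"
  shows "block_embed D j (block_restrict D j Y) = P j * Y"
proof -
  note [simp] = block_dims[OF j] isometry[OF j] carrier_matD[OF block_proj_carrier[OF j]] carrier_matD[OF Y]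
  have "block_embed D j (block_restrict D j Y) = P j * (Y * P j)"
    by (simp add: block_embed_def block_restrict_def block_proj_def mat_assoc)
  also have "\<dots> = P j * Y" unfolding comm[symmetric] by (simp add: block_proj_def mat_assoc)
  finally show ?thesis .
qed

end

section \<open>The decomposition of the states\<close>

lemma complex_pos_cancel:
  fixes a b :: complex
  assumes "0 < a" "0 < a * b"
  shows "0 < b"
  using assms by (auto simp: less_complex_def zero_less_mult_iff)

lemma complex_inverse_nonneg:
  fixes a :: complex
  assumes "0 < a"
  shows "0 \<le> inverse a"
proof -
  have "a = of_real (Re a)" "0 < Re a" using assms by (auto simp: less_complex_def complex_eq_iff)
  then obtain r where "a = of_real r" "0 < r" by blast
  then show ?thesis by (simp add: less_eq_complex_def)
qed

locale fixed_point_decomposition = coarse_graining n M N \<rho> + decomposition n "ac_fixed M N \<rho>" D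
  for n M N \<rho> D
begin

text \<open>\<open>k j\<close> is the right factor of \<kappa> on block \<open>j\<close>;
  \<open>g j\<close> and \<open>h j\<close> below are the left factors of the two commutant elements
  coming from \<rho> and \<open>\<rho>N\<close>.\<close>

definition "k = (SOME k. \<forall>j<J. k j \<in> carrier_mat (q j) (q j) \<and> block_restrict D j \<kappa> = 1\<^sub>m (p j) \<otimes>\<^sub>m k j)"
definition "g j = corner (p j) (q j) (block_restrict D j (\<kappa>i * \<rho>))"
definition "h j = corner (p j) (q j) (block_restrict D j (\<kappa>i * \<rho>N))"

text \<open>Both left factors are divided by the trace of \<open>g j\<close>, since both formulas
  use the right marginal of \<rho>, which is
  \<open>mat_tr (g j) \<cdot>\<^sub>m k j\<close>.\<close>

definition "\<gamma> j = inverse (mat_tr (g j)) \<cdot>\<^sub>m g j"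
definition "\<gamma>t j = inverse (mat_tr (g j)) \<cdot>\<^sub>m h j"

lemma k_props:
  assumes "j < J"
  shows "k j \<in> carrier_mat (q j) (q j)" "block_restrict D j \<kappa> = 1\<^sub>m (p j) \<otimes>\<^sub>m k j"
  using someI_ex[OF C_form[OF \<kappa>_C]] assms unfolding k_def by blast+

lemma gh_carrier:
  "g j \<in> carrier_mat (p j) (p j)" "h j \<in> carrier_mat (p j) (p j)"
  by (simp_all add: g_def h_def corner_def)

lemma gh_dims [simp]:
  "dim_row (g j) = p j" "dim_col (g j) = p j" "dim_row (h j) = p j" "dim_col (h j) = p j"
  using gh_carrier by auto

text \<open>\<open>P j\<close> lies in \<open>C\<close>, hence commutes with the commutant elements,
  and is central there, hence commutes with \<kappa>. Writing \<rho> and \<open>\<rho>N\<close> as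
  \<kappa> times a commutant element gives the rest.\<close>

lemma commutes_block_proj:
  assumes "j < J" "X \<in> C"
  shows "P j * (\<kappa>i * \<rho> * X) = \<kappa>i * \<rho> * X * P j" "P j * (\<rho> * X) = \<rho> * X * P j" "P j * \<rho>N = \<rho>N * P j"
    "P j * (\<kappa>i * \<rho>) = \<kappa>i * \<rho> * P j" "P j * (\<kappa>i * \<rho>N) = \<kappa>i * \<rho>N * P j"
proof -
  have Pc: "P j \<in> C" using block_proj_C[OF assms(1)] .
  note [simp] = C_dim[OF Pc] C_dim[OF assms(2)]
  have PX: "P j * X = X * P j" by (rule block_proj_commutes[OF assms])
  have P\<kappa>: "P j * \<kappa> = \<kappa> * P j" by (rule block_proj_commutes[OF assms(1) \<kappa>_C])
  show Z: "P j * (\<kappa>i * \<rho>) = \<kappa>i * \<rho> * P j" and Zt: "P j * (\<kappa>i * \<rho>N) = \<kappa>i * \<rho>N * P j"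
    by (simp_all only: commutant[OF Pc])
  have "P j * (\<kappa>i * \<rho> * X) = P j * (\<kappa>i * \<rho>) * X" by (simp add: mat_assoc)
  also have "\<dots> = \<kappa>i * \<rho> * (P j * X)" unfolding Z by (simp add: mat_assoc)
  also have "\<dots> = \<kappa>i * \<rho> * X * P j" unfolding PX by (simp add: mat_assoc)
  finally show ZX: "P j * (\<kappa>i * \<rho> * X) = \<kappa>i * \<rho> * X * P j" .
  have "P j * (\<rho> * X) = P j * \<kappa> * (\<kappa>i * \<rho> * X)" by (simp add: mat_assoc)
  also have "\<dots> = \<kappa> * (P j * (\<kappa>i * \<rho> * X))" unfolding P\<kappa> by (simp add: mat_assoc)
  also have "\<dots> = \<rho> * X * P j" unfolding ZX by (simp add: mat_assoc)
  finally show "P j * (\<rho> * X) = \<rho> * X * P j" .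
  have "P j * \<rho>N = P j * \<kappa> * (\<kappa>i * \<rho>N)" by (simp add: mat_assoc)
  also have "\<dots> = \<kappa> * (P j * (\<kappa>i * \<rho>N))" unfolding P\<kappa> by (simp add: mat_assoc)
  also have "\<dots> = \<rho>N * P j" unfolding Zt by (simp add: mat_assoc)
  finally show "P j * \<rho>N = \<rho>N * P j" .
qed

lemma carriers: "\<kappa> \<in> carrier_mat n n" "\<kappa>i * \<rho> \<in> carrier_mat n n" "\<kappa>i * \<rho>N \<in> carrier_mat n n" "\<rho>N \<in> carrier_mat n n"
  using vn_algebraD(1)[OF vn_C \<kappa>_C] vn_algebraD(1)[OF vn_N \<rho>N_N] by auto

text \<open>On a block, \<rho> is the product of \<kappa> and \<open>\<kappa>i * \<rho>\<close>,
  that is of \<open>1 \<otimes> k\<close> and \<open>g \<otimes> 1\<close>; likewise for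
  \<open>\<rho>N\<close>.\<close>

lemma restrict_forms:
  assumes j: "j < J"
  shows "block_restrict D j (\<kappa>i * \<rho>) = g j \<otimes>\<^sub>m 1\<^sub>m (q j)" "block_restrict D j (\<kappa>i * \<rho>N) = h j \<otimes>\<^sub>m 1\<^sub>m (q j)"
    "block_restrict D j \<rho> = g j \<otimes>\<^sub>m k j" "block_restrict D j \<rho>N = h j \<otimes>\<^sub>m k j"
proof -
  note kc = k_props(1)[OF j]
  note [simp] = carrier_matD[OF kc]
  show Z: "block_restrict D j (\<kappa>i * \<rho>) = g j \<otimes>\<^sub>m 1\<^sub>m (q j)" and Zt: "block_restrict D j (\<kappa>i * \<rho>N) = h j \<otimes>\<^sub>m 1\<^sub>m (q j)"
    unfolding g_def h_def using commutant carriers j by (intro commutant_form; simp)+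
  note comm = commutes_block_proj(4,5)[OF j vn_algebraD(4)[OF vn_C]]
  have "block_restrict D j (\<kappa> * (\<kappa>i * \<rho>)) = g j \<otimes>\<^sub>m k j"
    by (simp add: block_restrict_mult[OF j carriers(1,2) comm(1)] k_props[OF j] Z mat_tensor_mult del: \<kappa>_cancel)
  then show "block_restrict D j \<rho> = g j \<otimes>\<^sub>m k j" by simp
  have "block_restrict D j (\<kappa> * (\<kappa>i * \<rho>N)) = h j \<otimes>\<^sub>m k j"
    by (simp add: block_restrict_mult[OF j carriers(1,3) comm(2)] k_props[OF j] Zt mat_tensor_mult del: \<kappa>_cancel)
  then show "block_restrict D j \<rho>N = h j \<otimes>\<^sub>m k j" by simp
qed

text \<open>Compressing \<open>\<kappa>\<close> and \<open>\<rho>\<close> by \<open>v \<mapsto> v \<otimes> e\<^sub>0\<close> gives multiples of \<open>1\<close> and of \<open>g j\<close> with the same factor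
  \<open>k j $$ (0, 0)\<close>; positivity is inherited.\<close>

lemma positivity:
  assumes j: "j < J"
  shows "0 < k j $$ (0, 0)" "0 < mat_tr (g j)" "psd_mat (p j) (\<gamma> j)" "mat_tr (\<gamma> j) = 1"
proof -
  note [simp] = block_dims[OF j] isometry[OF j]
  \<comment> \<open>An isometry from a space of positive dimension, hence nonzero, as strict
    positivity of the compressed traces requires.\<close>
  define Y where "Y = V j * corner_incl (p j) (q j)"
  have Yc: "Y \<in> carrier_mat n (p j)" by (simp add: Y_def)
  have "mat_adjoint Y * Y = 1\<^sub>m (p j)"
    by (simp add: Y_def mat_adjoint_mult mat_assoc corner_incl_isometry)
  then have "mat_tr (mat_adjoint Y * Y) \<noteq> 0" by simp
  then have Y0: "Y \<noteq> 0\<^sub>m n (p j)"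
    using hs_inner_self(2)[OF Yc] by (auto simp: hs_inner_def)
  have corner: "mat_adjoint Y * A * Y = corner (p j) (q j) (block_restrict D j A)" if "A \<in> carrier_mat n n" for A
    using carrier_matD[OF that] by (simp add: Y_def corner_def block_restrict_def mat_adjoint_mult mat_assoc)
  have \<kappa>Y: "mat_adjoint Y * \<kappa> * Y = k j $$ (0, 0) \<cdot>\<^sub>m 1\<^sub>m (p j)"
    using k_props[OF j] by (simp add: corner[OF carriers(1)] corner_tensor)
  have \<rho>Y: "mat_adjoint Y * \<rho> * Y = k j $$ (0, 0) \<cdot>\<^sub>m g j"
    using k_props[OF j] by (simp add: corner[OF \<rho>_carrier] restrict_forms[OF j] corner_tensor gh_carrier)
  have "0 < of_nat (p j) * k j $$ (0, 0)"
    using pd_mat_tr_pos[OF pd_\<kappa> Yc Y0] by (simp add: \<kappa>Y mult.commute)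
  then show k0: "0 < k j $$ (0, 0)" by (rule complex_pos_cancel[rotated]) (simp add: less_complex_def)
  have "0 < k j $$ (0, 0) * mat_tr (g j)"
    using pd_mat_tr_pos[OF pd_\<rho> Yc Y0] by (simp add: \<rho>Y)
  then show g: "0 < mat_tr (g j)" by (rule complex_pos_cancel[OF k0])
  have nz: "k j $$ (0, 0) \<noteq> 0" "mat_tr (g j) \<noteq> 0" using k0 g by auto
  have "psd_mat n \<rho>"
  proof -
    have "mat_adjoint s * s = \<rho>" by (simp add: self_adjoint squares)
    then show ?thesis using psd_mat_gram[OF vn_algebraD(1)[OF vn_M s_props(1)]] by simp
  qed
  then have "psd_mat (p j) (k j $$ (0, 0) \<cdot>\<^sub>m g j)"
    using psd_mat_compress[OF _ Yc] by (simp only: \<rho>Y[symmetric])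
  \<comment> \<open>The first scaling undoes the factor \<open>k j $$ (0, 0)\<close> of the
    compression, the second normalises the trace.\<close>
  then have "psd_mat (p j) (inverse (mat_tr (g j)) \<cdot>\<^sub>m (inverse (k j $$ (0, 0)) \<cdot>\<^sub>m (k j $$ (0, 0) \<cdot>\<^sub>m g j)))"
    by (rule psd_mat_smult[OF psd_mat_smult[OF _ complex_inverse_nonneg[OF k0]] complex_inverse_nonneg[OF g]])
  moreover have "inverse (k j $$ (0, 0)) \<cdot>\<^sub>m (k j $$ (0, 0) \<cdot>\<^sub>m g j) = g j"
    using nz by (intro eq_matI) auto
  ultimately show "psd_mat (p j) (\<gamma> j)" by (simp add: \<gamma>_def)
  show "mat_tr (\<gamma> j) = 1" using nz by (simp add: \<gamma>_def)
qed

lemma \<gamma>_carrier: "\<gamma> j \<in> carrier_mat (p j) (p j)" "\<gamma>t j \<in> carrier_mat (p j) (p j)"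
  using gh_carrier by (simp_all add: \<gamma>_def \<gamma>t_def)

lemma rescale_tensor:
  assumes "j < J"
  shows "\<gamma> j \<otimes>\<^sub>m (mat_tr (g j) \<cdot>\<^sub>m X) = g j \<otimes>\<^sub>m X" "\<gamma>t j \<otimes>\<^sub>m (mat_tr (g j) \<cdot>\<^sub>m X) = h j \<otimes>\<^sub>m X"
proof -
  have "mat_tr (g j) \<noteq> 0" using positivity(2)[OF assms] by auto
  then show "\<gamma> j \<otimes>\<^sub>m (mat_tr (g j) \<cdot>\<^sub>m X) = g j \<otimes>\<^sub>m X" "\<gamma>t j \<otimes>\<^sub>m (mat_tr (g j) \<cdot>\<^sub>m X) = h j \<otimes>\<^sub>m X"
    by (intro eq_matI; simp add: \<gamma>_def \<gamma>t_def mat_tensor_smult)+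
qed

lemma right_marginal_tensor:
  assumes "j < J" "Y \<in> carrier_mat n n" "X \<in> carrier_mat (q j) (q j)" "block_restrict D j Y = g j \<otimes>\<^sub>m X"
  shows "right_marginal D j Y = mat_tr (g j) \<cdot>\<^sub>m X"
  using assms by (simp add: right_marginal_eq partial_trace_left_tensor gh_carrier)

lemma block_sum_cong:
  assumes "\<And>j. j < J \<Longrightarrow> X j = Y j"
  shows "block_sum n D X = block_sum n D Y"
  unfolding block_sum_def using assms by (intro msum_cong block_embed_carrier) auto

text \<open>Serves two purposes: \<open>X = 1\<close> gives the form of \<rho>, and general
  \<open>X\<close> covers all solutions of the Petz equation. On each block \<open>X\<close> is
  \<open>1 \<otimes> x\<close>, so only the right factor changes from \<open>k j\<close> to
  \<open>k j * x j\<close>.\<close>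

lemma recovered_form:
  assumes X: "X \<in> C"
  shows "\<rho> * X = block_sum n D (\<lambda>j. \<gamma> j \<otimes>\<^sub>m right_marginal D j (\<rho> * X))"
proof -
  have Xc: "X \<in> carrier_mat n n" using vn_algebraD(1)[OF vn_C X] .
  have \<rho>X: "\<rho> * X \<in> carrier_mat n n" using carrier_matD[OF Xc] by simp
  obtain x where x: "\<forall>j<J. x j \<in> carrier_mat (q j) (q j) \<and> block_restrict D j X = 1\<^sub>m (p j) \<otimes>\<^sub>m x j"
    using C_form[OF X] by blast
  have "block_restrict D j (\<rho> * X) = \<gamma> j \<otimes>\<^sub>m right_marginal D j (\<rho> * X)" if j: "j < J" for j
  proof -
    note [simp] = carrier_matD[OF k_props(1)[OF j]]
    have xc: "x j \<in> carrier_mat (q j) (q j)" "block_restrict D j X = 1\<^sub>m (p j) \<otimes>\<^sub>m x j" using x j by auto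
    note [simp] = carrier_matD[OF xc(1)]
    have r: "block_restrict D j (\<rho> * X) = g j \<otimes>\<^sub>m (k j * x j)"
      by (simp add: block_restrict_mult[OF j \<rho>_carrier Xc block_proj_commutes[OF j X]] restrict_forms[OF j] xc mat_tensor_mult)
    have "k j * x j \<in> carrier_mat (q j) (q j)" by simp
    from right_marginal_tensor[OF j \<rho>X this r] show ?thesis by (simp only: r rescale_tensor[OF j])
  qed
  then have "block_sum n D (\<lambda>j. \<gamma> j \<otimes>\<^sub>m right_marginal D j (\<rho> * X)) = block_sum n D (\<lambda>j. block_restrict D j (\<rho> * X))"
    by (intro block_sum_cong) simp
  then show ?thesis using block_sum_restrict[OF \<rho>X commutes_block_proj(2)[OF _ X]] by simp
qed

lemma \<rho>_form: "\<rho> = block_sum n D (\<lambda>j. \<gamma> j \<otimes>\<^sub>m right_marginal D j \<rho>)"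
  using recovered_form[OF vn_algebraD(4)[OF vn_C]] by simp

lemma \<rho>_marginal:
  assumes j: "j < J"
  shows "right_marginal D j \<rho> = mat_tr (g j) \<cdot>\<^sub>m k j"
  by (rule right_marginal_tensor[OF j \<rho>_carrier k_props(1)[OF j] restrict_forms(3)[OF j]])

lemma \<rho>N_form: "\<rho>N = block_sum n D (\<lambda>j. \<gamma>t j \<otimes>\<^sub>m right_marginal D j \<rho>)"
proof -
  have "block_sum n D (\<lambda>j. \<gamma>t j \<otimes>\<^sub>m right_marginal D j \<rho>) = block_sum n D (\<lambda>j. block_restrict D j \<rho>N)"
    by (intro block_sum_cong) (simp add: \<rho>_marginal rescale_tensor restrict_forms)
  then show ?thesis
    using block_sum_restrict[OF carriers(4) commutes_block_proj(3)[OF _ vn_algebraD(4)[OF vn_C]]] by simp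
qed

lemma block_embed_smult:
  assumes "j < J" "X \<in> carrier_mat (p j * q j) (p j * q j)"
  shows "block_embed D j (c \<cdot>\<^sub>m X) = c \<cdot>\<^sub>m block_embed D j X"
  using block_dims[OF assms(1)] carrier_matD[OF assms(2)] by (simp add: block_embed_def mat_distribs)

text \<open>On the whole space \<open>\<gamma> \<otimes> 1\<close> is a multiple of
  \<open>P j * (\<kappa>i * \<rho>)\<close>, a product of elements of \<open>M\<close>. This is how
  its membership in \<open>M\<close> and its expectation become accessible.\<close>

lemma embed_forms:
  assumes j: "j < J"
  shows "block_embed D j (\<gamma> j \<otimes>\<^sub>m 1\<^sub>m (q j)) = inverse (mat_tr (g j)) \<cdot>\<^sub>m (P j * (\<kappa>i * \<rho>))"
    "block_embed D j (\<gamma>t j \<otimes>\<^sub>m 1\<^sub>m (q j)) = inverse (mat_tr (g j)) \<cdot>\<^sub>m (P j * (\<kappa>i * \<rho>N))"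
proof -
  note comm = commutes_block_proj(4,5)[OF j vn_algebraD(4)[OF vn_C]]
  have c: "g j \<otimes>\<^sub>m 1\<^sub>m (q j) \<in> carrier_mat (p j * q j) (p j * q j)" "h j \<otimes>\<^sub>m 1\<^sub>m (q j) \<in> carrier_mat (p j * q j) (p j * q j)"
    by (rule carrier_matI; simp)+
  show "block_embed D j (\<gamma> j \<otimes>\<^sub>m 1\<^sub>m (q j)) = inverse (mat_tr (g j)) \<cdot>\<^sub>m (P j * (\<kappa>i * \<rho>))"
    using block_embed_restrict[OF j carriers(2) comm(1)]
    by (simp add: \<gamma>_def mat_tensor_smult block_embed_smult[OF j c(1)] restrict_forms[OF j])
  show "block_embed D j (\<gamma>t j \<otimes>\<^sub>m 1\<^sub>m (q j)) = inverse (mat_tr (g j)) \<cdot>\<^sub>m (P j * (\<kappa>i * \<rho>N))"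
    using block_embed_restrict[OF j carriers(3) comm(2)]
    by (simp add: \<gamma>t_def mat_tensor_smult block_embed_smult[OF j c(2)] restrict_forms[OF j])
qed

lemma left_densities_\<gamma>: "left_densities n M D \<rho> \<gamma>"
  unfolding left_densities_def density_matrix_def
proof (intro conjI allI impI)
  fix j assume j: "j < J"
  show "psd_mat (p j) (\<gamma> j)" "mat_tr (\<gamma> j) = 1" using positivity[OF j] by auto
  have "P j \<in> M" "\<kappa>i \<in> M" using block_proj_C[OF j] \<kappa>i_C C_subset_N N_M by blast+
  then show "block_embed D j (\<gamma> j \<otimes>\<^sub>m 1\<^sub>m (q j)) \<in> M"
    unfolding embed_forms[OF j] using \<rho>_M vn_algebraD(6,8)[OF vn_M] by simp
qed (rule \<rho>_form)

text \<open>The right marginals depend on \<rho> alone, so two solutions have the same right factor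
  on each block. Slicing at (0, 0) leaves a common scalar, nonzero by positivity, which can be
  cancelled.\<close>

lemma left_densities_unique:
  assumes "left_densities n M D \<rho> \<gamma>'" and j: "j < J"
  shows "\<gamma>' j = \<gamma> j"
proof -
  have c': "\<gamma>' i \<in> carrier_mat (p i) (p i)" if "i < J" for i
    using assms that by (auto simp: left_densities_def density_matrix_def psd_mat_def)
  have e': "block_sum n D (\<lambda>j. \<gamma>' j \<otimes>\<^sub>m right_marginal D j \<rho>) = \<rho>"
    using assms(1) by (simp add: left_densities_def)
  have mc: "right_marginal D i \<rho> \<in> carrier_mat (q i) (q i)" if "i < J" for i
    using that k_props by (simp add: \<rho>_marginal)
  have tc: "\<gamma>' i \<otimes>\<^sub>m right_marginal D i \<rho> \<in> carrier_mat (p i * q i) (p i * q i)" if "i < J" for i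
    using carrier_matD[OF c'[OF that]] carrier_matD[OF mc[OF that]] by (intro carrier_matI) auto
  have "\<gamma>' j \<otimes>\<^sub>m right_marginal D j \<rho> = block_restrict D j \<rho>"
    using block_restrict_sum[of "\<lambda>j. \<gamma>' j \<otimes>\<^sub>m right_marginal D j \<rho>" j] tc j e' by simp
  also have "\<dots> = \<gamma> j \<otimes>\<^sub>m right_marginal D j \<rho>"
    using j by (simp add: restrict_forms \<rho>_marginal rescale_tensor)
  finally have "corner (p j) (q j) (\<gamma>' j \<otimes>\<^sub>m right_marginal D j \<rho>) = corner (p j) (q j) (\<gamma> j \<otimes>\<^sub>m right_marginal D j \<rho>)"
    by simp
  then have e: "right_marginal D j \<rho> $$ (0, 0) \<cdot>\<^sub>m \<gamma>' j = right_marginal D j \<rho> $$ (0, 0) \<cdot>\<^sub>m \<gamma> j"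
    using c'[OF j] \<gamma>_carrier mc[OF j] block_dims[OF j] by (simp add: corner_tensor)
  have "right_marginal D j \<rho> $$ (0, 0) = mat_tr (g j) * k j $$ (0, 0)"
    using carrier_matD[OF k_props(1)[OF j]] block_dims[OF j] by (simp add: \<rho>_marginal[OF j])
  then have nz: "right_marginal D j \<rho> $$ (0, 0) \<noteq> 0" using positivity[OF j] by auto
  show ?thesis
  proof (rule eq_matI)
    fix a b assume "a < dim_row (\<gamma> j)" "b < dim_col (\<gamma> j)"
    then show "\<gamma>' j $$ (a, b) = \<gamma> j $$ (a, b)"
      using arg_cong[OF e, of "\<lambda>A. A $$ (a, b)"] nz carrier_matD[OF c'[OF j]] carrier_matD[OF \<gamma>_carrier(1)[of j]] by simp
  qed (use carrier_matD[OF c'[OF j]] carrier_matD[OF \<gamma>_carrier(1)[of j]] in auto)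
qed

text \<open>\<open>P j * \<kappa>i\<close> lies in \<open>C\<close>, hence in \<open>N\<close>, and
  leaves the expectation; what remains inside is \<rho>, with expectation
  \<open>\<rho>N\<close>.\<close>

lemma tracial_exp_\<gamma>:
  assumes j: "j < J"
  shows "tracial_exp N (block_embed D j (\<gamma> j \<otimes>\<^sub>m 1\<^sub>m (q j))) = block_embed D j (\<gamma>t j \<otimes>\<^sub>m 1\<^sub>m (q j))"
proof -
  have N: "P j * \<kappa>i \<in> N"
    using block_proj_C[OF j] \<kappa>i_C C_subset_N vn_algebraD(6)[OF vn_N] by blast
  note [simp] = carrier_matD[OF block_proj_carrier[OF j]]
  have "P j * (\<kappa>i * \<rho>) \<in> carrier_mat n n" by simp
  moreover have "tracial_exp N (P j * (\<kappa>i * \<rho>)) = P j * (\<kappa>i * \<rho>N)"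
    using tracial_exp_mult_left[OF vn_N \<rho>_carrier N] by (simp add: \<rho>N_def[symmetric] mat_assoc)
  ultimately show ?thesis
    unfolding embed_forms[OF j] by (simp add: tracial_exp_smult[OF vn_N])
qed

end

theorem theorem1p9:
  fixes n :: nat and M N :: "complex mat set" and \<rho> :: "complex mat" and D :: block_decomp
  assumes "vn_algebra n M" and "vn_algebra n N" and "N \<subseteq> M"
    and "state_on n M \<rho>" and "invertible_mat \<rho>"
    and "decomposes n (ac_fixed M N \<rho>) D"
  shows "\<exists>\<gamma>.
    (left_densities n M D \<rho> \<gamma> \<and>
      (\<forall>\<gamma>'. left_densities n M D \<rho> \<gamma>' \<longrightarrow> (\<forall>j<nblocks D. \<gamma>' j = \<gamma> j))) \<and>
    (\<exists>\<gamma>t.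
      (\<forall>j<nblocks D. \<gamma>t j \<in> carrier_mat (ldim D j) (ldim D j) \<and>
        tracial_exp N (block_embed D j (\<gamma> j \<otimes>\<^sub>m 1\<^sub>m (rdim D j)))
          = block_embed D j (\<gamma>t j \<otimes>\<^sub>m 1\<^sub>m (rdim D j))) \<and>
      tracial_exp N \<rho> = block_sum n D (\<lambda>j. \<gamma>t j \<otimes>\<^sub>m right_marginal D j \<rho>)) \<and>
    (\<forall>\<sigma>. state_on n M \<sigma> \<longrightarrow>
      (petz_recovery N \<rho> (tracial_exp N \<sigma>) = \<sigma> \<longleftrightarrow>
        (\<forall>X\<in>M. mat_tr (\<sigma> * X) = mat_tr (\<sigma> * gns_exp (ac_fixed M N \<rho>) \<rho> X))) \<and>
      (petz_recovery N \<rho> (tracial_exp N \<sigma>) = \<sigma> \<longrightarrow>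
        \<sigma> = block_sum n D (\<lambda>j. \<gamma> j \<otimes>\<^sub>m right_marginal D j \<sigma>)))"
proof -
  have \<rho>: "\<rho> \<in> M" "psd_mat n \<rho>" using assms(4) by (auto simp: state_on_def density_matrix_def)
  have cg: "coarse_graining n M N \<rho>"
    using assms(1-3) \<rho> psd_invertible_pd[OF \<rho>(2) assms(5)] by unfold_locales auto
  interpret fixed_point_decomposition n M N \<rho> D
    using assms(6) vn_algebraD(1)[OF coarse_graining.vn_C[OF cg]] cg
    by (simp add: fixed_point_decomposition_def decomposition_def)
  show ?thesis
  proof (rule exI[of _ \<gamma>], intro exI[of _ \<gamma>t] conjI allI impI)
    show "left_densities n M D \<rho> \<gamma>" by (rule left_densities_\<gamma>)
    show "\<gamma>' j = \<gamma> j" if "left_densities n M D \<rho> \<gamma>'" "j < J" for \<gamma>' j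
      using that by (rule left_densities_unique)
    show "\<gamma>t j \<in> carrier_mat (p j) (p j)" for j by (rule \<gamma>_carrier)
    show "tracial_exp N (block_embed D j (\<gamma> j \<otimes>\<^sub>m 1\<^sub>m (q j))) = block_embed D j (\<gamma>t j \<otimes>\<^sub>m 1\<^sub>m (q j))" if "j < J" for j
      using that by (rule tracial_exp_\<gamma>)
    show "tracial_exp N \<rho> = block_sum n D (\<lambda>j. \<gamma>t j \<otimes>\<^sub>m right_marginal D j \<rho>)"
      using \<rho>N_form by (simp only: \<rho>N_def)
    fix \<sigma> assume "state_on n M \<sigma>"
    then have \<sigma>: "\<sigma> \<in> M" by (simp add: state_on_def)
    show "petz_recovery N \<rho> (tracial_exp N \<sigma>) = \<sigma> \<longleftrightarrow>
        (\<forall>X\<in>M. mat_tr (\<sigma> * X) = mat_tr (\<sigma> * gns_exp (ac_fixed M N \<rho>) \<rho> X))"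
      by (simp only: petz_iff[OF \<sigma>] gns_preserved_iff[OF \<sigma>])
    assume "petz_recovery N \<rho> (tracial_exp N \<sigma>) = \<sigma>"
    then obtain Z where "Z \<in> C" "\<sigma> = \<rho> * Z" using petz_iff[OF \<sigma>] by blast
    then show "\<sigma> = block_sum n D (\<lambda>j. \<gamma> j \<otimes>\<^sub>m right_marginal D j \<sigma>)"
      using recovered_form by simp
  qed
qed

end
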